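(* Let $K=\{x\in\mathbb{R}^n : c_i(x)=0\ (i\in\mathcal{E}),\ c_j(x)\ge 0\ (j\in\mathcal{I})\}$ with polynomials $c_i,c_j\in\mathbb{R}[x]$, let $\mathcal{A}\subseteq\mathbb{N}^n$ be a finite set with $d=\deg(\mathcal{A})$, let $a_1,\dots,a_m\in\mathbb{R}[x]_{\mathcal{A}}$, $b_1,\dots,b_m\in\mathbb{R}$ and $0\le m_1\le m$. Consider the moment system $$(S)\qquad \langle a_i,y\rangle=b_i\ (1\le i\le m_1),\quad \langle a_i,y\rangle\ge b_i\ (m_1<i\le m),\quad y\in\mathscr{R}_{\mathcal{A}}(K),$$ and the closure moment system $(\overline{S})$ obtained from $(S)$ by replacing $y\in\mathscr{R}_{\mathcal{A}}(K)$ by $y\in cl(\mathscr{R}_{\mathcal{A}}(K))$. Let $d_1>d$ be even, let $f\in\mathbb{R}[\tilde{x}]_{d_1}$, and for $k\ge d_1/2$ consider the $k$th order moment relaxation $$(M_k)\qquad \begin{array}{cl}\min & \langle f,w\rangle\\ \text{s.t.} & \langle\hat{a}_i,w\rangle=b_i\ (1\le i\le m_1),\quad \langle\hat{a}_i,w\rangle\ge b_i\ (m_1<i\le m),\\ & L^{(k)}_{\tilde{c}_i}[w]=0\ (i\in\mathcal{E}),\quad L^{(k)}_{\|\tilde{x}\|^2-1}[w]=0,\\ & L^{(k)}_{\tilde{c}_j}[w]\succeq 0\ (j\in\mathcal{I}),\quad L^{(k)}_{x_0}[w]\succeq 0,\\ & M_k[w]\succeq 0,\quad w\in\mathbb{R}^{\mathbb{N}^{n+1}_{2k}}.\end{array}$$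 Then: (i) If $(M_k)$ is infeasible for some order $k$, then $(S)$ is infeasible. (ii) Suppose $K$ is closed at $\infty$ and $H_0\cap int(\mathscr{P}_d(K))\ne\emptyset$, where $H_0=\mathrm{Span}\{a_1,\dots,a_{m_1}\}-\mathrm{Cone}\{a_{m_1+1},\dots,a_m\}$. Then $(\overline{S})$ is infeasible if and only if $(M_k)$ is infeasible for some order $k$. (iii) Suppose $K$ is closed at $\infty$ and $w^*$ is a minimizer of $(M_k)$ such that the truncation $w^*|_{2t}$ (with $2t\ge d$) is flat. Then $(\overline{S})$ is feasible. Moreover, if $\nu$ is the $\widetilde{K}$-representing measure for $w^*|_{2t}$ and $\mathrm{supp}(\nu)\subseteq\{x_0>0\}$, then $(S)$ is also feasible.
   Context: Notation: $x=(x_1,\dots,x_n)$, $\tilde{x}=(x_0,x)$. $\mathcal{E},\mathcal{I}$ are finite label sets. $|\alpha|=\sum\alpha_i$; $\deg(\mathcal{A})=\max\{|\alpha|:\alpha\in\mathcal{A}\}$; $\mathbb{R}[x]_{\mathcal{A}}$ is the span of the monomials $x^\alpha$, $\alpha\in\mathcal{A}$; $\mathbb{R}^{\mathcal{A}}$ is the space of real vectors $(y_\alpha)_{\alpha\in\mathcal{A}}$; $\langle\sum_\alpha p_\alpha x^\alpha,y\rangle=\sum_\alpha p_\alpha y_\alpha$ (likewise for polynomials in $\tilde{x}$). $\mathbb{N}^N_t=\{\alpha\in\mathbb{N}^N:|\alpha|\le t\}$; $\mathbb{R}[x]_t$, $\mathbb{R}[\tilde{x}]_t$ are the spaces of polynomials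 of degree $\le t$. $\mathscr{P}_d(K)=\{p\in\mathbb{R}[x]_d:p\ge 0\text{ on }K\}$, with interior $int$ in $\mathbb{R}[x]_d$. $\mathrm{Span}$ is linear span and $\mathrm{Cone}$ is conic hull. A $K$-representing measure of $y\in\mathbb{R}^{\mathcal{A}}$ is a positive Borel measure $\mu$ on $\mathbb{R}^n$ with support in $K$ and $y_\alpha=\int x^\alpha\,d\mu$ for all $\alpha\in\mathcal{A}$ (zero measure allowed); $\mathscr{R}_{\mathcal{A}}(K)$ is the set of $y\in\mathbb{R}^{\mathcal{A}}$ having a $K$-representing measure. $\widetilde{K}$-representing measures (for vectors labelled by powers in $\mathbb{N}^{n+1}$) are defined in the same way. $cl$ is Euclidean closure and $\mathrm{supp}$ is the support of a measure. For a polynomial $p$, $\tilde{p}(\tilde{x})=x_0^{\deg(p)}p(x/x_0)$ is its homogenization, and $\hat{a}_i(\tilde{x})=x_0^{d}a_i(x/x_0)$ is the degree-$d$ homogenization of $a_i$. Define $$\widetilde{K}^h=\{\tilde{x}\in\mathbb{R}^{n+1}:\tilde{c}_i(\tilde{x})=0\ (i\in\mathcal{E}),\ \tilde{c}_j(\tilde{x})\ge 0\ (j\in\mathcal{I}),\ x_0\ge 0\},$$ $$\widetilde{K}^c=\widetilde{K}^h\cap\{x_0>0\},\qquad \widetilde{K}=\widetilde{K}^h\cap\{x_0^2+x^Tx=1\}.$$ $K$ (with its describing polynomials) is closed at $\infty$ if $cl(\widetilde{K}^c)=\widetilde{K}^h$. For $w\in\mathbb{R}^{\mathbb{N}^{n+1}_{2k}}$,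 $\mathscr{L}_w$ is the linear functional on polynomials of degree $\le 2k$ sending each monomial $\tilde{x}^\beta$ to $w_\beta$. The localizing matrix $L_q^{(k)}[w]$ is the symmetric matrix such that $\mathscr{L}_w(qp^2)=\mathit{vec}(p)^T L_q^{(k)}[w]\,\mathit{vec}(p)$ for all $p\in\mathbb{R}[\tilde{x}]$ with $\deg(qp^2)\le 2k$, where $\mathit{vec}(p)$ is the coefficient vector (constraints on it are vacuous if $\deg q>2k$); $M_k[w]=L_1^{(k)}[w]$. Let $d_K=\max_{i\in\mathcal{E}\cup\mathcal{I}}\{1,\lceil\deg(c_i)/2\rceil\}$. For $t\le k$, $w|_{2t}$ is the subvector of $w$ with labels in $\mathbb{N}^{n+1}_{2t}$; it is flat if $\mathrm{rank}\,M_{t-d_K}[w|_{2t}]=\mathrm{rank}\,M_t[w|_{2t}]$ (here $t\ge d_K$). By the Curto–Fialkow flat extension theorem, for $w$ feasible for $(M_k)$ a flat $w|_{2t}$ admits a unique $\widetilde{K}$-representing measure. *)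

theory Defs
  imports "HOL-Analysis.Analysis" "HOL-Analysis.Finite_Function_Topology"
begin

section \<open>Polynomials and moment vectors\<close>

text \<open>
  The variables \<open>x\<close> are indexed by a finite type \<open>'n\<close>, and the variables \<open>(x\<^sub>0, x)\<close> by
  \<open>'n option\<close>, with \<open>None\<close> the index of \<open>x\<^sub>0\<close>.  Exponents are functions \<open>'n \<Rightarrow>\<^sub>0 nat\<close>.
  A polynomial is its family of coefficients; multiplication on \<open>\<Rightarrow>\<^sub>0\<close> is convolution.
  Vectors labelled by a finite set \<open>A\<close> of exponents have the same type: they are extended by zero
  outside \<open>A\<close>.  The library norm on \<open>\<Rightarrow>\<^sub>0\<close> is the l1-norm, which on the finite-dimensional spaces
  considered here induces the Euclidean topology.
\<close>

type_synonym 'n exponent = "'n \<Rightarrow>\<^sub>0 nat"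
type_synonym 'n mpoly = "('n \<Rightarrow>\<^sub>0 nat) \<Rightarrow>\<^sub>0 real"
type_synonym 'n mvec = "('n \<Rightarrow>\<^sub>0 nat) \<Rightarrow>\<^sub>0 real"

abbreviation mcoeff :: "'n mpoly \<Rightarrow> 'n exponent \<Rightarrow> real"
  where "mcoeff \<equiv> Poly_Mapping.lookup"

abbreviation mmonom :: "'n exponent \<Rightarrow> 'n mpoly"
  where "mmonom \<alpha> \<equiv> Poly_Mapping.single \<alpha> 1"

abbreviation var :: "'n \<Rightarrow> 'n mpoly"
  where "var i \<equiv> mmonom (Poly_Mapping.single i 1)"

definition mdeg :: "'n::finite exponent \<Rightarrow> nat"
  where "mdeg \<alpha> = (\<Sum>i\<in>UNIV. Poly_Mapping.lookup \<alpha> i)"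

text \<open>On \<open>nat\<close>, \<open>Sup\<close> of a nonempty finite set is its maximum, and \<open>Sup {} = 0\<close>.\<close>

definition set_deg :: "'n::finite exponent set \<Rightarrow> nat"
  where "set_deg A = (SUP \<alpha>\<in>A. mdeg \<alpha>)"

definition tdeg :: "'n::finite mpoly \<Rightarrow> nat"
  where "tdeg p = set_deg (Poly_Mapping.keys p)"

definition exps :: "nat \<Rightarrow> 'n::finite exponent set"
  where "exps t = {\<alpha>. mdeg \<alpha> \<le> t}"

definition poly_space :: "'n exponent set \<Rightarrow> 'n mpoly set"
  where "poly_space A = span (mmonom ` A)"

definition polys :: "nat \<Rightarrow> 'n::finite mpoly set"
  where "polys t = {p. tdeg p \<le> t}"

definition mvecs :: "'n exponent set \<Rightarrow> 'n mvec set"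
  where "mvecs A = {y. Poly_Mapping.keys y \<subseteq> A}"

definition truncate :: "nat \<Rightarrow> 'n::finite mvec \<Rightarrow> 'n mvec"
  where "truncate s w =
    (\<Sum>\<beta>\<in>Poly_Mapping.keys w \<inter> exps s. Poly_Mapping.single \<beta> (Poly_Mapping.lookup w \<beta>))"

text \<open>\<open>pairing p w\<close> is also the value at \<open>p\<close> of the Riesz functional of \<open>w\<close>.\<close>

definition pairing :: "'n mpoly \<Rightarrow> 'n mvec \<Rightarrow> real"
  where "pairing p y = (\<Sum>\<alpha>\<in>Poly_Mapping.keys p. mcoeff p \<alpha> * Poly_Mapping.lookup y \<alpha>)"

definition mono_eval :: "'n::finite exponent \<Rightarrow> real ^ 'n \<Rightarrow> real"
  where "mono_eval \<alpha> x = (\<Prod>i\<in>UNIV. (x $ i) ^ Poly_Mapping.lookup \<alpha> i)"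

definition poly_eval :: "'n::finite mpoly \<Rightarrow> real ^ 'n \<Rightarrow> real"
  where "poly_eval p x = (\<Sum>\<alpha>\<in>Poly_Mapping.keys p. mcoeff p \<alpha> * mono_eval \<alpha> x)"


section \<open>Homogenization\<close>

text \<open>
  \<open>homog_exp e \<alpha>\<close> is the exponent of \<open>x\<^sub>0 ^ (e - |\<alpha>|) * x ^ \<alpha>\<close>; it is only used for \<open>|\<alpha>| \<le> e\<close>.
  The lemma \<open>poly_eval_homogenize\<close> below says that \<open>homogenize e p\<close> is \<open>x\<^sub>0 ^ e * p (x / x\<^sub>0)\<close>.
\<close>

definition homog_exp :: "nat \<Rightarrow> 'n::finite exponent \<Rightarrow> 'n option exponent"
  where "homog_exp e \<alpha> = Poly_Mapping.single None (e - mdeg \<alpha>)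
    + (\<Sum>i\<in>UNIV. Poly_Mapping.single (Some i) (Poly_Mapping.lookup \<alpha> i))"

definition homogenize :: "nat \<Rightarrow> 'n::finite mpoly \<Rightarrow> 'n option mpoly"
  where "homogenize e p =
    (\<Sum>\<alpha>\<in>Poly_Mapping.keys p. Poly_Mapping.single (homog_exp e \<alpha>) (mcoeff p \<alpha>))"

definition homogenization :: "'n::finite mpoly \<Rightarrow> 'n option mpoly"
  where "homogenization p = homogenize (tdeg p) p"

lemma mdeg_le_tdeg:
  assumes "\<alpha> \<in> Poly_Mapping.keys p"
  shows "mdeg \<alpha> \<le> tdeg p"
  unfolding tdeg_def set_deg_def using assms by (intro cSUP_upper) auto

lemma tdeg_le_iff: "tdeg p \<le> t \<longleftrightarrow> Poly_Mapping.keys p \<subseteq> exps t"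
proof
  assume "tdeg p \<le> t"
  then show "Poly_Mapping.keys p \<subseteq> exps t"
    using mdeg_le_tdeg[of _ p] by (force simp: exps_def)
next
  assume *: "Poly_Mapping.keys p \<subseteq> exps t"
  show "tdeg p \<le> t"
  proof (cases "Poly_Mapping.keys p = {}")
    case True
    then show ?thesis by (simp add: tdeg_def set_deg_def Sup_nat_def)
  next
    case False
    then show ?thesis
      unfolding tdeg_def set_deg_def using * by (intro cSUP_least) (auto simp: exps_def)
  qed
qed

lemma poly_eval_superset:
  assumes "finite S" "Poly_Mapping.keys p \<subseteq> S"
  shows "poly_eval p x = (\<Sum>\<alpha>\<in>S. mcoeff p \<alpha> * mono_eval \<alpha> x)"
  unfolding poly_eval_def using assms
  by (intro sum.mono_neutral_left) (auto simp: in_keys_iff)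

lemma poly_eval_add: "poly_eval (p + q) x = poly_eval p x + poly_eval q x"
proof -
  let ?S = "Poly_Mapping.keys p \<union> Poly_Mapping.keys q"
  have "poly_eval (p + q) x = (\<Sum>\<alpha>\<in>?S. mcoeff (p + q) \<alpha> * mono_eval \<alpha> x)"
    by (rule poly_eval_superset) (auto simp: Poly_Mapping.keys_add)
  moreover have "poly_eval p x = (\<Sum>\<alpha>\<in>?S. mcoeff p \<alpha> * mono_eval \<alpha> x)"
    by (rule poly_eval_superset) auto
  moreover have "poly_eval q x = (\<Sum>\<alpha>\<in>?S. mcoeff q \<alpha> * mono_eval \<alpha> x)"
    by (rule poly_eval_superset) auto
  ultimately show ?thesis
    by (simp add: lookup_add ring_distribs sum.distrib)
qed

lemma poly_eval_sum: "poly_eval (sum f S) x = (\<Sum>i\<in>S. poly_eval (f i) x)"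
proof (induction S rule: infinite_finite_induct)
  case (insert i S)
  then show ?case by (simp add: poly_eval_add)
qed (simp_all add: poly_eval_def)

lemma poly_eval_single: "poly_eval (Poly_Mapping.single \<alpha> r) x = r * mono_eval \<alpha> x"
  by (cases "r = 0") (simp_all add: poly_eval_def)

lemma lookup_homog_exp:
  "Poly_Mapping.lookup (homog_exp e \<alpha>) None = e - mdeg \<alpha>"
  "Poly_Mapping.lookup (homog_exp e \<alpha>) (Some i) = Poly_Mapping.lookup \<alpha> i"
  by (simp_all add: homog_exp_def lookup_add lookup_sum lookup_single when_def)

lemma mono_eval_homog_exp:
  fixes z :: "real ^ ('n::finite) option"
  assumes "z $ None \<noteq> 0" "mdeg \<alpha> \<le> e"
  shows "mono_eval (homog_exp e \<alpha>) z
    = (z $ None) ^ e * mono_eval \<alpha> (\<chi> i. z $ Some i / z $ None)"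
proof -
  have "mono_eval (homog_exp e \<alpha>) z
      = (z $ None) ^ (e - mdeg \<alpha>) * (\<Prod>i\<in>UNIV. (z $ Some i) ^ Poly_Mapping.lookup \<alpha> i)"
    by (simp add: mono_eval_def UNIV_option_conv lookup_homog_exp prod.reindex)
  also have "(z $ None) ^ (e - mdeg \<alpha>) = (z $ None) ^ e / (z $ None) ^ mdeg \<alpha>"
    using assms by (simp add: power_diff)
  also have "(z $ None) ^ mdeg \<alpha> = (\<Prod>i\<in>UNIV. (z $ None) ^ Poly_Mapping.lookup \<alpha> i)"
    by (simp add: mdeg_def power_sum)
  finally show ?thesis
    by (simp add: mono_eval_def power_divide prod_dividef)
qed

lemma poly_eval_homogenize:
  fixes z :: "real ^ ('n::finite) option"
  assumes "z $ None \<noteq> 0" "tdeg p \<le> e"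
  shows "poly_eval (homogenize e p) z
    = (z $ None) ^ e * poly_eval p (\<chi> i. z $ Some i / z $ None)"
proof -
  have "poly_eval (homogenize e p) z
      = (\<Sum>\<alpha>\<in>Poly_Mapping.keys p. mcoeff p \<alpha> * mono_eval (homog_exp e \<alpha>) z)"
    by (simp add: homogenize_def poly_eval_sum poly_eval_single)
  also have "\<dots> = (\<Sum>\<alpha>\<in>Poly_Mapping.keys p. mcoeff p \<alpha> *
      ((z $ None) ^ e * mono_eval \<alpha> (\<chi> i. z $ Some i / z $ None)))"
    using assms mdeg_le_tdeg[of _ p]
    by (intro sum.cong refl arg_cong2[where f = "(*)"] mono_eval_homog_exp) (auto intro: order_trans)
  finally show ?thesis
    by (simp add: poly_eval_def sum_distrib_left mult_ac)
qed


section \<open>The sets\<close>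

definition semialg :: "'l set \<Rightarrow> 'l set \<Rightarrow> ('l \<Rightarrow> 'n::finite mpoly) \<Rightarrow> (real ^ 'n) set"
  where "semialg E I c =
    {x. (\<forall>i\<in>E. poly_eval (c i) x = 0) \<and> (\<forall>j\<in>I. poly_eval (c j) x \<ge> 0)}"

definition semialg_h :: "'l set \<Rightarrow> 'l set \<Rightarrow> ('l \<Rightarrow> 'n::finite mpoly) \<Rightarrow> (real ^ 'n option) set"
  where "semialg_h E I c =
    {z. (\<forall>i\<in>E. poly_eval (homogenization (c i)) z = 0)
      \<and> (\<forall>j\<in>I. poly_eval (homogenization (c j)) z \<ge> 0) \<and> z $ None \<ge> 0}"

definition semialg_c :: "'l set \<Rightarrow> 'l set \<Rightarrow> ('l \<Rightarrow> 'n::finite mpoly) \<Rightarrow> (real ^ 'n option) set"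
  where "semialg_c E I c = semialg_h E I c \<inter> {z. z $ None > 0}"

definition semialg_tilde :: "'l set \<Rightarrow> 'l set \<Rightarrow> ('l \<Rightarrow> 'n::finite mpoly) \<Rightarrow> (real ^ 'n option) set"
  where "semialg_tilde E I c =
    semialg_h E I c \<inter> {z. (z $ None)\<^sup>2 + (\<Sum>i\<in>UNIV. (z $ Some i)\<^sup>2) = 1}"

definition closed_at_infinity :: "'l set \<Rightarrow> 'l set \<Rightarrow> ('l \<Rightarrow> 'n::finite mpoly) \<Rightarrow> bool"
  where "closed_at_infinity E I c \<longleftrightarrow> closure (semialg_c E I c) = semialg_h E I c"

definition nonneg_polys :: "nat \<Rightarrow> (real ^ 'n::finite) set \<Rightarrow> 'n mpoly set"
  where "nonneg_polys d K = {p \<in> polys d. \<forall>x\<in>K. poly_eval p x \<ge> 0}"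

definition int_nonneg_polys :: "nat \<Rightarrow> (real ^ 'n::finite) set \<Rightarrow> 'n mpoly set"
  where "int_nonneg_polys d K = (top_of_set (polys d)) interior_of (nonneg_polys d K)"


section \<open>Representing measures and moment systems\<close>

definition supp :: "'a::topological_space measure \<Rightarrow> 'a set"
  where "supp M = {x. \<forall>U. open U \<and> x \<in> U \<longrightarrow> emeasure M U \<noteq> 0}"

definition representing_measure ::
    "'n::finite exponent set \<Rightarrow> (real ^ 'n) set \<Rightarrow> 'n mvec \<Rightarrow> (real ^ 'n) measure \<Rightarrow> bool"
  where "representing_measure A K y \<mu> \<longleftrightarrow>
    sets \<mu> = sets borel \<and> supp \<mu> \<subseteq> K \<and>
    (\<forall>\<alpha>\<in>A. integrable \<mu> (mono_eval \<alpha>) \<and>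
      Poly_Mapping.lookup y \<alpha> = (\<integral>x. mono_eval \<alpha> x \<partial>\<mu>))"

definition moment_cone :: "'n::finite exponent set \<Rightarrow> (real ^ 'n) set \<Rightarrow> 'n mvec set"
  where "moment_cone A K = {y \<in> mvecs A. \<exists>\<mu>. representing_measure A K y \<mu>}"

text \<open>
  The common linear constraints of the moment systems and their relaxations; \<open>a\<close> and \<open>b\<close> are
  used at the indices \<open>1, \<dots>, m\<close> only, the first \<open>m1\<close> of which are equalities.
\<close>

definition lin_constraints ::
    "nat \<Rightarrow> nat \<Rightarrow> (nat \<Rightarrow> 'n mpoly) \<Rightarrow> (nat \<Rightarrow> real) \<Rightarrow> 'n mvec \<Rightarrow> bool"
  where "lin_constraints m1 m a b y \<longleftrightarrow>
    (\<forall>i\<in>{1..m1}. pairing (a i) y = b i) \<and> (\<forall>i\<in>{m1<..m}. pairing (a i) y \<ge> b i)"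

definition moment_system ::
    "nat \<Rightarrow> nat \<Rightarrow> (nat \<Rightarrow> 'n::finite mpoly) \<Rightarrow> (nat \<Rightarrow> real) \<Rightarrow>
      'n exponent set \<Rightarrow> (real ^ 'n) set \<Rightarrow> 'n mvec set"
  where "moment_system m1 m a b A K = {y \<in> moment_cone A K. lin_constraints m1 m a b y}"

definition closure_moment_system ::
    "nat \<Rightarrow> nat \<Rightarrow> (nat \<Rightarrow> 'n::finite mpoly) \<Rightarrow> (nat \<Rightarrow> real) \<Rightarrow>
      'n exponent set \<Rightarrow> (real ^ 'n) set \<Rightarrow> 'n mvec set"
  where "closure_moment_system m1 m a b A K =
    {y \<in> closure (moment_cone A K). lin_constraints m1 m a b y}"

definition span_minus_cone :: "nat \<Rightarrow> nat \<Rightarrow> (nat \<Rightarrow> 'n mpoly) \<Rightarrow> 'n mpoly set"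
  where "span_minus_cone m1 m a =
    {p - q | p q. p \<in> span (a ` {1..m1}) \<and> q \<in> convex_cone hull (a ` {m1<..m})}"


section \<open>Localizing matrices\<close>

text \<open>
  Matrices are functions of two exponents, zero outside a finite index set.  For nonzero \<open>q\<close> and
  \<open>p\<close>, the degree of \<open>q * p\<^sup>2\<close> is \<open>tdeg q + 2 * tdeg p\<close>, so \<open>loc_index q k\<close> is the set of
  exponents that may occur in a polynomial \<open>p\<close> with \<open>deg (q * p\<^sup>2) \<le> 2 * k\<close>; it is empty if the
  degree of \<open>q\<close> exceeds \<open>2 * k\<close>.
\<close>

definition loc_index :: "'n::finite mpoly \<Rightarrow> nat \<Rightarrow> 'n exponent set"
  where "loc_index q k = {\<beta>. tdeg q + 2 * mdeg \<beta> \<le> 2 * k}"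

definition is_loc_matrix ::
    "'n::finite mpoly \<Rightarrow> nat \<Rightarrow> 'n mvec \<Rightarrow> ('n exponent \<Rightarrow> 'n exponent \<Rightarrow> real) \<Rightarrow> bool"
  where "is_loc_matrix q k w L \<longleftrightarrow>
    (\<forall>\<beta> \<gamma>. L \<beta> \<gamma> = L \<gamma> \<beta>) \<and>
    (\<forall>\<beta> \<gamma>. \<beta> \<notin> loc_index q k \<longrightarrow> L \<beta> \<gamma> = 0) \<and>
    (\<forall>p. tdeg q + 2 * tdeg p \<le> 2 * k \<longrightarrow>
      pairing (q * p\<^sup>2) w
        = (\<Sum>\<beta>\<in>loc_index q k. \<Sum>\<gamma>\<in>loc_index q k. mcoeff p \<beta> * L \<beta> \<gamma> * mcoeff p \<gamma>))"

definition loc_matrix ::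
    "'n::finite mpoly \<Rightarrow> nat \<Rightarrow> 'n mvec \<Rightarrow> 'n exponent \<Rightarrow> 'n exponent \<Rightarrow> real"
  where "loc_matrix q k w = (THE L. is_loc_matrix q k w L)"

definition moment_matrix :: "nat \<Rightarrow> 'n::finite mvec \<Rightarrow> 'n exponent \<Rightarrow> 'n exponent \<Rightarrow> real"
  where "moment_matrix k w = loc_matrix 1 k w"

definition psd_on :: "'i set \<Rightarrow> ('i \<Rightarrow> 'i \<Rightarrow> real) \<Rightarrow> bool"
  where "psd_on B L \<longleftrightarrow>
    (\<forall>\<beta>\<in>B. \<forall>\<gamma>\<in>B. L \<beta> \<gamma> = L \<gamma> \<beta>) \<and>
    (\<forall>v. 0 \<le> (\<Sum>\<beta>\<in>B. \<Sum>\<gamma>\<in>B. v \<beta> * L \<beta> \<gamma> * v \<gamma>))"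

definition rank_on :: "'i set \<Rightarrow> ('i \<Rightarrow> 'i \<Rightarrow> real) \<Rightarrow> nat"
  where "rank_on B L = dim ((\<lambda>\<gamma>. \<Sum>\<beta>\<in>B. Poly_Mapping.single \<beta> (L \<beta> \<gamma>)) ` B)"

lemma finite_exps [simp]: "finite (exps t :: 'n::finite exponent set)"
proof -
  have "Poly_Mapping.lookup ` (exps t :: 'n exponent set) \<subseteq> (UNIV :: 'n set) \<rightarrow>\<^sub>E {..t}"
  proof -
    have "Poly_Mapping.lookup \<alpha> i \<le> mdeg \<alpha>" for \<alpha> :: "'n exponent" and i
      unfolding mdeg_def by (rule member_le_sum) auto
    then show ?thesis by (auto simp: exps_def intro: order_trans)
  qed
  moreover have "finite ((UNIV :: 'n set) \<rightarrow>\<^sub>E {..t})"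
    by (intro finite_PiE) auto
  ultimately have "finite (Poly_Mapping.lookup ` (exps t :: 'n exponent set))"
    by (rule finite_subset)
  moreover have "inj_on Poly_Mapping.lookup (exps t :: 'n exponent set)"
    by (rule inj_onI, rule poly_mapping_eqI) simp
  ultimately show ?thesis by (rule finite_imageD)
qed

lemma finite_loc_index [simp]: "finite (loc_index q k)"
  by (rule finite_subset[OF _ finite_exps[of k]]) (auto simp: loc_index_def exps_def)

lemma pairing_superset:
  assumes "finite S" "Poly_Mapping.keys p \<subseteq> S"
  shows "pairing p y = (\<Sum>\<alpha>\<in>S. mcoeff p \<alpha> * Poly_Mapping.lookup y \<alpha>)"
  unfolding pairing_def using assms
  by (intro sum.mono_neutral_left) (auto simp: in_keys_iff)

lemma pairing_add: "pairing (p + q) y = pairing p y + pairing q y"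
proof -
  let ?S = "Poly_Mapping.keys p \<union> Poly_Mapping.keys q"
  have "pairing (p + q) y = (\<Sum>\<alpha>\<in>?S. mcoeff (p + q) \<alpha> * Poly_Mapping.lookup y \<alpha>)"
    by (rule pairing_superset) (auto simp: Poly_Mapping.keys_add)
  moreover have "pairing p y = (\<Sum>\<alpha>\<in>?S. mcoeff p \<alpha> * Poly_Mapping.lookup y \<alpha>)"
    by (rule pairing_superset) auto
  moreover have "pairing q y = (\<Sum>\<alpha>\<in>?S. mcoeff q \<alpha> * Poly_Mapping.lookup y \<alpha>)"
    by (rule pairing_superset) auto
  ultimately show ?thesis
    by (simp add: lookup_add ring_distribs sum.distrib)
qed

lemma pairing_sum: "pairing (sum f S) y = (\<Sum>i\<in>S. pairing (f i) y)"
proof (induction S rule: infinite_finite_induct)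
  case (insert i S)
  then show ?case by (simp add: pairing_add)
qed (simp_all add: pairing_def)

lemma pairing_scaleR: "pairing (r *\<^sub>R p) y = r * pairing p y"
proof -
  have l: "mcoeff (r *\<^sub>R p) \<alpha> = r * mcoeff p \<alpha>" for \<alpha>
    by (simp add: scaleR_poly_mapping_def)
  have "pairing (r *\<^sub>R p) y
      = (\<Sum>\<alpha>\<in>Poly_Mapping.keys p. mcoeff (r *\<^sub>R p) \<alpha> * Poly_Mapping.lookup y \<alpha>)"
    by (rule pairing_superset) (auto simp: in_keys_iff l)
  then show ?thesis by (simp add: pairing_def l sum_distrib_left mult_ac)
qed

lemma poly_mapping_sum_monom:
  assumes "finite S" "Poly_Mapping.keys p \<subseteq> S"
  shows "p = (\<Sum>\<beta>\<in>S. Poly_Mapping.single \<beta> (mcoeff p \<beta>))"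
proof (rule poly_mapping_eqI)
  fix k
  show "mcoeff p k = mcoeff (\<Sum>\<beta>\<in>S. Poly_Mapping.single \<beta> (mcoeff p \<beta>)) k"
    using assms by (cases "k \<in> S") (auto simp: lookup_sum lookup_single when_def in_keys_iff)
qed

lemma mult_single_scaleR:
  fixes q :: "'n mpoly"
  shows "q * Poly_Mapping.single \<beta> r = r *\<^sub>R (q * mmonom \<beta>)"
proof -
  have "Poly_Mapping.single 0 r * p = r *\<^sub>R p" for p :: "'n mpoly"
    by (rule poly_mapping_eqI)
      (simp add: mult_map_scale_conv_mult[symmetric] Poly_Mapping.map.rep_eq
        scaleR_poly_mapping_def when_def)
  moreover have "Poly_Mapping.single \<beta> r = Poly_Mapping.single 0 r * mmonom \<beta>"
    by (simp add: mult_single)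
  ultimately show ?thesis by (metis mult.left_commute)
qed

lemma pairing_quadratic:
  assumes "finite S" "Poly_Mapping.keys p \<subseteq> S"
  shows "pairing (q * p\<^sup>2) w
    = (\<Sum>\<beta>\<in>S. \<Sum>\<gamma>\<in>S. mcoeff p \<beta> * pairing (q * mmonom (\<beta> + \<gamma>)) w * mcoeff p \<gamma>)"
proof -
  have "p\<^sup>2 = (\<Sum>\<beta>\<in>S. Poly_Mapping.single \<beta> (mcoeff p \<beta>))
      * (\<Sum>\<gamma>\<in>S. Poly_Mapping.single \<gamma> (mcoeff p \<gamma>))"
    using poly_mapping_sum_monom[OF assms] by (metis power2_eq_square)
  also have "\<dots> = (\<Sum>\<beta>\<in>S. \<Sum>\<gamma>\<in>S. Poly_Mapping.single (\<beta> + \<gamma>) (mcoeff p \<beta> * mcoeff p \<gamma>))"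
    by (simp add: sum_product mult_single)
  finally have "q * p\<^sup>2
      = (\<Sum>\<beta>\<in>S. \<Sum>\<gamma>\<in>S. q * Poly_Mapping.single (\<beta> + \<gamma>) (mcoeff p \<beta> * mcoeff p \<gamma>))"
    by (simp add: sum_distrib_left)
  also have "\<dots> = (\<Sum>\<beta>\<in>S. \<Sum>\<gamma>\<in>S. (mcoeff p \<beta> * mcoeff p \<gamma>) *\<^sub>R (q * mmonom (\<beta> + \<gamma>)))"
    by (subst mult_single_scaleR) (rule refl)
  finally show ?thesis
    by (simp add: pairing_sum pairing_scaleR mult_ac)
qed

lemma loc_index_keys:
  assumes "tdeg q + 2 * tdeg p \<le> 2 * k"
  shows "Poly_Mapping.keys p \<subseteq> loc_index q k"
  using assms mdeg_le_tdeg[of _ p] by (fastforce simp: loc_index_def)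

lemma tdeg_loc_index:
  assumes "Poly_Mapping.keys p \<subseteq> loc_index q k" "p \<noteq> 0"
  shows "tdeg q + 2 * tdeg p \<le> 2 * k"
proof -
  obtain \<alpha> where \<alpha>: "\<alpha> \<in> loc_index q k"
    using assms by (metis poly_mapping_eqI in_keys_iff lookup_zero subsetD)
  then have 1: "tdeg q \<le> 2 * k" by (simp add: loc_index_def)
  have "Poly_Mapping.keys p \<subseteq> exps ((2 * k - tdeg q) div 2)"
    using assms(1) by (force simp: loc_index_def exps_def)
  then have "tdeg p \<le> (2 * k - tdeg q) div 2" by (simp add: tdeg_le_iff)
  then show ?thesis using 1 by linarith
qed

lemma quadratic_restrict:
  assumes "finite B" "S \<subseteq> B" "Poly_Mapping.keys p \<subseteq> S"
  shows "(\<Sum>\<beta>\<in>B. \<Sum>\<gamma>\<in>B. mcoeff p \<beta> * N \<beta> \<gamma> * mcoeff p \<gamma>)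
    = (\<Sum>\<beta>\<in>S. \<Sum>\<gamma>\<in>S. mcoeff p \<beta> * N \<beta> \<gamma> * mcoeff p \<gamma>)"
proof -
  have z: "mcoeff p \<beta> = 0" if "\<beta> \<in> B - S" for \<beta>
    using that assms(3) by (auto simp: in_keys_iff)
  have "(\<Sum>\<gamma>\<in>B. mcoeff p \<beta> * N \<beta> \<gamma> * mcoeff p \<gamma>)
      = (\<Sum>\<gamma>\<in>S. mcoeff p \<beta> * N \<beta> \<gamma> * mcoeff p \<gamma>)" for \<beta>
    by (rule sum.mono_neutral_right[OF assms(1,2)]) (simp add: z)
  then have "(\<Sum>\<beta>\<in>B. \<Sum>\<gamma>\<in>B. mcoeff p \<beta> * N \<beta> \<gamma> * mcoeff p \<gamma>)
      = (\<Sum>\<beta>\<in>B. \<Sum>\<gamma>\<in>S. mcoeff p \<beta> * N \<beta> \<gamma> * mcoeff p \<gamma>)"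
    by simp
  also have "\<dots> = (\<Sum>\<beta>\<in>S. \<Sum>\<gamma>\<in>S. mcoeff p \<beta> * N \<beta> \<gamma> * mcoeff p \<gamma>)"
    by (rule sum.mono_neutral_right[OF assms(1,2)]) (simp add: z)
  finally show ?thesis .
qed

lemma is_loc_matrix_unique:
  assumes L: "is_loc_matrix q k w L"
  shows "L \<beta> \<gamma> =
    (if \<beta> \<in> loc_index q k \<and> \<gamma> \<in> loc_index q k then pairing (q * mmonom (\<beta> + \<gamma>)) w else 0)"
proof -
  let ?B = "loc_index q k"
  let ?M = "\<lambda>\<beta> \<gamma>. pairing (q * mmonom (\<beta> + \<gamma>)) w"
  have sym: "L \<beta> \<gamma> = L \<gamma> \<beta>" and out: "\<beta> \<notin> ?B \<Longrightarrow> L \<beta> \<gamma> = 0" for \<beta> \<gamma>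
    using L unfolding is_loc_matrix_def by blast+
  have quad: "(\<Sum>\<beta>\<in>?B. \<Sum>\<gamma>\<in>?B. mcoeff p \<beta> * L \<beta> \<gamma> * mcoeff p \<gamma>)
      = (\<Sum>\<beta>\<in>?B. \<Sum>\<gamma>\<in>?B. mcoeff p \<beta> * ?M \<beta> \<gamma> * mcoeff p \<gamma>)"
    if "Poly_Mapping.keys p \<subseteq> ?B" "p \<noteq> 0" for p
  proof -
    have "pairing (q * p\<^sup>2) w = (\<Sum>\<beta>\<in>?B. \<Sum>\<gamma>\<in>?B. mcoeff p \<beta> * L \<beta> \<gamma> * mcoeff p \<gamma>)"
      using L tdeg_loc_index[OF that] unfolding is_loc_matrix_def by blast
    then show ?thesis using pairing_quadratic[OF finite_loc_index that(1)] by simp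
  qed
  have diag: "L \<beta> \<beta> = ?M \<beta> \<beta>" if "\<beta> \<in> ?B" for \<beta>
  proof -
    have *: "(\<Sum>\<beta>'\<in>?B. \<Sum>\<gamma>'\<in>?B. mcoeff (mmonom \<beta>) \<beta>' * N \<beta>' \<gamma>' * mcoeff (mmonom \<beta>) \<gamma>') = N \<beta> \<beta>"
      for N :: "'a exponent \<Rightarrow> 'a exponent \<Rightarrow> real"
      using that by (subst quadratic_restrict[of _ "{\<beta>}"]) auto
    have "mmonom \<beta> \<noteq> (0 :: 'a mpoly)"
      by (metis keys_single keys_zero insert_not_empty zero_neq_one)
    then show ?thesis using quad[of "mmonom \<beta>"] that by (simp add: *)
  qed
  have off: "L \<beta> \<gamma> = ?M \<beta> \<gamma>" if B: "\<beta> \<in> ?B" "\<gamma> \<in> ?B" "\<beta> \<noteq> \<gamma>"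
  proof -
    let ?p = "mmonom \<beta> + mmonom \<gamma> :: 'a mpoly"
    have co: "mcoeff ?p \<delta> = (if \<delta> = \<beta> then 1 else 0) + (if \<delta> = \<gamma> then 1 else 0)" for \<delta>
      by (auto simp: lookup_add lookup_single when_def)
    have keys0: "Poly_Mapping.keys ?p \<subseteq> {\<beta>, \<gamma>}"
      using Poly_Mapping.keys_add[of "mmonom \<beta>" "mmonom \<gamma> :: 'a mpoly"] by auto
    then have keys: "Poly_Mapping.keys ?p \<subseteq> ?B"
      using B by blast
    have *: "(\<Sum>\<beta>'\<in>?B. \<Sum>\<gamma>'\<in>?B. mcoeff ?p \<beta>' * N \<beta>' \<gamma>' * mcoeff ?p \<gamma>')
        = N \<beta> \<beta> + N \<beta> \<gamma> + (N \<gamma> \<beta> + N \<gamma> \<gamma>)" for N :: "'a exponent \<Rightarrow> 'a exponent \<Rightarrow> real"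
      using B by (subst quadratic_restrict[OF finite_loc_index _ keys0]) (auto simp: co)
    have "mcoeff ?p \<beta> \<noteq> 0" by (simp add: co)
    then have nz: "?p \<noteq> 0" by fastforce
    have "L \<beta> \<beta> + L \<beta> \<gamma> + (L \<gamma> \<beta> + L \<gamma> \<gamma>)
        = ?M \<beta> \<beta> + ?M \<beta> \<gamma> + (?M \<gamma> \<beta> + ?M \<gamma> \<gamma>)"
      using quad[OF keys nz] unfolding * .
    then show ?thesis
      using diag[OF B(1)] diag[OF B(2)] sym[of \<beta> \<gamma>] by (simp add: add.commute)
  qed
  show ?thesis using diag off out sym by metis
qed

lemma is_loc_matrix_exists:
  "is_loc_matrix q k w (\<lambda>\<beta> \<gamma>. if \<beta> \<in> loc_index q k \<and> \<gamma> \<in> loc_index q k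
     then pairing (q * mmonom (\<beta> + \<gamma>)) w else 0)"
proof -
  let ?B = "loc_index q k"
  let ?N = "\<lambda>\<beta> \<gamma>. if \<beta> \<in> ?B \<and> \<gamma> \<in> ?B then pairing (q * mmonom (\<beta> + \<gamma>)) w else 0"
  have "pairing (q * p\<^sup>2) w = (\<Sum>\<beta>\<in>?B. \<Sum>\<gamma>\<in>?B. mcoeff p \<beta> * ?N \<beta> \<gamma> * mcoeff p \<gamma>)"
    if "tdeg q + 2 * tdeg p \<le> 2 * k" for p
    using pairing_quadratic[OF finite_loc_index loc_index_keys[OF that]] by simp
  then show ?thesis
    unfolding is_loc_matrix_def by (auto simp: add.commute)
qed

lemma loc_matrix_eq:
  "loc_matrix q k w = (\<lambda>\<beta> \<gamma>. if \<beta> \<in> loc_index q k \<and> \<gamma> \<in> loc_index q k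
     then pairing (q * mmonom (\<beta> + \<gamma>)) w else 0)"
  unfolding loc_matrix_def
  by (rule the_equality, rule is_loc_matrix_exists) (intro ext is_loc_matrix_unique)


section \<open>The relaxations\<close>

text \<open>\<open>d\<close> is the degree used to homogenize the \<open>a i\<close>.\<close>

definition relax_feasible ::
    "'l set \<Rightarrow> 'l set \<Rightarrow> ('l \<Rightarrow> 'n::finite mpoly) \<Rightarrow> nat \<Rightarrow> nat \<Rightarrow> (nat \<Rightarrow> 'n mpoly) \<Rightarrow>
      (nat \<Rightarrow> real) \<Rightarrow> nat \<Rightarrow> nat \<Rightarrow> 'n option mvec set"
  where "relax_feasible E I c m1 m a b d k =
    {w \<in> mvecs (exps (2 * k)).
      lin_constraints m1 m (\<lambda>i. homogenize d (a i)) b w \<and>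
      (\<forall>i\<in>E. loc_matrix (homogenization (c i)) k w = (\<lambda>_ _. 0)) \<and>
      loc_matrix ((\<Sum>i\<in>UNIV. (var i)\<^sup>2) - 1) k w = (\<lambda>_ _. 0) \<and>
      (\<forall>j\<in>I. psd_on (loc_index (homogenization (c j)) k) (loc_matrix (homogenization (c j)) k w)) \<and>
      psd_on (loc_index (var None) k) (loc_matrix (var None) k w) \<and>
      psd_on (exps k) (moment_matrix k w)}"

definition relax_minimizer ::
    "'l set \<Rightarrow> 'l set \<Rightarrow> ('l \<Rightarrow> 'n::finite mpoly) \<Rightarrow> nat \<Rightarrow> nat \<Rightarrow> (nat \<Rightarrow> 'n mpoly) \<Rightarrow>
      (nat \<Rightarrow> real) \<Rightarrow> nat \<Rightarrow> 'n option mpoly \<Rightarrow> nat \<Rightarrow> 'n option mvec \<Rightarrow> bool"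
  where "relax_minimizer E I c m1 m a b d f k w \<longleftrightarrow>
    w \<in> relax_feasible E I c m1 m a b d k \<and>
    (\<forall>v\<in>relax_feasible E I c m1 m a b d k. pairing f w \<le> pairing f v)"

definition deg_K :: "'l set \<Rightarrow> 'l set \<Rightarrow> ('l \<Rightarrow> 'n::finite mpoly) \<Rightarrow> nat"
  where "deg_K E I c = Max (insert 1 ((\<lambda>i. nat \<lceil>real (tdeg (c i)) / 2\<rceil>) ` (E \<union> I)))"

text \<open>\<open>u\<close> is labelled by the exponents of degree at most \<open>2 * t\<close>.\<close>

definition flat :: "'l set \<Rightarrow> 'l set \<Rightarrow> ('l \<Rightarrow> 'n::finite mpoly) \<Rightarrow> nat \<Rightarrow> 'n option mvec \<Rightarrow> bool"
  where "flat E I c t u \<longleftrightarrow> t \<ge> deg_K E I c \<and>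
    rank_on (exps (t - deg_K E I c)) (moment_matrix (t - deg_K E I c) u)
      = rank_on (exps t) (moment_matrix t u)"

end

theory Submission
  imports Defs
begin

text \<open>
  A measure on \<open>K\<close> may be replaced by an atomic one (Richter--Tchakaloff), and its atoms lift to the
  unit sphere, where all monomials are bounded.  The lifts are feasible for every relaxation, which
  gives (i); if \<open>H\<^sub>0\<close> meets the interior of \<open>P\<^sub>d(K)\<close>, the constraints bound their masses, so that limits
  of lifts exist as well.  Conversely, let \<open>Q\<close> be the cone of polynomials on which the feasible points of
  high order (for (ii)), or the flat extension of the given one (for (iii)), are nonnegative.  It contains
  the quadratic module, hence, by Putinar's theorem, every polynomial that is positive on the part of the
  sphere cut out by the homogenized constraints.
  Separation in \<open>\<real>\<^sup>A\<close> then puts the dehomogenized moment vector into the closure of the moment cone.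

  Putinar's theorem is obtained as follows.  Subtracting weighted squares makes the polynomial positive on
  the whole cube; modulo \<open>\<parallel>x\<parallel>\<^sup>2 - 1\<close> the polynomials \<open>1 + x\<^sub>i\<close> and \<open>1 - x\<^sub>i\<close> are sums of squares, so the
  Bernstein form of a polynomial that is positive on the cube exhibits it as a sum of squares.
\<close>

section \<open>Polynomials as linear extensions of their values on monomials\<close>

text \<open>The obstacle is that \<open>K\<close> may be unbounded: the moment cone need not be
  closed, and mass can escape to infinity. On the sphere, escaping mass accumulates at points with
  x_0 = 0, and \<open>closed_at_infinity\<close> makes every such point of the homogenized set a
  limit of points with x_0 > 0. Hence the degree-\<open>d\<close> homogenization of a polynomial
  that is nonnegative on \<open>K\<close> is nonnegative on all of \<open>semialg_tilde\<close>. It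
  may vanish there, while Putinar's theorem demands strict positivity, so an error e times the mass
  is carried along and removed by e -> 0. Along relaxations of growing order this requires a uniform
  mass bound. An interior point \<open>p\<close> in H_0 provides it: its homogenization has a
  positive lower bound on the compact set, while the linear constraints bound the pairing with
  \<open>p\<close> from above. For a flat point one fixed functional occurs, so e -> 0 is immediate.
  No measure is extracted from a relaxation: membership in the closure of the moment cone is tested
  on nonnegative polynomials. For the last claim of (iii) the measure is given; it is replaced by
  atoms with x_0 > 0, which project back to \<open>K\<close>.\<close>

definition lext :: "('n exponent \<Rightarrow> 'b::real_vector) \<Rightarrow> 'n mpoly \<Rightarrow> 'b"
  where "lext \<phi> p = (\<Sum>\<alpha>\<in>Poly_Mapping.keys p. mcoeff p \<alpha> *\<^sub>R \<phi> \<alpha>)"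

lemma lookup_scaleR [simp]: "Poly_Mapping.lookup (r *\<^sub>R p) \<alpha> = r *\<^sub>R Poly_Mapping.lookup p \<alpha>"
  by (simp add: scaleR_poly_mapping_def)

lemma scaleR_eq_mult: "r *\<^sub>R p = Poly_Mapping.single 0 r * (p :: 'n mpoly)"
  by (rule poly_mapping_eqI)
    (simp add: mult_map_scale_conv_mult[symmetric] Poly_Mapping.map.rep_eq when_def)

lemma mult_scaleR_mpoly:
  "(r *\<^sub>R p) * q = r *\<^sub>R (p * q)" "p * (r *\<^sub>R q) = r *\<^sub>R (p * q)" for p q :: "'n mpoly"
  by (simp_all add: scaleR_eq_mult mult_ac)

lemma lext_superset:
  assumes "finite S" "Poly_Mapping.keys p \<subseteq> S"
  shows "lext \<phi> p = (\<Sum>\<alpha>\<in>S. mcoeff p \<alpha> *\<^sub>R \<phi> \<alpha>)"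
  unfolding lext_def using assms
  by (intro sum.mono_neutral_left) (auto simp: in_keys_iff)

lemma linear_lext: "linear (lext \<phi>)"
proof (rule linearI)
  fix p q :: "'a mpoly"
  let ?S = "Poly_Mapping.keys p \<union> Poly_Mapping.keys q"
  have "lext \<phi> (p + q) = (\<Sum>\<alpha>\<in>?S. mcoeff (p + q) \<alpha> *\<^sub>R \<phi> \<alpha>)"
    by (rule lext_superset) (auto simp: Poly_Mapping.keys_add)
  moreover have "lext \<phi> p = (\<Sum>\<alpha>\<in>?S. mcoeff p \<alpha> *\<^sub>R \<phi> \<alpha>)"
    "lext \<phi> q = (\<Sum>\<alpha>\<in>?S. mcoeff q \<alpha> *\<^sub>R \<phi> \<alpha>)"
    by (rule lext_superset; simp)+
  ultimately show "lext \<phi> (p + q) = lext \<phi> p + lext \<phi> q"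
    by (simp add: lookup_add scaleR_add_left sum.distrib)
next
  fix r and p :: "'a mpoly"
  have "lext \<phi> (r *\<^sub>R p) = (\<Sum>\<alpha>\<in>Poly_Mapping.keys p. mcoeff (r *\<^sub>R p) \<alpha> *\<^sub>R \<phi> \<alpha>)"
    by (rule lext_superset) (auto simp: in_keys_iff)
  then show "lext \<phi> (r *\<^sub>R p) = r *\<^sub>R lext \<phi> p"
    by (simp add: lext_def scaleR_sum_right)
qed

lemma lext_single [simp]: "lext \<phi> (Poly_Mapping.single \<alpha> r) = r *\<^sub>R \<phi> \<alpha>"
  by (cases "r = 0") (simp_all add: lext_def)

lemma lext_one [simp]: "lext \<phi> 1 = \<phi> 0"
  using lext_single[of \<phi> 0 1] by simp

lemmas lext_add = linear_add[OF linear_lext]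
lemmas lext_diff = linear_diff[OF linear_lext]
lemmas lext_neg = linear_neg[OF linear_lext]
lemmas lext_sum = linear_sum[OF linear_lext]
lemmas lext_scaleR = linear_scale[OF linear_lext]
lemmas lext_zero = linear_0[OF linear_lext]

text \<open>Riesz functionals, point evaluations, columns of moment matrices and polynomials in the
  operators of the flat extension are all instances of \<open>lext\<close>, which is why its values
  lie in an arbitrary real vector space.\<close>

lemma pairing_eq_lext: "pairing p y = lext (Poly_Mapping.lookup y) p"
  by (simp add: pairing_def lext_def)

lemma poly_eval_eq_lext: "poly_eval p x = lext (\<lambda>\<alpha>. mono_eval \<alpha> x) p"
  by (simp add: poly_eval_def lext_def)

lemma mpoly_eq_sum_monom: "p = (\<Sum>\<alpha>\<in>Poly_Mapping.keys p. mcoeff p \<alpha> *\<^sub>R mmonom \<alpha>)"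
proof -
  have "Poly_Mapping.single \<alpha> (mcoeff p \<alpha>) = mcoeff p \<alpha> *\<^sub>R mmonom \<alpha>" for \<alpha>
    by (rule poly_mapping_eqI) (simp add: lookup_single when_def)
  then show ?thesis using poly_mapping_sum_monom[of "Poly_Mapping.keys p" p] by simp
qed

lemma linear_eq_on_monom:
  assumes f: "linear f" and g: "linear g"
    and "\<And>\<alpha>. \<alpha> \<in> Poly_Mapping.keys p \<Longrightarrow> f (mmonom \<alpha>) = g (mmonom \<alpha>)"
  shows "f (p :: 'n mpoly) = g p"
  by (subst (1 2) mpoly_eq_sum_monom[of p])
    (simp add: linear_sum[OF f] linear_sum[OF g] linear_scale[OF f] linear_scale[OF g] assms(3))

lemma linear_mult_left: "linear (\<lambda>p :: 'n mpoly. q * p)"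
  by (rule linearI) (simp_all add: ring_distribs mult_scaleR_mpoly)

lemma lext_mult_monom: "lext \<phi> (p * mmonom \<beta>) = lext (\<lambda>\<alpha>. \<phi> (\<alpha> + \<beta>)) p"
proof (rule linear_eq_on_monom[OF _ linear_lext])
  show "linear (\<lambda>p. lext \<phi> (p * mmonom \<beta>))"
    by (rule linearI) (simp_all add: ring_distribs mult_scaleR_mpoly lext_add lext_scaleR)
qed (simp add: mult_single)

lemma mono_eval_add: "mono_eval (\<alpha> + \<beta>) x = mono_eval \<alpha> x * mono_eval \<beta> x"
  by (simp add: mono_eval_def lookup_add power_add prod.distrib)

lemma mono_eval_0 [simp]: "mono_eval 0 x = 1"
  by (simp add: mono_eval_def)

lemma mono_eval_single [simp]: "mono_eval (Poly_Mapping.single i e) x = (x $ i) ^ e"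
proof -
  have "mono_eval (Poly_Mapping.single i e) x = (\<Prod>j\<in>UNIV. if j = i then (x $ i) ^ e else 1)"
    unfolding mono_eval_def by (intro prod.cong) (auto simp: lookup_single when_def)
  then show ?thesis by simp
qed

lemma poly_eval_mult: "poly_eval (p * q) x = poly_eval p x * poly_eval q x"
proof -
  have "lext (\<lambda>\<alpha>. mono_eval \<alpha> x) (p * q) = lext (\<lambda>\<alpha>. mono_eval \<alpha> x) p * lext (\<lambda>\<alpha>. mono_eval \<alpha> x) q"
  proof (rule linear_eq_on_monom[of "\<lambda>q. lext (\<lambda>\<alpha>. mono_eval \<alpha> x) (p * q)"])
    show "linear (\<lambda>q. lext (\<lambda>\<alpha>. mono_eval \<alpha> x) (p * q))"
      by (rule linearI) (simp_all add: ring_distribs mult_scaleR_mpoly lext_add lext_scaleR)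
    show "linear (\<lambda>q. lext (\<lambda>\<alpha>. mono_eval \<alpha> x) p * lext (\<lambda>\<alpha>. mono_eval \<alpha> x) q)"
      by (rule linearI) (simp_all add: ring_distribs lext_add lext_scaleR)
    show "lext (\<lambda>\<alpha>. mono_eval \<alpha> x) (p * mmonom \<alpha>) = lext (\<lambda>\<alpha>. mono_eval \<alpha> x) p * lext (\<lambda>\<alpha>. mono_eval \<alpha> x) (mmonom \<alpha>)" for \<alpha>
      by (simp add: lext_mult_monom mono_eval_add) (simp add: lext_def sum_distrib_right mult.assoc)
  qed
  then show ?thesis by (simp add: poly_eval_eq_lext)
qed

lemma poly_eval_simps [simp]:
  "poly_eval 0 x = 0" "poly_eval 1 x = 1"
  "poly_eval (p - q) x = poly_eval p x - poly_eval q x"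
  "poly_eval (- p) x = - poly_eval p x"
  "poly_eval (r *\<^sub>R p) x = r * poly_eval p x"
  "poly_eval (p ^ k) x = poly_eval p x ^ k"
  "poly_eval (p + q) x = poly_eval p x + poly_eval q x"
  "poly_eval (p * q) x = poly_eval p x * poly_eval q x"
  "poly_eval (Poly_Mapping.single \<alpha> r) x = r * mono_eval \<alpha> x"
  by (simp_all add: poly_eval_eq_lext lext_zero lext_diff lext_neg lext_scaleR lext_add)
    (simp_all add: poly_eval_eq_lext[symmetric] poly_eval_mult,
     induction k, simp_all add: poly_eval_eq_lext[symmetric] poly_eval_mult, simp add: poly_eval_eq_lext)

lemma continuous_mono_eval [continuous_intros]: "continuous_on S (mono_eval \<alpha>)"
  unfolding mono_eval_def by (intro continuous_intros)

lemma continuous_poly_eval [continuous_intros]: "continuous_on S (poly_eval p)"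
  unfolding poly_eval_def by (intro continuous_intros)

section \<open>Degrees and induction on exponents\<close>

lemma mdeg_add: "mdeg (\<alpha> + \<beta>) = mdeg \<alpha> + mdeg \<beta>"
  by (simp add: mdeg_def lookup_add sum.distrib)

lemma mdeg_0 [simp]: "mdeg 0 = 0"
  by (simp add: mdeg_def)

lemma mdeg_single [simp]: "mdeg (Poly_Mapping.single i e) = e"
  by (simp add: mdeg_def lookup_single when_def)

lemma exponent_cases:
  fixes \<alpha> :: "'n::finite exponent"
  obtains "\<alpha> = 0" | i \<beta> where "\<alpha> = Poly_Mapping.single i 1 + \<beta>"
proof (cases "\<alpha> = 0")
  case False
  then obtain i where i: "Poly_Mapping.lookup \<alpha> i \<noteq> 0"
    by (metis poly_mapping_eqI lookup_zero)
  have "\<alpha> = Poly_Mapping.single i 1 + (\<alpha> - Poly_Mapping.single i 1)"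
    by (rule poly_mapping_eqI) (use i in \<open>auto simp: lookup_add lookup_minus lookup_single when_def\<close>)
  then show ?thesis using that by blast
qed

lemma exponent_induct [case_names zero add]:
  fixes \<alpha> :: "'n::finite exponent"
  assumes "P 0" "\<And>i \<beta>. P \<beta> \<Longrightarrow> P (Poly_Mapping.single i 1 + \<beta>)"
  shows "P \<alpha>"
proof (induction "mdeg \<alpha>" arbitrary: \<alpha>)
  case 0
  then show ?case using assms(1) by (cases \<alpha> rule: exponent_cases) (auto simp: mdeg_add)
next
  case (Suc k)
  then show ?case using assms by (cases \<alpha> rule: exponent_cases) (auto simp: mdeg_add)
qed

text \<open>Monomials arise from \<open>1\<close> by multiplying with variables. This suits
  subspaces for which one variable is easy to treat but a general product is what has to be
  understood, as in \<open>extension_mult\<close>.\<close>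

lemma mpoly_var_induct:
  fixes p :: "'n::finite mpoly"
  assumes S: "subspace S" and one: "1 \<in> S" and var: "\<And>i p. p \<in> S \<Longrightarrow> var i * p \<in> S"
  shows "p \<in> S"
proof -
  have "mmonom \<alpha> \<in> S" for \<alpha>
  proof (induction \<alpha> rule: exponent_induct)
    case (add i \<beta>)
    then show ?case using var[OF add, of i] by (simp add: mult_single)
  qed (use one in simp)
  then show ?thesis
    by (subst mpoly_eq_sum_monom) (intro subspace_sum subspace_scale S)
qed

lemma tdeg_mult: "tdeg (p * q) \<le> tdeg p + tdeg q"
proof -
  have "\<gamma> \<in> exps (tdeg p + tdeg q)" if "\<gamma> \<in> Poly_Mapping.keys (p * q)" for \<gamma>
  proof -
    obtain \<alpha> \<beta> where "\<gamma> = \<alpha> + \<beta>" "\<alpha> \<in> Poly_Mapping.keys p" "\<beta> \<in> Poly_Mapping.keys q"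
      using keys_mult[of p q] \<open>\<gamma> \<in> Poly_Mapping.keys (p * q)\<close> by auto
    then show ?thesis by (auto simp: exps_def mdeg_add intro!: add_mono mdeg_le_tdeg)
  qed
  then show ?thesis by (auto simp: tdeg_le_iff)
qed

lemma tdeg_uminus [simp]: "tdeg (- p) = tdeg p"
  by (simp add: tdeg_def)

lemma tdeg_0 [simp]: "tdeg 0 = 0"
  by (simp add: tdeg_def set_deg_def Sup_nat_def)

lemma tdeg_monom [simp]: "tdeg (mmonom \<alpha>) = mdeg \<alpha>"
  by (simp add: tdeg_def set_deg_def)

lemma tdeg_one [simp]: "tdeg 1 = 0"
  using tdeg_monom[of 0] by simp

lemma subspace_polys: "subspace (polys k)"
  unfolding polys_def tdeg_le_iff
  by (rule subspaceI) (auto simp: in_keys_iff lookup_add subset_iff, metis add_0)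


section \<open>Separation of convex cones and the theorem of Richter and Tchakaloff\<close>

text \<open>Coordinates are removed one at a time: once the slope \<open>t\<close> in direction
  \<beta> is fixed, minimising over that coordinate leaves a sublinear function of the others. Plain
  functions serve as vectors because \<open>A\<close> is a finite part of an arbitrary index type;
  the last hypothesis says that \<open>f\<close> sees only the coordinates in
  \<open>A\<close>.\<close>

lemma finite_hahn_banach:
  fixes f :: "('e \<Rightarrow> real) \<Rightarrow> real"
  assumes "finite A"
    and "\<And>x y. f (\<lambda>\<alpha>. x \<alpha> + y \<alpha>) \<le> f x + f y"
    and "\<And>r x. r > 0 \<Longrightarrow> f (\<lambda>\<alpha>. r * x \<alpha>) \<le> r * f x"
    and "f (\<lambda>_. 0) = 0"
    and "\<And>x y. (\<And>\<alpha>. \<alpha> \<in> A \<Longrightarrow> x \<alpha> = y \<alpha>) \<Longrightarrow> f x = f y"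
  shows "\<exists>l. \<forall>x. (\<Sum>\<alpha>\<in>A. l \<alpha> * x \<alpha>) \<le> f x"
  using assms
proof (induction A arbitrary: f rule: finite_induct)
  case empty
  have "f x = 0" for x
    using empty(4)[of x "\<lambda>_. 0"] empty(3) by simp
  then show ?case by simp
next
  case (insert \<beta> A)
  note sub = insert.prems(1) and hom = insert.prems(2) and zero = insert.prems(3)
    and dep = insert.prems(4)
  define e :: "real \<Rightarrow> 'e \<Rightarrow> real" where "e s = (\<lambda>_. 0)(\<beta> := s)" for s
  \<comment> \<open>Any slope from \<open>- f (e (- 1))\<close> to \<open>f (e 1)\<close> would do;
    at the upper end the bound is an equality for s > 0, and subadditivity gives it for s <
    0.\<close>
  define t where "t = f (e 1)"
  have t: "t * s \<le> f (e s)" for s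
  proof -
    consider "s = 0" | "s > 0" | "s < 0" by linarith
    then show ?thesis
    proof cases
      case 1
      have "e 0 = (\<lambda>_. 0)" by (auto simp: e_def)
      then show ?thesis using zero 1 by simp
    next
      case 2
      have "(\<lambda>\<alpha>. (1 / s) * e s \<alpha>) = e 1" using 2 by (auto simp: e_def)
      then show ?thesis using hom[of "1 / s" "e s"] 2 by (simp add: t_def field_simps)
    next
      case 3
      have "(\<lambda>\<alpha>. (1 / - s) * e s \<alpha>) = e (- 1)" using 3 by (auto simp: e_def)
      then have "f (e (- 1)) \<le> (1 / - s) * f (e s)" using hom[of "1 / - s" "e s"] 3 by simp
      then have 1: "(- s) * f (e (- 1)) \<le> f (e s)" using 3 by (simp add: field_simps)
      have "(\<lambda>\<alpha>. e 1 \<alpha> + e (- 1) \<alpha>) = (\<lambda>_. 0)" by (auto simp: e_def)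
      then have "0 \<le> t + f (e (- 1))" using sub[of "e 1" "e (- 1)"] zero by (simp add: t_def)
      then have "0 \<le> (- s) * (t + f (e (- 1)))" using 3 by (intro mult_nonneg_nonneg) auto
      then show ?thesis using 1 by (simp add: algebra_simps)
    qed
  qed
  \<comment> \<open>Infimal projection along \<beta>; subadditivity against the fixed vector
    \<open>- x\<close> keeps the infimum finite.\<close>
  define g where "g x = (INF s. f (x(\<beta> := s)) - t * s)" for x
  have lower: "- f ((\<lambda>\<alpha>. - x \<alpha>)(\<beta> := 0)) \<le> f (x(\<beta> := s)) - t * s" for x s
  proof -
    have "(\<lambda>\<alpha>. (x(\<beta> := s)) \<alpha> + ((\<lambda>\<alpha>. - x \<alpha>)(\<beta> := 0)) \<alpha>) = e s" by (auto simp: e_def)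
    then have "f (e s) \<le> f (x(\<beta> := s)) + f ((\<lambda>\<alpha>. - x \<alpha>)(\<beta> := 0))"
      using sub[of "x(\<beta> := s)" "(\<lambda>\<alpha>. - x \<alpha>)(\<beta> := 0)"] by (simp only:)
    then show ?thesis using t[of s] by linarith
  qed
  have g_le: "g x \<le> f (x(\<beta> := s)) - t * s" for x s
    unfolding g_def by (rule cINF_lower) (use lower in \<open>auto intro!: bdd_belowI2\<close>)
  have g_ge: "c \<le> g x" if "\<And>s. c \<le> f (x(\<beta> := s)) - t * s" for c x
    unfolding g_def by (rule cINF_greatest) (use that in auto)
  have "\<exists>l. \<forall>x. (\<Sum>\<alpha>\<in>A. l \<alpha> * x \<alpha>) \<le> g x"
  proof (rule insert.IH)
    fix x y :: "'e \<Rightarrow> real"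
    have "g (\<lambda>\<alpha>. x \<alpha> + y \<alpha>) - (f (y(\<beta> := s')) - t * s') \<le> f (x(\<beta> := s)) - t * s" for s s'
    proof -
      have "(\<lambda>\<alpha>. x \<alpha> + y \<alpha>)(\<beta> := s + s') = (\<lambda>\<alpha>. (x(\<beta> := s)) \<alpha> + (y(\<beta> := s')) \<alpha>)" by auto
      then have "g (\<lambda>\<alpha>. x \<alpha> + y \<alpha>) \<le> f (\<lambda>\<alpha>. (x(\<beta> := s)) \<alpha> + (y(\<beta> := s')) \<alpha>) - t * (s + s')"
        using g_le[of "\<lambda>\<alpha>. x \<alpha> + y \<alpha>" "s + s'"] by simp
      moreover have "f (\<lambda>\<alpha>. (x(\<beta> := s)) \<alpha> + (y(\<beta> := s')) \<alpha>) \<le> f (x(\<beta> := s)) + f (y(\<beta> := s'))"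
        by (rule sub)
      moreover have "t * (s + s') = t * s + t * s'" by (simp add: ring_distribs)
      ultimately show ?thesis by linarith
    qed
    then have "g (\<lambda>\<alpha>. x \<alpha> + y \<alpha>) - (f (y(\<beta> := s')) - t * s') \<le> g x" for s'
      by (rule g_ge)
    then have "g (\<lambda>\<alpha>. x \<alpha> + y \<alpha>) - g x \<le> g y"
      by (intro g_ge) (simp add: algebra_simps)
    then show "g (\<lambda>\<alpha>. x \<alpha> + y \<alpha>) \<le> g x + g y" by simp
  next
    fix r :: real and x :: "'e \<Rightarrow> real"
    assume r: "r > 0"
    have "g (\<lambda>\<alpha>. r * x \<alpha>) / r \<le> f (x(\<beta> := s)) - t * s" for s
    proof -
      have "(\<lambda>\<alpha>. r * x \<alpha>)(\<beta> := r * s) = (\<lambda>\<alpha>. r * (x(\<beta> := s)) \<alpha>)" by auto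
      then have "g (\<lambda>\<alpha>. r * x \<alpha>) \<le> f (\<lambda>\<alpha>. r * (x(\<beta> := s)) \<alpha>) - t * (r * s)"
        using g_le[of "\<lambda>\<alpha>. r * x \<alpha>" "r * s"] by simp
      also have "\<dots> \<le> r * (f (x(\<beta> := s)) - t * s)"
        unfolding right_diff_distrib mult.left_commute[of r t s] by (intro diff_right_mono hom r)
      finally show ?thesis using r by (simp add: field_simps)
    qed
    then have "g (\<lambda>\<alpha>. r * x \<alpha>) / r \<le> g x" by (rule g_ge)
    then show "g (\<lambda>\<alpha>. r * x \<alpha>) \<le> r * g x" using r by (simp add: field_simps)
  next
    have "g (\<lambda>_. 0) \<le> 0"
      using g_le[of "\<lambda>_. 0" 0] zero by (simp add: fun_upd_idem)
    moreover have "0 \<le> g (\<lambda>_. 0)"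
      using t by (intro g_ge) (simp add: e_def)
    ultimately show "g (\<lambda>_. 0) = 0" by simp
  next
    fix x y :: "'e \<Rightarrow> real"
    assume "\<And>\<alpha>. \<alpha> \<in> A \<Longrightarrow> x \<alpha> = y \<alpha>"
    then have "f (x(\<beta> := s)) = f (y(\<beta> := s))" for s
      by (intro dep) auto
    then show "g x = g y" by (simp add: g_def)
  qed
  then obtain l where l: "(\<Sum>\<alpha>\<in>A. l \<alpha> * x \<alpha>) \<le> g x" for x by blast
  have "(\<Sum>\<alpha>\<in>insert \<beta> A. (l(\<beta> := t)) \<alpha> * x \<alpha>) \<le> f x" for x
  proof -
    have "(\<Sum>\<alpha>\<in>A. (l(\<beta> := t)) \<alpha> * x \<alpha>) = (\<Sum>\<alpha>\<in>A. l \<alpha> * x \<alpha>)"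
      using insert.hyps by (intro sum.cong) auto
    then show ?thesis
      using l[of x] g_le[of x "x \<beta>"] insert.hyps by (simp add: fun_upd_triv)
  qed
  then show ?case by blast
qed

locale function_cone =
  fixes C :: "('e \<Rightarrow> real) set"
  assumes zero: "(\<lambda>_. 0) \<in> C"
    and add: "\<And>x y. x \<in> C \<Longrightarrow> y \<in> C \<Longrightarrow> (\<lambda>\<alpha>. x \<alpha> + y \<alpha>) \<in> C"
    and scale: "\<And>r x. r > 0 \<Longrightarrow> x \<in> C \<Longrightarrow> (\<lambda>\<alpha>. r * x \<alpha>) \<in> C"
begin

lemma scale_nonneg: "r \<ge> 0 \<Longrightarrow> x \<in> C \<Longrightarrow> (\<lambda>\<alpha>. r * x \<alpha>) \<in> C"
  using scale zero by (cases "r = 0") auto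

text \<open>Induction on the coordinates. If the projection of \<open>C\<close> to \<open>A\<close>
  already misses a vector, a functional on \<open>A\<close> is padded by zero. Otherwise every fibre
  over \<open>A\<close> is nonempty, and the fibre over 0 cannot contain both signs of the
  \<beta>-coordinate, since \<open>C\<close> would then project onto everything. So the lower
  envelope of the fibres is finite and sublinear, and a linear minorant of it yields the
  functional.\<close>

lemma nonneg_functional:
  assumes "finite A" and "\<exists>v. \<forall>x\<in>C. \<exists>\<alpha>\<in>A. x \<alpha> \<noteq> v \<alpha>"
  shows "\<exists>l. (\<exists>\<alpha>\<in>A. l \<alpha> \<noteq> 0) \<and> (\<forall>x\<in>C. 0 \<le> (\<Sum>\<alpha>\<in>A. l \<alpha> * x \<alpha>))"
  using assms
proof (induction A rule: finite_induct)
  case empty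
  then show ?case using zero by blast
next
  case (insert \<beta> A)
  show ?case
  proof (cases "\<exists>v. \<forall>x\<in>C. \<exists>\<alpha>\<in>A. x \<alpha> \<noteq> v \<alpha>")
    case True
    then obtain l where l: "\<exists>\<alpha>\<in>A. l \<alpha> \<noteq> 0" "\<And>x. x \<in> C \<Longrightarrow> 0 \<le> (\<Sum>\<alpha>\<in>A. l \<alpha> * x \<alpha>)"
      using insert.IH by blast
    have "(\<Sum>\<alpha>\<in>insert \<beta> A. (l(\<beta> := 0)) \<alpha> * x \<alpha>) = (\<Sum>\<alpha>\<in>A. l \<alpha> * x \<alpha>)" for x
      using insert.hyps by (simp, intro sum.cong) auto
    moreover have "\<exists>\<alpha>\<in>insert \<beta> A. (l(\<beta> := 0)) \<alpha> \<noteq> 0"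
      using l(1) insert.hyps by auto
    ultimately show ?thesis using l(2) by metis
  next
    case False
    then have full: "\<exists>x\<in>C. \<forall>\<alpha>\<in>A. x \<alpha> = v \<alpha>" for v by blast
    have "\<exists>\<sigma>\<in>{1, -1}. \<forall>x\<in>C. (\<forall>\<alpha>\<in>A. x \<alpha> = 0) \<longrightarrow> \<sigma> * x \<beta> \<ge> 0"
    proof (rule ccontr)
      assume "\<not> ?thesis"
      then obtain xp xm where xp: "xp \<in> C" "\<And>\<alpha>. \<alpha> \<in> A \<Longrightarrow> xp \<alpha> = 0" "xp \<beta> > 0"
        and xm: "xm \<in> C" "\<And>\<alpha>. \<alpha> \<in> A \<Longrightarrow> xm \<alpha> = 0" "xm \<beta> < 0"
        by (auto simp: not_le)
      obtain v where v: "\<And>x. x \<in> C \<Longrightarrow> \<exists>\<alpha>\<in>insert \<beta> A. x \<alpha> \<noteq> v \<alpha>" using insert.prems by blast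
      obtain x where x: "x \<in> C" "\<And>\<alpha>. \<alpha> \<in> A \<Longrightarrow> x \<alpha> = v \<alpha>" using full by blast
      consider "v \<beta> \<ge> x \<beta>" | "v \<beta> < x \<beta>" by linarith
      then show False
      proof cases
        case 1
        have "(\<lambda>\<alpha>. x \<alpha> + (v \<beta> - x \<beta>) / xp \<beta> * xp \<alpha>) \<in> C"
          using 1 xp by (intro add x(1) scale_nonneg) auto
        from v[OF this] show False using x(2) xp by auto
      next
        case 2
        have "(\<lambda>\<alpha>. x \<alpha> + (v \<beta> - x \<beta>) / xm \<beta> * xm \<alpha>) \<in> C"
          using 2 xm by (intro add x(1) scale_nonneg) (auto simp: divide_nonpos_neg)
        from v[OF this] show False using x(2) xm by auto
      qed
    qed
    then obtain \<sigma> :: real where \<sigma>: "\<sigma> \<noteq> 0"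
      "\<And>x. x \<in> C \<Longrightarrow> (\<And>\<alpha>. \<alpha> \<in> A \<Longrightarrow> x \<alpha> = 0) \<Longrightarrow> \<sigma> * x \<beta> \<ge> 0"
      by (metis insertE singletonD zero_neq_neg_one zero_neq_one)
    define S where "S x = {y \<in> C. \<forall>\<alpha>\<in>A. y \<alpha> = x \<alpha>}" for x
    define f where "f x = (INF y\<in>S x. \<sigma> * y \<beta>)" for x
    have ne: "S x \<noteq> {}" for x using full[of x] by (auto simp: S_def)
    have bdd: "bdd_below ((\<lambda>y. \<sigma> * y \<beta>) ` S x)" for x
    proof -
      \<comment> \<open>Adding a point over \<open>- x\<close> moves the fibre over \<open>x\<close>
        into the fibre over 0, where the sign is known.\<close>
      obtain y0 where y0: "y0 \<in> C" "\<And>\<alpha>. \<alpha> \<in> A \<Longrightarrow> y0 \<alpha> = - x \<alpha>" using full[of "\<lambda>\<alpha>. - x \<alpha>"] by blast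
      have "- (\<sigma> * y0 \<beta>) \<le> \<sigma> * y \<beta>" if "y \<in> S x" for y
        using \<sigma>(2)[OF add[of y y0]] that y0 by (auto simp: S_def algebra_simps)
      then show ?thesis by (intro bdd_belowI2) auto
    qed
    have f_le: "f x \<le> \<sigma> * y \<beta>" if "y \<in> S x" for x y
      unfolding f_def by (rule cINF_lower[OF bdd that])
    have f_ge: "c \<le> f x" if "\<And>y. y \<in> S x \<Longrightarrow> c \<le> \<sigma> * y \<beta>" for c x
      unfolding f_def by (rule cINF_greatest[OF ne that])
    have "\<exists>l. \<forall>x. (\<Sum>\<alpha>\<in>A. l \<alpha> * x \<alpha>) \<le> f x"
    proof (rule finite_hahn_banach[OF insert.hyps(1)])
      fix x y :: "'e \<Rightarrow> real"
      have "f (\<lambda>\<alpha>. x \<alpha> + y \<alpha>) - \<sigma> * y' \<beta> \<le> \<sigma> * x' \<beta>" if "x' \<in> S x" "y' \<in> S y" for x' y'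
        using f_le[of "\<lambda>\<alpha>. x' \<alpha> + y' \<alpha>" "\<lambda>\<alpha>. x \<alpha> + y \<alpha>"] that
        by (auto simp: S_def add algebra_simps)
      then have "f (\<lambda>\<alpha>. x \<alpha> + y \<alpha>) - \<sigma> * y' \<beta> \<le> f x" if "y' \<in> S y" for y'
        using that by (intro f_ge) auto
      then have "f (\<lambda>\<alpha>. x \<alpha> + y \<alpha>) - f x \<le> f y"
        by (intro f_ge) (simp add: algebra_simps)
      then show "f (\<lambda>\<alpha>. x \<alpha> + y \<alpha>) \<le> f x + f y" by simp
    next
      fix r :: real and x :: "'e \<Rightarrow> real"
      assume r: "r > 0"
      have "f (\<lambda>\<alpha>. r * x \<alpha>) / r \<le> \<sigma> * y \<beta>" if "y \<in> S x" for y
        using f_le[of "\<lambda>\<alpha>. r * y \<alpha>" "\<lambda>\<alpha>. r * x \<alpha>"] that r scale[OF r]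
        by (auto simp: S_def field_simps)
      then have "f (\<lambda>\<alpha>. r * x \<alpha>) / r \<le> f x" by (rule f_ge)
      then show "f (\<lambda>\<alpha>. r * x \<alpha>) \<le> r * f x" using r by (simp add: field_simps)
    next
      have "f (\<lambda>_. 0) \<le> 0" using f_le[of "\<lambda>_. 0" "\<lambda>_. 0"] zero by (simp add: S_def)
      moreover have "0 \<le> f (\<lambda>_. 0)" by (rule f_ge) (use \<sigma>(2) in \<open>auto simp: S_def\<close>)
      ultimately show "f (\<lambda>_. 0) = 0" by simp
    next
      fix x y :: "'e \<Rightarrow> real"
      assume "\<And>\<alpha>. \<alpha> \<in> A \<Longrightarrow> x \<alpha> = y \<alpha>"
      then have "S x = S y" by (auto simp: S_def)
      then show "f x = f y" by (simp add: f_def)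
    qed
    then obtain l where l: "(\<Sum>\<alpha>\<in>A. l \<alpha> * x \<alpha>) \<le> f x" for x by blast
    define l' where "l' = (\<lambda>\<alpha>. - l \<alpha>)(\<beta> := \<sigma>)"
    have "0 \<le> (\<Sum>\<alpha>\<in>insert \<beta> A. l' \<alpha> * y \<alpha>)" if "y \<in> C" for y
    proof -
      have "(\<Sum>\<alpha>\<in>A. l' \<alpha> * y \<alpha>) = - (\<Sum>\<alpha>\<in>A. l \<alpha> * y \<alpha>)"
        unfolding sum_negf[symmetric] using insert.hyps by (intro sum.cong) (auto simp: l'_def)
      moreover have "f y \<le> \<sigma> * y \<beta>" using that by (intro f_le) (auto simp: S_def)
      ultimately show ?thesis using l[of y] insert.hyps by (simp add: l'_def)
    qed
    moreover have "l' \<beta> \<noteq> 0" using \<sigma>(1) by (simp add: l'_def)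
    ultimately show ?thesis by blast
  qed
qed

text \<open>For \<open>\<epsilon> = 0\<close> the functional may vanish on all of \<open>C\<close>, since \<open>C\<close> need not be closed.\<close>

lemma separation:
  assumes A: "finite A" and \<epsilon>: "\<epsilon> \<ge> 0"
    and v: "\<And>x. x \<in> C \<Longrightarrow> \<exists>\<alpha>\<in>A. \<epsilon> < \<bar>x \<alpha> - v \<alpha>\<bar>"
  shows "\<exists>l. (\<exists>\<alpha>\<in>A. l \<alpha> \<noteq> 0) \<and> (\<forall>x\<in>C. 0 \<le> (\<Sum>\<alpha>\<in>A. l \<alpha> * x \<alpha>)) \<and>
    (\<Sum>\<alpha>\<in>A. l \<alpha> * v \<alpha>) \<le> - \<epsilon> * (\<Sum>\<alpha>\<in>A. \<bar>l \<alpha>\<bar>)"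
proof -
  \<comment> \<open>The cone generated by \<open>C\<close> and the cube of radius \<epsilon> around
    \<open>- v\<close>. It misses \<open>v\<close> on \<open>A\<close>: otherwise a point of
    \<open>C\<close>, divided by 1 + s, would lie within \<epsilon> of \<open>v\<close>.\<close>
  define D where "D = {y. \<exists>x\<in>C. \<exists>s\<ge>0. \<forall>\<alpha>. \<bar>y \<alpha> - (x \<alpha> - s * v \<alpha>)\<bar> \<le> s * \<epsilon>}"
  interpret D: function_cone D
  proof
    show "(\<lambda>_. 0) \<in> D" unfolding D_def using zero by force
  next
    fix x y assume "x \<in> D" "y \<in> D"
    then obtain x' s y' u where *: "x' \<in> C" "y' \<in> C" "s \<ge> 0" "u \<ge> 0"
      "\<And>\<alpha>. \<bar>x \<alpha> - (x' \<alpha> - s * v \<alpha>)\<bar> \<le> s * \<epsilon>" "\<And>\<alpha>. \<bar>y \<alpha> - (y' \<alpha> - u * v \<alpha>)\<bar> \<le> u * \<epsilon>"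
      unfolding D_def by blast
    have "\<bar>(x \<alpha> + y \<alpha>) - ((x' \<alpha> + y' \<alpha>) - (s + u) * v \<alpha>)\<bar> \<le> (s + u) * \<epsilon>" for \<alpha>
      using *(5,6)[of \<alpha>] by (simp add: algebra_simps)
    then show "(\<lambda>\<alpha>. x \<alpha> + y \<alpha>) \<in> D" unfolding D_def
      using * by (intro CollectI bexI[of _ "\<lambda>\<alpha>. x' \<alpha> + y' \<alpha>"] exI[of _ "s + u"]) (auto intro: add)
  next
    fix x and r :: real assume "x \<in> D" and r: "r > 0"
    then obtain x' s where *: "x' \<in> C" "s \<ge> 0" "\<And>\<alpha>. \<bar>x \<alpha> - (x' \<alpha> - s * v \<alpha>)\<bar> \<le> s * \<epsilon>"
      unfolding D_def by blast
    have "\<bar>r * x \<alpha> - (r * x' \<alpha> - r * s * v \<alpha>)\<bar> \<le> r * s * \<epsilon>" for \<alpha>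
    proof -
      have "r * x \<alpha> - (r * x' \<alpha> - r * s * v \<alpha>) = r * (x \<alpha> - (x' \<alpha> - s * v \<alpha>))"
        by (simp add: algebra_simps)
      then show ?thesis
        using mult_left_mono[OF *(3)[of \<alpha>], of r] r by (simp add: abs_mult mult.assoc)
    qed
    then show "(\<lambda>\<alpha>. r * x \<alpha>) \<in> D" unfolding D_def using * r
      by (intro CollectI bexI[of _ "\<lambda>\<alpha>. r * x' \<alpha>"] exI[of _ "r * s"]) (auto intro: scale)
  qed
  have "\<exists>\<alpha>\<in>A. y \<alpha> \<noteq> v \<alpha>" if "y \<in> D" for y
  proof -
    obtain x s where y: "\<And>\<alpha>. \<bar>y \<alpha> - (x \<alpha> - s * v \<alpha>)\<bar> \<le> s * \<epsilon>" "x \<in> C" "s \<ge> 0"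
      using \<open>y \<in> D\<close> unfolding D_def by blast
    obtain \<alpha> where \<alpha>: "\<alpha> \<in> A" "\<epsilon> < \<bar>1 / (1 + s) * x \<alpha> - v \<alpha>\<bar>"
      using v[OF scale_nonneg[of "1 / (1 + s)" x]] y by auto
    have "(1 + s) * \<epsilon> < (1 + s) * \<bar>1 / (1 + s) * x \<alpha> - v \<alpha>\<bar>"
      using \<alpha>(2) y(3) by (intro mult_strict_left_mono) auto
    also have "\<dots> = \<bar>(1 + s) * (1 / (1 + s) * x \<alpha> - v \<alpha>)\<bar>"
      using y(3) by (simp add: abs_mult)
    also have "(1 + s) * (1 / (1 + s) * x \<alpha> - v \<alpha>) = x \<alpha> - (1 + s) * v \<alpha>"
      using y(3) by (simp add: field_simps)
    finally have "\<bar>v \<alpha> - (x \<alpha> - s * v \<alpha>)\<bar> > s * \<epsilon>"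
      using \<epsilon> by (simp add: algebra_simps)
    then show ?thesis using y(1)[of \<alpha>] \<alpha>(1) by force
  qed
  then obtain l where l: "\<exists>\<alpha>\<in>A. l \<alpha> \<noteq> 0" "\<And>x. x \<in> D \<Longrightarrow> 0 \<le> (\<Sum>\<alpha>\<in>A. l \<alpha> * x \<alpha>)"
    using D.nonneg_functional[OF assms(1)] by blast
  have "x \<in> D" if "x \<in> C" for x unfolding D_def using that by force
  \<comment> \<open>The corner of the cube at which the functional is smallest; evaluating there
    yields the margin in terms of the l1-norm of \<open>l\<close>.\<close>
  moreover have "(\<lambda>\<alpha>. - v \<alpha> - \<epsilon> * sgn (l \<alpha>)) \<in> D" unfolding D_def
    using zero \<epsilon> by (intro CollectI bexI[of _ "\<lambda>_. 0"] exI[of _ 1]) (auto simp: abs_mult sgn_real_def)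
  then have "0 \<le> (\<Sum>\<alpha>\<in>A. l \<alpha> * (- v \<alpha> - \<epsilon> * sgn (l \<alpha>)))" by (rule l(2))
  moreover have "l \<alpha> * (- v \<alpha> - \<epsilon> * sgn (l \<alpha>)) = - (l \<alpha> * v \<alpha>) - \<epsilon> * \<bar>l \<alpha>\<bar>" for \<alpha>
    by (simp add: abs_sgn[of "l \<alpha>"] algebra_simps)
  ultimately show ?thesis
    using l by (intro exI[of _ l]) (simp add: sum_subtractf sum_negf sum_distrib_left)
qed

end

section \<open>Conic combinations of finitely many atoms and Richter's theorem\<close>

definition conic_atoms :: "'x set \<Rightarrow> ('x \<Rightarrow> 'e \<Rightarrow> real) \<Rightarrow> ('e \<Rightarrow> real) set"
  where "conic_atoms X \<phi> =
    {\<lambda>\<alpha>. \<Sum>u\<in>U. \<kappa> u * \<phi> u \<alpha> | U \<kappa>. finite U \<and> U \<subseteq> X \<and> (\<forall>u\<in>U. 0 \<le> \<kappa> u)}"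

lemma conic_atoms_mono: "X \<subseteq> Y \<Longrightarrow> conic_atoms X \<phi> \<subseteq> conic_atoms Y \<phi>"
  unfolding conic_atoms_def by blast

lemma conic_atoms_single: "x \<in> X \<Longrightarrow> \<phi> x \<in> conic_atoms X \<phi>"
  unfolding conic_atoms_def by (intro CollectI exI[of _ "{x}"] exI[of _ "\<lambda>_. 1"]) auto

lemma function_cone_conic_atoms: "function_cone (conic_atoms X \<phi>)"
proof
  show "(\<lambda>_. 0) \<in> conic_atoms X \<phi>"
    unfolding conic_atoms_def by (intro CollectI exI[of _ "{}"]) auto
next
  fix x y assume "x \<in> conic_atoms X \<phi>" "y \<in> conic_atoms X \<phi>"
  then obtain U \<kappa> V \<mu> where *: "x = (\<lambda>\<alpha>. \<Sum>u\<in>U. \<kappa> u * \<phi> u \<alpha>)" "y = (\<lambda>\<alpha>. \<Sum>u\<in>V. \<mu> u * \<phi> u \<alpha>)"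
    "finite U" "finite V" "U \<subseteq> X" "V \<subseteq> X" "\<And>u. u \<in> U \<Longrightarrow> 0 \<le> \<kappa> u" "\<And>u. u \<in> V \<Longrightarrow> 0 \<le> \<mu> u"
    unfolding conic_atoms_def by blast
  let ?\<kappa> = "\<lambda>u. (if u \<in> U then \<kappa> u else 0) + (if u \<in> V then \<mu> u else 0)"
  have "x \<alpha> = (\<Sum>u\<in>U\<union>V. (if u \<in> U then \<kappa> u else 0) * \<phi> u \<alpha>)"
    "y \<alpha> = (\<Sum>u\<in>U\<union>V. (if u \<in> V then \<mu> u else 0) * \<phi> u \<alpha>)" for \<alpha>
    unfolding *(1,2) using *(3,4) by (intro sum.mono_neutral_cong_left; auto)+
  then have "(\<lambda>\<alpha>. x \<alpha> + y \<alpha>) = (\<lambda>\<alpha>. \<Sum>u\<in>U\<union>V. ?\<kappa> u * \<phi> u \<alpha>)"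
    by (simp add: sum.distrib ring_distribs)
  then show "(\<lambda>\<alpha>. x \<alpha> + y \<alpha>) \<in> conic_atoms X \<phi>"
    unfolding conic_atoms_def using *
    by (intro CollectI exI[of _ "U \<union> V"] exI[of _ ?\<kappa>]) auto
next
  fix x and r :: real assume "x \<in> conic_atoms X \<phi>" "r > 0"
  then obtain U \<kappa> where *: "x = (\<lambda>\<alpha>. \<Sum>u\<in>U. \<kappa> u * \<phi> u \<alpha>)"
    "finite U" "U \<subseteq> X" "\<And>u. u \<in> U \<Longrightarrow> 0 \<le> \<kappa> u"
    unfolding conic_atoms_def by blast
  then show "(\<lambda>\<alpha>. r * x \<alpha>) \<in> conic_atoms X \<phi>"
    unfolding conic_atoms_def using \<open>r > 0\<close>
    by (intro CollectI exI[of _ U] exI[of _ "\<lambda>u. r * \<kappa> u"]) (auto simp: sum_distrib_left mult.assoc)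
qed

text \<open>A functional that is nonnegative on the atoms and nonpositive on the integral vanishes almost
  everywhere; since it is nonzero, it expresses one coordinate by the others, which can be dropped.\<close>

theorem richter:
  fixes \<phi> :: "'x \<Rightarrow> 'e \<Rightarrow> real"
  assumes "finite A" and "\<And>\<alpha>. \<alpha> \<in> A \<Longrightarrow> integrable M (\<lambda>x. \<phi> x \<alpha>)" and "AE x in M. x \<in> X"
  shows "\<exists>c\<in>conic_atoms X \<phi>. \<forall>\<alpha>\<in>A. c \<alpha> = (\<integral>x. \<phi> x \<alpha> \<partial>M)"
  using assms
proof (induction A arbitrary: X rule: finite_psubset_induct)
  case (psubset A)
  interpret function_cone "conic_atoms X \<phi>" by (rule function_cone_conic_atoms)
  let ?v = "\<lambda>\<alpha>. \<integral>x. \<phi> x \<alpha> \<partial>M"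
  show ?case
  proof (rule ccontr)
    assume no: "\<not> ?case"
    then obtain l where l: "\<exists>\<alpha>\<in>A. l \<alpha> \<noteq> 0"
      "\<And>x. x \<in> conic_atoms X \<phi> \<Longrightarrow> 0 \<le> (\<Sum>\<alpha>\<in>A. l \<alpha> * x \<alpha>)"
      "(\<Sum>\<alpha>\<in>A. l \<alpha> * ?v \<alpha>) \<le> 0"
      using separation[OF psubset.hyps(1), of 0 ?v] by auto
    let ?g = "\<lambda>x. \<Sum>\<alpha>\<in>A. l \<alpha> * \<phi> x \<alpha>"
    have int: "integrable M ?g" using psubset.prems(1) by auto
    have eq: "(\<integral>x. ?g x \<partial>M) = (\<Sum>\<alpha>\<in>A. l \<alpha> * ?v \<alpha>)"
      using psubset.prems(1) by (subst Bochner_Integration.integral_sum) auto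
    have nonneg: "0 \<le> ?g x" if "x \<in> X" for x
      using l(2)[OF conic_atoms_single[OF that]] .
    have ae: "AE x in M. 0 \<le> ?g x"
      using psubset.prems(2) by eventually_elim (rule nonneg)
    have zero: "(\<Sum>\<alpha>\<in>A. l \<alpha> * ?v \<alpha>) = 0"
      using integral_nonneg_AE[OF ae] l(3) eq by linarith
    then have "AE x in M. ?g x = 0"
      using integral_nonneg_eq_0_iff_AE[OF int ae] eq by simp
    then have X': "AE x in M. x \<in> {x \<in> X. ?g x = 0}"
      using psubset.prems(2) by eventually_elim auto
    obtain \<beta> where \<beta>: "\<beta> \<in> A" "l \<beta> \<noteq> 0" using l(1) by blast
    have "\<exists>c\<in>conic_atoms {x \<in> X. ?g x = 0} \<phi>. \<forall>\<alpha>\<in>A - {\<beta>}. c \<alpha> = ?v \<alpha>"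
      using \<beta> psubset.prems(1) by (intro psubset.IH X') auto
    then obtain c where c: "c \<in> conic_atoms {x \<in> X. ?g x = 0} \<phi>" "\<And>\<alpha>. \<alpha> \<in> A - {\<beta>} \<Longrightarrow> c \<alpha> = ?v \<alpha>"
      by blast
    obtain U \<kappa> where U: "c = (\<lambda>\<alpha>. \<Sum>u\<in>U. \<kappa> u * \<phi> u \<alpha>)" "U \<subseteq> {x \<in> X. ?g x = 0}"
      using c(1) unfolding conic_atoms_def by blast
    \<comment> \<open>All atoms lie in the zero set of the functional, so the dropped coordinate
      \<beta> is recovered from the others.\<close>
    have "(\<Sum>\<alpha>\<in>A. l \<alpha> * c \<alpha>) = (\<Sum>u\<in>U. \<kappa> u * ?g u)"
      unfolding U(1) sum_distrib_left by (subst sum.swap) (simp add: mult_ac)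
    also have "\<dots> = 0" using U(2) by (intro sum.neutral) auto
    finally have "(\<Sum>\<alpha>\<in>A. l \<alpha> * (c \<alpha> - ?v \<alpha>)) = 0"
      using zero by (simp add: right_diff_distrib sum_subtractf)
    then have "l \<beta> * (c \<beta> - ?v \<beta>) = 0"
      using psubset.hyps(1) \<beta>(1) c(2) by (subst (asm) sum.remove[of _ \<beta>]) auto
    then have "\<forall>\<alpha>\<in>A. c \<alpha> = ?v \<alpha>" using \<beta> c(2) by auto
    moreover have "c \<in> conic_atoms X \<phi>" using c(1) conic_atoms_mono[of "{x \<in> X. ?g x = 0}" X \<phi>] by blast
    ultimately show False using no by blast
  qed
qed

text \<open>The complement of the support is a union of open null sets, and by the Lindelof property
  a countable subfamily already covers it.\<close>

lemma AE_in_supp: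
  fixes M :: "'a::second_countable_topology measure"
  assumes "sets M = sets borel"
  shows "AE x in M. x \<in> supp M"
proof -
  let ?F = "{U. open U \<and> emeasure M U = 0}"
  obtain F where F: "F \<subseteq> ?F" "countable F" "\<Union>F = \<Union>?F"
    using Lindelof[of ?F] by auto
  have "(\<Union>U\<in>F. U) \<in> null_sets M"
    using F assms by (intro null_sets_UN') (auto simp: null_sets_def)
  then show ?thesis
    by (rule AE_I') (use F(3) in \<open>auto simp: supp_def\<close>)
qed

lemma finite_bolzano_weierstrass:
  fixes f :: "nat \<Rightarrow> 'e \<Rightarrow> real"
  assumes "finite A" and "\<And>\<alpha>. \<alpha> \<in> A \<Longrightarrow> bounded (range (\<lambda>n. f n \<alpha>))"
  shows "\<exists>l r. strict_mono r \<and> (\<forall>\<alpha>\<in>A. (\<lambda>n. f (r n) \<alpha>) \<longlonglongrightarrow> l \<alpha>)"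
  using assms
proof (induction A rule: finite_induct)
  case empty
  then show ?case using strict_mono_id by auto
next
  case (insert \<beta> A)
  then obtain l r where r: "strict_mono (r :: nat \<Rightarrow> nat)" "\<And>\<alpha>. \<alpha> \<in> A \<Longrightarrow> (\<lambda>n. f (r n) \<alpha>) \<longlonglongrightarrow> l \<alpha>" by auto
  have "bounded (range (\<lambda>n. f (r n) \<beta>))"
    by (rule bounded_subset[OF insert.prems[of \<beta>]]) auto
  then obtain b q where q: "strict_mono (q :: nat \<Rightarrow> nat)" "((\<lambda>n. f (r n) \<beta>) \<circ> q) \<longlonglongrightarrow> b"
    using bounded_imp_convergent_subsequence by blast
  have "(\<lambda>n. f ((r \<circ> q) n) \<alpha>) \<longlonglongrightarrow> (l(\<beta> := b)) \<alpha>" if "\<alpha> \<in> insert \<beta> A" for \<alpha>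
    using that q(2) insert.hyps LIMSEQ_subseq_LIMSEQ[OF r(2) q(1), of \<alpha>]
    by (cases "\<alpha> = \<beta>") (auto simp: o_def)
  then show ?case using strict_mono_o[OF r(1) q(1)] by blast
qed


section \<open>Bernstein approximation on the cube\<close>

text \<open>Factorial moments of the binomial distribution, from (M choose k)(k choose a) = (M
  choose a)(M - a choose k - a). Stated in a commutative ring because \<open>t\<close> and
  \<open>s\<close> become the polynomials (1 + x_i)/2 and (1 - x_i)/2.\<close>

lemma bernstein_moment:
  fixes t s :: "'a::comm_ring_1"
  assumes "t + s = 1" "a \<le> M"
  shows "(\<Sum>k\<le>M. of_nat (k choose a) * (of_nat (M choose k) * t ^ k * s ^ (M - k)))
    = of_nat (M choose a) * t ^ a"
proof -
  have "(\<Sum>k\<le>M. of_nat (k choose a) * (of_nat (M choose k) * t ^ k * s ^ (M - k)))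
      = (\<Sum>k\<in>{a..M}. of_nat (k choose a) * (of_nat (M choose k) * t ^ k * s ^ (M - k)))"
    by (intro sum.mono_neutral_right) (auto simp: binomial_eq_0 not_le)
  also have "\<dots> = (\<Sum>j\<le>M - a. of_nat ((j + a) choose a) * (of_nat (M choose (j + a)) * t ^ (j + a) * s ^ (M - (j + a))))"
    by (rule sum.reindex_bij_witness[of _ "\<lambda>j. j + a" "\<lambda>k. k - a"]) (use assms(2) in auto)
  also have "\<dots> = (\<Sum>j\<le>M - a. of_nat (M choose a) * t ^ a * (of_nat ((M - a) choose j) * t ^ j * s ^ (M - a - j)))"
  proof (rule sum.cong[OF refl])
    fix j assume "j \<in> {..M - a}"
    then have "(M choose (j + a)) * ((j + a) choose a) = (M choose a) * ((M - a) choose j)"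
      using choose_mult[of a "j + a" M] assms(2) by auto
    then have "of_nat (M choose (j + a)) * of_nat ((j + a) choose a)
        = (of_nat (M choose a) * of_nat ((M - a) choose j) :: 'a)"
      by (metis of_nat_mult)
    moreover have "of_nat ((j + a) choose a) * (of_nat (M choose (j + a)) * t ^ (j + a) * s ^ (M - (j + a)))
        = (of_nat (M choose (j + a)) * of_nat ((j + a) choose a)) * (t ^ a * t ^ j * s ^ (M - a - j))"
      by (simp add: power_add add.commute[of j a] mult_ac)
    ultimately show "of_nat ((j + a) choose a) * (of_nat (M choose (j + a)) * t ^ (j + a) * s ^ (M - (j + a)))
        = of_nat (M choose a) * t ^ a * (of_nat ((M - a) choose j) * t ^ j * s ^ (M - a - j))"
      by (simp add: mult_ac)
  qed
  also have "\<dots> = of_nat (M choose a) * t ^ a * (t + s) ^ (M - a)"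
    by (simp add: binomial_ring sum_distrib_left)
  finally show ?thesis using assms(1) by simp
qed

text \<open>For a > k both sides vanish, since natural subtraction makes the factor at i = k
  zero.\<close>

lemma binomial_ratio_prod:
  assumes "a \<le> M" "k \<le> M"
  shows "real (k choose a) / real (M choose a) = (\<Prod>i<a. real (k - i) / real (M - i))"
proof (cases "a \<le> k")
  case True
  have "(\<Prod>i<a. real (k - i) / real (M - i)) = (\<Prod>i<a. (real (k - i) / real (a - i)) / (real (M - i) / real (a - i)))"
    by (intro prod.cong) auto
  then show ?thesis
    using True assms by (simp add: binomial_altdef_of_nat prod_dividef atLeast0LessThan)
next
  case False
  then have "(\<Prod>i<a. real (k - i) / real (M - i)) = 0"
    by (intro prod_zero) (auto intro!: bexI[of _ k])
  then show ?thesis using False by (simp add: binomial_eq_0)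
qed

lemma binomial_ratio_bounds:
  assumes "a \<le> M" "k \<le> M"
  shows "\<bar>real (k choose a) / real (M choose a)\<bar> \<le> 1"
  using binomial_right_mono[OF assms(2), of a] assms by (simp add: divide_le_eq)

text \<open>The factors (k - i)/(M - i) are compared with k/M; products of numbers of modulus at
  most 1 differ by at most the sum of the differences of their factors. The bound is uniform in
  \<open>k\<close> and tends to 0 as \<open>M\<close> grows.\<close>

lemma binomial_ratio_approx:
  assumes "a < M" "k \<le> M"
  shows "\<bar>real (k choose a) / real (M choose a) - (real k / real M) ^ a\<bar> \<le> real a * (real a / (real M - real a))"
proof -
  have *: "\<bar>real (k - i) / real (M - i) - real k / real M\<bar> \<le> real a / (real M - real a)" if i: "i < a" for i
  proof -
    have M: "real (M - i) = real M - real i" "real M - real i > 0" using assms i by auto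
    have up: "real i / (real M - real i) \<le> real a / (real M - real a)"
      using assms i by (intro frac_le) auto
    show ?thesis
    proof (cases "i \<le> k")
      case True
      then have "real (k - i) = real k - real i" by simp
      then have eq: "real k / real M - real (k - i) / real (M - i) = real i / (real M - real i) * ((real M - real k) / real M)"
        using M assms by (simp add: field_simps)
      have 1: "\<bar>(real M - real k) / real M\<bar> \<le> 1"
        using assms by (simp add: divide_simps)
      have "\<bar>real k / real M - real (k - i) / real (M - i)\<bar> \<le> real i / (real M - real i) * 1"
        unfolding eq abs_mult using 1 M by (intro mult_mono) auto
      then show ?thesis using up by (simp add: abs_minus_commute)
    next
      case False
      then have "real k / real M \<le> real i / (real M - real i)"
        using M by (intro frac_le) auto
      then show ?thesis using up False by simp
    qed
  qed
  have "\<bar>(\<Prod>i<a. real (k - i) / real (M - i)) - (\<Prod>i<a. real k / real M)\<bar>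
      \<le> (\<Sum>i<a. \<bar>real (k - i) / real (M - i) - real k / real M\<bar>)"
    by (rule norm_prod_diff[where 'a = real, unfolded real_norm_def])
      (use assms in \<open>auto simp: divide_simps\<close>)
  also have "\<dots> \<le> (\<Sum>i<a. real a / (real M - real a))"
    using * by (intro sum_mono) auto
  finally show ?thesis using assms by (simp add: binomial_ratio_prod)
qed

text \<open>Tensor products of univariate Bernstein polynomials, transported from [0,1] to [-1,1] by
  t = (1 + x)/2; \<open>node\<close> is the matching grid point.\<close>

definition bernstein :: "nat \<Rightarrow> ('n::finite \<Rightarrow> nat) \<Rightarrow> 'n mpoly"
  where "bernstein M k = (\<Prod>i\<in>UNIV. of_nat (M choose k i)
    * ((1 / 2) *\<^sub>R (1 + var i)) ^ k i * ((1 / 2) *\<^sub>R (1 - var i)) ^ (M - k i))"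

definition node :: "nat \<Rightarrow> ('n \<Rightarrow> nat) \<Rightarrow> real ^ ('n::finite)"
  where "node M k = (\<chi> i. 2 * (real (k i) / real M) - 1)"

text \<open>Monomials in the variables (1 + x_i)/2: their Bernstein coefficients are plain products
  of binomial ratios.\<close>

definition half_monom :: "'n::finite exponent \<Rightarrow> 'n mpoly"
  where "half_monom \<alpha> = (\<Prod>i\<in>UNIV. ((1 / 2) *\<^sub>R (1 + var i)) ^ Poly_Mapping.lookup \<alpha> i)"

abbreviation grid :: "nat \<Rightarrow> ('n \<Rightarrow> nat) set"
  where "grid M \<equiv> UNIV \<rightarrow>\<^sub>E {..M}"

lemma of_nat_mult_mpoly: "of_nat k * (p :: 'n mpoly) = real k *\<^sub>R p"
  by (simp add: scaleR_eq_mult single_of_nat)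

lemma lookup_le_mdeg: "Poly_Mapping.lookup \<alpha> i \<le> mdeg (\<alpha> :: 'n::finite exponent)"
  unfolding mdeg_def by (rule member_le_sum) auto

text \<open>\<open>bernstein_moment\<close> in each variable separately; multiplying out gives a sum
  over the grid. The degree bound keeps the binomials in the denominators nonzero.\<close>

lemma half_monom_bernstein:
  fixes \<alpha> :: "'n::finite exponent"
  assumes "mdeg \<alpha> \<le> M"
  shows "half_monom \<alpha> = (\<Sum>k\<in>grid M. (\<Prod>i\<in>UNIV. real (k i choose Poly_Mapping.lookup \<alpha> i)
    / real (M choose Poly_Mapping.lookup \<alpha> i)) *\<^sub>R bernstein M k)"
proof -
  let ?a = "Poly_Mapping.lookup \<alpha>"
  let ?t = "\<lambda>i :: 'n. (1 / 2) *\<^sub>R (1 + var i) :: 'n mpoly" and ?s = "\<lambda>i :: 'n. (1 / 2) *\<^sub>R (1 - var i) :: 'n mpoly"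
  have aM: "?a i \<le> M" for i using lookup_le_mdeg[of \<alpha> i] assms by linarith
  have ts: "?t i + ?s i = 1" for i
  proof -
    have "(1 + x) + (1 - x) = 1 + 1" for x :: "'n mpoly" by (simp only: add.assoc) simp
    then show ?thesis by (simp only: scaleR_add_right[symmetric] scaleR_half_double)
  qed
  have prod_of_nat: "(\<Prod>i\<in>UNIV. of_nat (c i) * f i) = (\<Prod>i\<in>UNIV. real (c i)) *\<^sub>R (\<Prod>i\<in>UNIV. f i)"
    for c :: "'n \<Rightarrow> nat" and f :: "'n \<Rightarrow> 'n mpoly"
    unfolding prod.distrib of_nat_prod[symmetric] by (rule of_nat_mult_mpoly)
  have "(\<Prod>i\<in>UNIV. real (M choose ?a i)) *\<^sub>R half_monom \<alpha> = (\<Prod>i\<in>UNIV. of_nat (M choose ?a i) * ?t i ^ ?a i)"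
    by (simp add: half_monom_def prod_of_nat)
  also have "\<dots> = (\<Prod>i\<in>UNIV. \<Sum>k\<le>M. of_nat (k choose ?a i) * (of_nat (M choose k) * ?t i ^ k * ?s i ^ (M - k)))"
    by (simp only: bernstein_moment[OF ts aM])
  also have "\<dots> = (\<Sum>k\<in>grid M. \<Prod>i\<in>UNIV. of_nat (k i choose ?a i) * (of_nat (M choose k i) * ?t i ^ k i * ?s i ^ (M - k i)))"
    by (rule prod_sum_PiE) auto
  also have "\<dots> = (\<Sum>k\<in>grid M. (\<Prod>i\<in>UNIV. real (k i choose ?a i)) *\<^sub>R bernstein M k)"
    by (simp only: prod_of_nat bernstein_def)
  finally have *: "(\<Prod>i\<in>UNIV. real (M choose ?a i)) *\<^sub>R half_monom \<alpha>
      = (\<Sum>k\<in>grid M. (\<Prod>i\<in>UNIV. real (k i choose ?a i)) *\<^sub>R bernstein M k)" .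
  have pos: "(\<Prod>i\<in>UNIV. real (M choose ?a i)) \<noteq> 0" using aM by (simp add: binomial_eq_0_iff not_less)
  have "half_monom \<alpha> = (1 / (\<Prod>i\<in>UNIV. real (M choose ?a i))) *\<^sub>R ((\<Prod>i\<in>UNIV. real (M choose ?a i)) *\<^sub>R half_monom \<alpha>)"
    using pos by simp
  then show ?thesis
    unfolding * scaleR_sum_right by (simp add: prod_dividef)
qed

lemma poly_eval_prod: "poly_eval (\<Prod>i\<in>I. f i) x = (\<Prod>i\<in>I. poly_eval (f i) x)"
  by (induction I rule: infinite_finite_induct) auto

lemma half_monom_approx:
  fixes \<alpha> :: "'n::finite exponent"
  assumes "\<epsilon> > 0"
  shows "\<exists>M0\<ge>mdeg \<alpha>. \<forall>M\<ge>M0. \<forall>k\<in>grid M.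
    \<bar>(\<Prod>i\<in>UNIV. real (k i choose Poly_Mapping.lookup \<alpha> i) / real (M choose Poly_Mapping.lookup \<alpha> i))
      - poly_eval (half_monom \<alpha>) (node M k)\<bar> \<le> \<epsilon>"
proof -
  let ?a = "Poly_Mapping.lookup \<alpha>"
  define D where "D = mdeg \<alpha>"
  \<comment> \<open>For M - D > N each of the \<open>CARD('n)\<close> coordinates then contributes
    an error of at most D^2 / (N + 1), which is at most \<epsilon> /
    \<open>CARD('n)\<close>.\<close>
  obtain N :: nat where N: "real CARD('n) * real D * real D / \<epsilon> < real N" using reals_Archimedean2 by blast
  have "\<bar>(\<Prod>i\<in>UNIV. real (k i choose ?a i) / real (M choose ?a i)) - poly_eval (half_monom \<alpha>) (node M k)\<bar> \<le> \<epsilon>"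
    if M: "M \<ge> Suc (N + D)" and k: "k \<in> grid M" for M k
  proof -
    have aD: "?a i \<le> D" for i using lookup_le_mdeg[of \<alpha> i] by (simp add: D_def)
    have ki: "k i \<le> M" for i using k by auto
    have "poly_eval (half_monom \<alpha>) (node M k) = (\<Prod>i\<in>UNIV. (real (k i) / real M) ^ ?a i)"
      by (simp add: half_monom_def poly_eval_prod node_def)
    moreover have "\<bar>(\<Prod>i\<in>UNIV. real (k i choose ?a i) / real (M choose ?a i)) - (\<Prod>i\<in>UNIV. (real (k i) / real M) ^ ?a i)\<bar>
        \<le> (\<Sum>i\<in>UNIV. \<bar>real (k i choose ?a i) / real (M choose ?a i) - (real (k i) / real M) ^ ?a i\<bar>)"
    proof (rule norm_prod_diff[where 'a = real, unfolded real_norm_def])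
      fix i
      show "\<bar>real (k i choose ?a i) / real (M choose ?a i)\<bar> \<le> 1"
        by (rule binomial_ratio_bounds) (use ki M aD[of i] in auto)
      show "\<bar>(real (k i) / real M) ^ ?a i\<bar> \<le> 1"
        unfolding power_abs by (rule power_le_one) (use ki[of i] M in auto)
    qed
    moreover have "\<dots> \<le> (\<Sum>i\<in>(UNIV :: 'n set). \<epsilon> / real CARD('n))"
    proof (rule sum_mono)
      fix i
      have a: "?a i < M" using aD[of i] M by simp
      have "\<bar>real (k i choose ?a i) / real (M choose ?a i) - (real (k i) / real M) ^ ?a i\<bar>
          \<le> real (?a i) * (real (?a i) / (real M - real (?a i)))"
        by (rule binomial_ratio_approx[OF a ki])
      also have "\<dots> \<le> real D * (real D / (real N + 1))"
        using M aD[of i] by (intro mult_mono frac_le) auto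
      also have "\<dots> \<le> \<epsilon> / real CARD('n)"
      proof -
        have "real CARD('n) * real D * real D \<le> \<epsilon> * (real N + 1)"
          using N assms by (simp add: field_simps)
        then show ?thesis by (simp add: field_simps)
      qed
      finally show "\<bar>real (k i choose ?a i) / real (M choose ?a i) - (real (k i) / real M) ^ ?a i\<bar> \<le> \<epsilon> / real CARD('n)" .
    qed
    ultimately show ?thesis by simp
  qed
  then show ?thesis by (intro exI[of _ "Suc (N + D)"]) (auto simp: D_def)
qed

text \<open>The expansion is an exact identity of polynomials; only its coefficients are
  approximately the values at the nodes. Asking for all large \<open>M\<close> lets two expansions
  be added at the same \<open>M\<close>, so a spanning set of polynomials suffices.\<close>

definition bernstein_approximable :: "('n::finite) mpoly set"
  where "bernstein_approximable = {h. \<forall>\<epsilon>>0. \<exists>M0. \<forall>M\<ge>M0. \<exists>c.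
    h = (\<Sum>k\<in>grid M. c k *\<^sub>R bernstein M k) \<and> (\<forall>k\<in>grid M. \<bar>c k - poly_eval h (node M k)\<bar> \<le> \<epsilon>)}"

lemma subspace_bernstein_approximable: "subspace bernstein_approximable"
proof (rule subspaceI)
  show "0 \<in> bernstein_approximable"
    unfolding bernstein_approximable_def by (auto intro!: exI[of _ "\<lambda>_. 0"])
next
  fix g h :: "'n::finite mpoly" assume g: "g \<in> bernstein_approximable" and h: "h \<in> bernstein_approximable"
  show "g + h \<in> bernstein_approximable"
    unfolding bernstein_approximable_def
  proof (intro CollectI allI impI)
    fix \<epsilon> :: real assume \<epsilon>: "\<epsilon> > 0"
    obtain M1 where M1: "\<And>M. M \<ge> M1 \<Longrightarrow> \<exists>c. g = (\<Sum>k\<in>grid M. c k *\<^sub>R bernstein M k)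
        \<and> (\<forall>k\<in>grid M. \<bar>c k - poly_eval g (node M k)\<bar> \<le> \<epsilon> / 2)"
      using g \<epsilon> half_gt_zero[OF \<epsilon>] unfolding bernstein_approximable_def by blast
    obtain M2 where M2: "\<And>M. M \<ge> M2 \<Longrightarrow> \<exists>c. h = (\<Sum>k\<in>grid M. c k *\<^sub>R bernstein M k)
        \<and> (\<forall>k\<in>grid M. \<bar>c k - poly_eval h (node M k)\<bar> \<le> \<epsilon> / 2)"
      using h \<epsilon> half_gt_zero[OF \<epsilon>] unfolding bernstein_approximable_def by blast
    have "\<exists>c. g + h = (\<Sum>k\<in>grid M. c k *\<^sub>R bernstein M k)
        \<and> (\<forall>k\<in>grid M. \<bar>c k - poly_eval (g + h) (node M k)\<bar> \<le> \<epsilon>)" if M: "M \<ge> max M1 M2" for M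
    proof -
      obtain c where c: "g = (\<Sum>k\<in>grid M. c k *\<^sub>R bernstein M k)"
        "\<And>k. k \<in> grid M \<Longrightarrow> \<bar>c k - poly_eval g (node M k)\<bar> \<le> \<epsilon> / 2" using M1[of M] M by auto
      obtain c' where c': "h = (\<Sum>k\<in>grid M. c' k *\<^sub>R bernstein M k)"
        "\<And>k. k \<in> grid M \<Longrightarrow> \<bar>c' k - poly_eval h (node M k)\<bar> \<le> \<epsilon> / 2" using M2[of M] M by auto
      have "g + h = (\<Sum>k\<in>grid M. (c k + c' k) *\<^sub>R bernstein M k)"
        by (subst c(1), subst c'(1)) (simp add: scaleR_add_left sum.distrib)
      moreover have "\<bar>c k + c' k - poly_eval (g + h) (node M k)\<bar> \<le> \<epsilon>" if "k \<in> grid M" for k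
        using c(2)[OF that] c'(2)[OF that] unfolding poly_eval_simps by linarith
      ultimately show ?thesis by (intro exI[of _ "\<lambda>k. c k + c' k"]) auto
    qed
    then show "\<exists>M0. \<forall>M\<ge>M0. \<exists>c. g + h = (\<Sum>k\<in>grid M. c k *\<^sub>R bernstein M k)
        \<and> (\<forall>k\<in>grid M. \<bar>c k - poly_eval (g + h) (node M k)\<bar> \<le> \<epsilon>)" by blast
  qed
next
  fix r and h :: "'n::finite mpoly" assume h: "h \<in> bernstein_approximable"
  show "r *\<^sub>R h \<in> bernstein_approximable"
    unfolding bernstein_approximable_def
  proof (intro CollectI allI impI)
    fix \<epsilon> :: real assume \<epsilon>: "\<epsilon> > 0"
    define \<delta> where "\<delta> = \<epsilon> / (\<bar>r\<bar> + 1)"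
    have \<delta>: "\<delta> > 0" using \<epsilon> by (simp add: \<delta>_def add_nonneg_pos)
    obtain M0 where M0: "\<And>M. M \<ge> M0 \<Longrightarrow> \<exists>c. h = (\<Sum>k\<in>grid M. c k *\<^sub>R bernstein M k)
        \<and> (\<forall>k\<in>grid M. \<bar>c k - poly_eval h (node M k)\<bar> \<le> \<delta>)"
      using h \<delta> unfolding bernstein_approximable_def by blast
    have "\<exists>c. r *\<^sub>R h = (\<Sum>k\<in>grid M. c k *\<^sub>R bernstein M k)
        \<and> (\<forall>k\<in>grid M. \<bar>c k - poly_eval (r *\<^sub>R h) (node M k)\<bar> \<le> \<epsilon>)" if M: "M \<ge> M0" for M
    proof -
      obtain c where c: "h = (\<Sum>k\<in>grid M. c k *\<^sub>R bernstein M k)"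
        "\<And>k. k \<in> grid M \<Longrightarrow> \<bar>c k - poly_eval h (node M k)\<bar> \<le> \<delta>" using M0[of M] M by auto
      have "r *\<^sub>R h = (\<Sum>k\<in>grid M. (r * c k) *\<^sub>R bernstein M k)"
        by (subst c(1)) (simp add: scaleR_sum_right)
      moreover have "\<bar>r * c k - poly_eval (r *\<^sub>R h) (node M k)\<bar> \<le> \<epsilon>" if "k \<in> grid M" for k
      proof -
        have "\<bar>r * c k - poly_eval (r *\<^sub>R h) (node M k)\<bar> = \<bar>r\<bar> * \<bar>c k - poly_eval h (node M k)\<bar>"
          by (simp add: abs_mult[symmetric] right_diff_distrib)
        also have "\<dots> \<le> (\<bar>r\<bar> + 1) * \<delta>" using c(2)[OF that] by (intro mult_mono) auto
        finally show ?thesis by (simp add: \<delta>_def)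
      qed
      ultimately show ?thesis by (intro exI[of _ "\<lambda>k. r * c k"]) auto
    qed
    then show "\<exists>M0. \<forall>M\<ge>M0. \<exists>c. r *\<^sub>R h = (\<Sum>k\<in>grid M. c k *\<^sub>R bernstein M k)
        \<and> (\<forall>k\<in>grid M. \<bar>c k - poly_eval (r *\<^sub>R h) (node M k)\<bar> \<le> \<epsilon>)" by blast
  qed
qed

lemma half_monom_approximable: "half_monom \<alpha> \<in> bernstein_approximable"
  unfolding bernstein_approximable_def
proof (intro CollectI allI impI)
  fix \<epsilon> :: real assume "\<epsilon> > 0"
  obtain M0 where M0: "\<And>M k. M \<ge> M0 \<Longrightarrow> k \<in> grid M \<Longrightarrow>
    \<bar>(\<Prod>i\<in>UNIV. real (k i choose Poly_Mapping.lookup \<alpha> i) / real (M choose Poly_Mapping.lookup \<alpha> i))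
      - poly_eval (half_monom \<alpha>) (node M k)\<bar> \<le> \<epsilon>" "M0 \<ge> mdeg \<alpha>"
    using half_monom_approx[OF \<open>\<epsilon> > 0\<close>, of \<alpha>] by auto
  have "\<exists>c. half_monom \<alpha> = (\<Sum>k\<in>grid M. c k *\<^sub>R bernstein M k)
      \<and> (\<forall>k\<in>grid M. \<bar>c k - poly_eval (half_monom \<alpha>) (node M k)\<bar> \<le> \<epsilon>)" if "M \<ge> M0" for M
    by (rule exI[of _ "\<lambda>k. \<Prod>i\<in>UNIV. real (k i choose Poly_Mapping.lookup \<alpha> i)
      / real (M choose Poly_Mapping.lookup \<alpha> i)"], intro conjI ballI)
      (rule half_monom_bernstein[OF order_trans[OF M0(2) that]], rule M0(1)[OF that])
  then show "\<exists>M0. \<forall>M\<ge>M0. \<exists>c. half_monom \<alpha> = (\<Sum>k\<in>grid M. c k *\<^sub>R bernstein M k)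
      \<and> (\<forall>k\<in>grid M. \<bar>c k - poly_eval (half_monom \<alpha>) (node M k)\<bar> \<le> \<epsilon>)"
    by (intro exI[of _ M0] allI impI)
qed

text \<open>The half-monomials span all polynomials because x_i is twice (1 + x_i)/2 minus
  1.\<close>

lemma bernstein_approximable:
  fixes h :: "'n::finite mpoly"
  shows "h \<in> bernstein_approximable"
proof -
  have half_add: "half_monom (Poly_Mapping.single i 1 + \<alpha>) = (1 / 2) *\<^sub>R (1 + var i) * half_monom \<alpha>"
    for i and \<alpha> :: "'n exponent"
  proof -
    have "(\<Prod>j\<in>UNIV. ((1 / 2) *\<^sub>R (1 + var j)) ^ Poly_Mapping.lookup (Poly_Mapping.single i (1 :: nat)) j)
        = (\<Prod>j\<in>UNIV. if j = i then (1 / 2) *\<^sub>R (1 + var i) else (1 :: 'n mpoly))"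
      by (intro prod.cong) (auto simp: lookup_single when_def)
    then show ?thesis by (simp add: half_monom_def lookup_add power_add prod.distrib)
  qed
  have "h \<in> span (range half_monom)"
  proof (rule mpoly_var_induct)
    show "1 \<in> span (range half_monom)"
      by (rule span_base) (auto simp: half_monom_def intro!: image_eqI[of _ _ 0])
    fix i and p :: "'n mpoly"
    assume "p \<in> span (range half_monom)"
    then show "var i * p \<in> span (range half_monom)"
    proof (induction rule: span_induct_alt)
      case base
      then show ?case by (simp add: span_zero)
    next
      case (step c x y)
      then obtain \<alpha> where "x = half_monom \<alpha>" by blast
      then have "var i * x = 2 *\<^sub>R half_monom (Poly_Mapping.single i 1 + \<alpha>) - x"
        unfolding half_add by (simp add: mult_scaleR_mpoly ring_distribs)
      moreover have "\<dots> \<in> span (range half_monom)"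
        using step(1) by (intro span_diff span_scale) (auto intro: span_base)
      ultimately show ?case using step(2)
        by (simp add: ring_distribs mult_scaleR_mpoly span_add span_scale)
    qed
  qed simp
  moreover have "span (range half_monom) \<subseteq> (bernstein_approximable :: 'n mpoly set)"
    by (rule span_minimal[OF _ subspace_bernstein_approximable]) (auto intro: half_monom_approximable)
  ultimately show ?thesis by blast
qed

section \<open>Certificates of positivity on the cube\<close>

locale mpoly_semicone =
  fixes P :: "('n::finite) mpoly set"
  assumes add: "\<And>p q. p \<in> P \<Longrightarrow> q \<in> P \<Longrightarrow> p + q \<in> P"
    and mult: "\<And>p q. p \<in> P \<Longrightarrow> q \<in> P \<Longrightarrow> p * q \<in> P"
    and scale: "\<And>r p. r \<ge> 0 \<Longrightarrow> p \<in> P \<Longrightarrow> r *\<^sub>R p \<in> P"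
    and one: "1 \<in> P"
begin

lemma zero: "0 \<in> P" using scale[of 0 1] one by simp

lemma sum_mem: "(\<And>i. i \<in> I \<Longrightarrow> f i \<in> P) \<Longrightarrow> sum f I \<in> P"
  by (induction I rule: infinite_finite_induct) (auto intro: zero add)

lemma prod_mem: "(\<And>i. i \<in> I \<Longrightarrow> f i \<in> P) \<Longrightarrow> prod f I \<in> P"
  by (induction I rule: infinite_finite_induct) (auto intro: one mult)

lemma power_mem: "p \<in> P \<Longrightarrow> p ^ k \<in> P"
  by (induction k) (auto intro: one mult)

text \<open>For large \<open>M\<close> every Bernstein coefficient is within \<eta> of a value that
  is at least \<eta>, hence nonnegative, while the Bernstein polynomials are products of elements of
  \<open>P\<close>.\<close>

theorem positive_on_cube:
  assumes lin: "\<And>i. (1 / 2) *\<^sub>R (1 + var i) \<in> P" "\<And>i. (1 / 2) *\<^sub>R (1 - var i) \<in> P"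
    and \<eta>: "\<eta> > 0" and pos: "\<And>x. (\<And>i. \<bar>x $ i\<bar> \<le> 1) \<Longrightarrow> \<eta> \<le> poly_eval h x"
  shows "h \<in> P"
proof -
  obtain M0 where M0: "\<And>M. M \<ge> M0 \<Longrightarrow> \<exists>c. h = (\<Sum>k\<in>grid M. c k *\<^sub>R bernstein M k)
      \<and> (\<forall>k\<in>grid M. \<bar>c k - poly_eval h (node M k)\<bar> \<le> \<eta>)"
    using bernstein_approximable[of h] \<eta> unfolding bernstein_approximable_def by blast
  define M where "M = Suc M0"
  obtain c where c: "h = (\<Sum>k\<in>grid M. c k *\<^sub>R bernstein M k)"
    "\<And>k. k \<in> grid M \<Longrightarrow> \<bar>c k - poly_eval h (node M k)\<bar> \<le> \<eta>"
    using M0[of M] by (auto simp: M_def)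
  have "bernstein M k \<in> P" for k :: "'n \<Rightarrow> nat"
    unfolding bernstein_def of_nat_mult_mpoly mult_scaleR_mpoly
    by (intro prod_mem mult power_mem lin scale) auto
  moreover have "0 \<le> c k" if "k \<in> grid M" for k
  proof -
    have "\<bar>node M k $ i\<bar> \<le> 1" for i
    proof -
      have "k i \<le> M" using that by auto
      then have "real (k i) / real M \<le> 1" "0 \<le> real (k i) / real M" by (auto simp: M_def)
      then show ?thesis unfolding node_def by (simp add: abs_le_iff)
    qed
    from pos[of "node M k", OF this] c(2)[OF that] show ?thesis by linarith
  qed
  ultimately show ?thesis by (subst c(1)) (intro sum_mem scale)
qed

end


section \<open>Positive polynomials on the sphere\<close>

text \<open>Sums of squares modulo the ideal of \<open>h\<close>. This is closed under products, as
  the products in the Bernstein basis require.\<close>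

inductive_set sos_mod :: "'n mpoly \<Rightarrow> 'n mpoly set" for h :: "'n mpoly" where
  square: "q\<^sup>2 \<in> sos_mod h"
| ideal: "h * r \<in> sos_mod h"
| plus: "p \<in> sos_mod h \<Longrightarrow> q \<in> sos_mod h \<Longrightarrow> p + q \<in> sos_mod h"

lemma sos_mod_mult:
  assumes "p \<in> sos_mod h" "q \<in> sos_mod h"
  shows "p * q \<in> sos_mod h"
  using assms
proof (induction p rule: sos_mod.induct)
  case (square p)
  from square.prems show ?case
  proof (induction q rule: sos_mod.induct)
    case (square q)
    then show ?case by (metis power_mult_distrib sos_mod.square)
  next
    case (ideal r)
    then show ?case by (metis mult.left_commute sos_mod.ideal)
  next
    case (plus q1 q2)
    then show ?case by (simp add: distrib_left sos_mod.plus)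
  qed
next
  case (ideal r)
  then show ?case by (metis mult.assoc sos_mod.ideal)
next
  case (plus p1 p2)
  then show ?case by (simp add: distrib_right sos_mod.plus)
qed

lemma sos_mod_scale:
  assumes "p \<in> sos_mod h" "r \<ge> 0"
  shows "r *\<^sub>R p \<in> sos_mod h"
  using assms(1)
proof (induction p rule: sos_mod.induct)
  case (square q)
  have "r *\<^sub>R q\<^sup>2 = (sqrt r *\<^sub>R q)\<^sup>2"
    using assms(2) by (simp add: power2_eq_square mult_scaleR_mpoly)
  then show ?case by (metis sos_mod.square)
next
  case (ideal q)
  then show ?case by (metis mult_scaleR_mpoly(2) sos_mod.ideal)
next
  case (plus p q)
  then show ?case by (simp add: scaleR_add_right sos_mod.plus)
qed

lemma mpoly_semicone_sos_mod: "mpoly_semicone (sos_mod h)"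
proof
  show "1 \<in> sos_mod h" using sos_mod.square[of 1 h] by simp
qed (auto intro: sos_mod.plus sos_mod_mult sos_mod_scale)

definition sphere_poly :: "('n::finite) mpoly"
  where "sphere_poly = (\<Sum>i\<in>UNIV. (var i)\<^sup>2) - 1"

lemma poly_eval_sphere: "poly_eval sphere_poly x = (\<Sum>i\<in>UNIV. (x $ i)\<^sup>2) - 1"
  by (simp add: sphere_poly_def poly_eval_sum)

text \<open>\<open>2 (1 + x\<^sub>i) = (1 + x\<^sub>i)\<^sup>2 + \<Sum>\<^bsub>j \<noteq> i\<^esub> x\<^sub>j\<^sup>2\<close> on the sphere.\<close>

lemma half_one_plus_in_sos_mod:
  fixes e :: real
  assumes "e\<^sup>2 = 1"
  shows "(1 / 2) *\<^sub>R (1 + e *\<^sub>R var i) \<in> sos_mod (sphere_poly :: ('n::finite) mpoly)"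
proof -
  interpret mpoly_semicone "sos_mod (sphere_poly :: 'n mpoly)" by (rule mpoly_semicone_sos_mod)
  let ?x = "e *\<^sub>R var i :: 'n mpoly"
  let ?R = "\<Sum>j\<in>UNIV - {i}. (var j)\<^sup>2 :: 'n mpoly"
  have "(\<Sum>j\<in>UNIV. (var j :: 'n mpoly)\<^sup>2) = (var i)\<^sup>2 + ?R"
    by (rule sum.remove) auto
  moreover have "?x\<^sup>2 = (var i)\<^sup>2"
    using assms by (simp add: power2_eq_square mult_scaleR_mpoly)
  ultimately have sp: "sphere_poly = ?x\<^sup>2 + ?R - 1" unfolding sphere_poly_def by simp
  have "(1 + ?x)\<^sup>2 + ?R + sphere_poly * (- 1) = (1 + ?x) + (1 + ?x)"
    unfolding sp by (simp add: power2_eq_square algebra_simps)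
  then have "(1 + ?x)\<^sup>2 + ?R + sphere_poly * (- 1) = 2 *\<^sub>R (1 + ?x)"
    unfolding scaleR_2 .
  then have "(1 / 2) *\<^sub>R (1 + ?x) = (1 / 4) *\<^sub>R ((1 + ?x)\<^sup>2 + ?R + sphere_poly * (- 1))"
    by simp
  also have "\<dots> \<in> sos_mod sphere_poly"
    by (intro scale add sum_mem sos_mod.square sos_mod.ideal) auto
  finally show ?thesis .
qed

lemma compact_pos_lower_bound:
  fixes f :: "'a::topological_space \<Rightarrow> real"
  assumes "compact S" "continuous_on S f" "\<And>x. x \<in> S \<Longrightarrow> f x > 0"
  obtains \<eta> where "\<eta> > 0" "\<And>x. x \<in> S \<Longrightarrow> f x \<ge> \<eta>"
proof (cases "S = {}")
  case True
  then show ?thesis using that[of 1] by auto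
next
  case False
  then obtain x where "x \<in> S" "\<And>y. y \<in> S \<Longrightarrow> f x \<le> f y"
    using continuous_attains_inf[OF assms(1) _ assms(2)] by blast
  then show ?thesis using that[of "f x"] assms(3) by blast
qed

text \<open>Bernoulli's inequality bounds 1 + n s by (1 + s)^n, and (1 - s)^n (1 + s)^n = (1 -
  s^2)^n \<le> 1.\<close>

lemma mult_power_one_minus_le:
  fixes s :: real
  assumes "0 \<le> s" "s \<le> 1" "n > 0"
  shows "s * (1 - s) ^ n \<le> 1 / n"
proof -
  have "(1 - s) ^ n * (1 + n * s) \<le> (1 - s) ^ n * (1 + s) ^ n"
    using assms Bernoulli_inequality[of s n] by (intro mult_left_mono) auto
  also have "\<dots> = ((1 - s) * (1 + s)) ^ n" by (simp add: power_mult_distrib)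
  also have "(1 - s) * (1 + s) = 1 - s\<^sup>2" by (simp add: power2_eq_square algebra_simps)
  also have "(1 - s\<^sup>2) ^ n \<le> 1"
    using assms by (intro power_le_one) (auto simp: power2_eq_square mult_le_one)
  finally have "(1 - s) ^ n * (1 + n * s) \<le> 1" .
  moreover have "0 \<le> (1 - s) ^ n" using assms by simp
  ultimately have "n * (s * (1 - s) ^ n) \<le> 1" by (simp add: algebra_simps)
  then show ?thesis using assms(3) by (simp add: field_simps)
qed

text \<open>The multiplier \<open>\<lambda> (1 - g / M)\<^bsup>2N\<^esup>\<close> is at least \<open>\<lambda>\<close> where \<open>g < 0\<close>, while its product with \<open>g\<close>
  is at most \<open>\<lambda> M / (2 N)\<close> where \<open>g \<ge> 0\<close>.\<close>

lemma penalty: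
  fixes q g :: "('n::finite) mpoly"
  assumes X: "compact X" and pos: "\<And>x. x \<in> X \<Longrightarrow> poly_eval g x \<ge> 0 \<Longrightarrow> poly_eval q x > 0"
  obtains p where "\<And>x. x \<in> X \<Longrightarrow> poly_eval (q - g * p\<^sup>2) x > 0"
proof -
  have cont: "continuous_on S (poly_eval f)" for S and f :: "'n mpoly" by (intro continuous_intros)
  have closed: "compact {x \<in> X. poly_eval f x \<le> c}" "compact {x \<in> X. 0 \<le> poly_eval f x}"
    for f :: "'n mpoly" and c
  proof -
    have "closed {x. poly_eval f x \<le> c}" "closed {x. 0 \<le> poly_eval f x}"
      by (intro closed_Collect_le continuous_intros)+
    then have "compact (X \<inter> {x. poly_eval f x \<le> c})" "compact (X \<inter> {x. 0 \<le> poly_eval f x})"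
      using compact_Int_closed[OF X] by blast+
    moreover have "X \<inter> {x. poly_eval f x \<le> c} = {x \<in> X. poly_eval f x \<le> c}"
      "X \<inter> {x. 0 \<le> poly_eval f x} = {x \<in> X. 0 \<le> poly_eval f x}" by auto
    ultimately show "compact {x \<in> X. poly_eval f x \<le> c}" "compact {x \<in> X. 0 \<le> poly_eval f x}"
      by simp_all
  qed
  have bound: "\<exists>B>0. \<forall>x\<in>X. \<bar>poly_eval f x\<bar> \<le> B" for f :: "'n mpoly"
    using compact_imp_bounded[OF compact_continuous_image[OF cont X]] unfolding bounded_pos by auto
  obtain M where M: "M > 0" "\<And>x. x \<in> X \<Longrightarrow> \<bar>poly_eval g x\<bar> \<le> M" using bound[of g] by blast
  obtain B where B: "B > 0" "\<And>x. x \<in> X \<Longrightarrow> \<bar>poly_eval q x\<bar> \<le> B" using bound[of q] by blast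
  obtain \<eta> where \<eta>: "\<eta> > 0" "\<And>x. x \<in> X \<Longrightarrow> 0 \<le> poly_eval g x \<Longrightarrow> poly_eval q x \<ge> \<eta>"
    by (rule compact_pos_lower_bound[OF closed(2)[of g] cont[of _ q]]) (use pos in auto)
  \<comment> \<open>Where q \<le> \<eta>/2, the choice of \<eta> forces g < 0, and compactness makes
    this uniform.\<close>
  obtain \<delta> where \<delta>: "\<delta> > 0" "\<And>x. x \<in> X \<Longrightarrow> poly_eval q x \<le> \<eta> / 2 \<Longrightarrow> poly_eval (- g) x \<ge> \<delta>"
  proof (rule compact_pos_lower_bound[OF closed(1)[of q "\<eta> / 2"] cont[of _ "- g"]])
    fix x assume "x \<in> {x \<in> X. poly_eval q x \<le> \<eta> / 2}"
    then show "0 < poly_eval (- g) x" using \<eta>(2)[of x] \<eta>(1) by (cases "0 \<le> poly_eval g x") auto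
  qed auto
  \<comment> \<open>Where \<open>q\<close> is small, subtracting the penalty then adds at least l
    \<delta> = B + 1, which outweighs q \<ge> -B. The exponent below is chosen afterwards so that
    the loss l M / (2 N) on g \<ge> 0 stays below \<eta>.\<close>
  define l where "l = (B + 1) / \<delta>"
  have l: "l > 0" using B \<delta> by (simp add: l_def)
  obtain N :: nat where N: "l * M / \<eta> < N" using reals_Archimedean2 by blast
  then have N0: "N > 0" using l M \<eta> by (metis divide_pos_pos gr0I less_asym mult_pos_pos of_nat_0)
  define p where "p = sqrt l *\<^sub>R (1 - (1 / M) *\<^sub>R g) ^ N"
  have p2: "poly_eval (p\<^sup>2) x = l * (1 - poly_eval g x / M) ^ (2 * N)" for x
    using l by (simp add: p_def power_mult_distrib power_even_eq)
  have "poly_eval (q - g * p\<^sup>2) x > 0" if x: "x \<in> X" for x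
  proof -
    let ?g = "poly_eval g x" and ?q = "poly_eval q x"
    have eq: "poly_eval (q - g * p\<^sup>2) x = ?q - l * ?g * (1 - ?g / M) ^ (2 * N)"
      unfolding poly_eval_simps(3,8) p2 by (simp add: mult_ac)
    consider "?g \<ge> 0" | "?g < 0" "?q > \<eta> / 2" | "?g < 0" "?q \<le> \<eta> / 2" by linarith
    then show ?thesis
    proof cases
      case 1
      have "?g / M * (1 - ?g / M) ^ (2 * N) \<le> 1 / real (2 * N)"
        using 1 M(1) M(2)[OF x] N0 by (intro mult_power_one_minus_le) (auto simp: divide_simps)
      then have "(l * M) * (?g / M * (1 - ?g / M) ^ (2 * N)) \<le> (l * M) * (1 / real (2 * N))"
        using l M by (intro mult_left_mono) auto
      moreover have "(l * M) * (1 / real (2 * N)) < \<eta>"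
      proof -
        have "l * M < \<eta> * N" using N \<eta> by (simp add: field_simps)
        also have "\<dots> \<le> \<eta> * real (2 * N)" using \<eta> by simp
        finally show ?thesis using N0 by (simp add: field_simps)
      qed
      ultimately show ?thesis unfolding eq using \<eta>(2)[OF x 1] M(1) by simp
    next
      case 2
      have "l * ?g * (1 - ?g / M) ^ (2 * N) \<le> 0"
        using 2 l by (intro mult_nonpos_nonneg mult_nonneg_nonpos zero_le_even_power') auto
      then show ?thesis unfolding eq using 2 \<eta> by linarith
    next
      case 3
      have "1 \<le> (1 - ?g / M) ^ (2 * N)"
        using 3 M by (intro one_le_power) (auto simp: divide_nonpos_pos)
      moreover have "l * \<delta> \<le> l * - ?g"
        using \<delta>(2)[OF x 3(2)] l by (intro mult_left_mono) auto
      then have "B + 1 \<le> l * - ?g"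
        using \<delta>(1) by (simp add: l_def)
      ultimately have "(B + 1) * 1 \<le> (l * - ?g) * (1 - ?g / M) ^ (2 * N)"
        using B by (intro mult_mono) auto
      then show ?thesis unfolding eq using B(2)[OF x] by simp
    qed
  qed
  then show ?thesis using that by blast
qed

text \<open>Kept abstract because two cones are used: polynomials eventually nonnegative along the
  relaxations, and polynomials on which the flat extension is nonnegative.\<close>

locale quadratic_cone =
  fixes Q :: "('n::finite) mpoly set"
  assumes add: "\<And>p q. p \<in> Q \<Longrightarrow> q \<in> Q \<Longrightarrow> p + q \<in> Q"
    and square: "\<And>p. p\<^sup>2 \<in> Q"
    and sphere: "\<And>p. sphere_poly * p \<in> Q"
begin

lemma sos_mod_subset: "p \<in> sos_mod sphere_poly \<Longrightarrow> p \<in> Q"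
  by (induction p rule: sos_mod.induct) (auto intro: add square sphere)

text \<open>Induction on the constraints: on the part of \<open>X\<close> where the remaining ones
  hold, a square multiple of \<open>g\<close>, itself in \<open>Q\<close>, is subtracted so that
  positivity no longer depends on \<open>g\<close>.\<close>

lemma penalties:
  assumes "finite G" "compact X"
    and "\<And>x. x \<in> X \<Longrightarrow> (\<And>g. g \<in> G \<Longrightarrow> poly_eval g x \<ge> 0) \<Longrightarrow> poly_eval q x > 0"
    and "\<And>g p. g \<in> G \<Longrightarrow> g * p\<^sup>2 \<in> Q"
  shows "\<exists>q'. (\<forall>x\<in>X. poly_eval q' x > 0) \<and> q - q' \<in> Q"
  using assms
proof (induction G arbitrary: q X rule: finite_induct)
  case empty
  then show ?case using square[of 0] by (intro exI[of _ q]) auto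
next
  case (insert g G)
  let ?Y = "X \<inter> {x. \<forall>g\<in>G. poly_eval g x \<ge> 0}"
  have "{x. \<forall>g\<in>G. poly_eval g x \<ge> 0} = (\<Inter>g\<in>G. {x. 0 \<le> poly_eval g x})" by auto
  moreover have "closed \<dots>"
    by (intro closed_INT ballI closed_Collect_le continuous_intros)
  ultimately have "compact ?Y" using compact_Int_closed[OF insert.prems(1)] by metis
  then obtain p where p: "\<And>x. x \<in> ?Y \<Longrightarrow> poly_eval (q - g * p\<^sup>2) x > 0"
    by (rule penalty[of ?Y g q]) (use insert.prems(2) in auto)
  have "\<exists>q'. (\<forall>x\<in>X. poly_eval q' x > 0) \<and> (q - g * p\<^sup>2) - q' \<in> Q"
    by (rule insert.IH[OF insert.prems(1)]) (use p insert.prems(3) in auto)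
  then obtain q' where q': "\<forall>x\<in>X. poly_eval q' x > 0" "(q - g * p\<^sup>2) - q' \<in> Q" by blast
  have "(q - g * p\<^sup>2) - q' + g * p\<^sup>2 \<in> Q"
    using q'(2) insert.prems(3) by (intro add) auto
  then show ?case using q'(1) by auto
qed

theorem putinar:
  assumes G: "finite G" "\<And>g p. g \<in> G \<Longrightarrow> g * p\<^sup>2 \<in> Q"
    and pos: "\<And>x. (\<Sum>i\<in>UNIV. (x $ i)\<^sup>2) = 1 \<Longrightarrow> (\<And>g. g \<in> G \<Longrightarrow> poly_eval g x \<ge> 0) \<Longrightarrow> poly_eval q x > 0"
  shows "q \<in> Q"
proof -
  let ?X = "{x :: real ^ 'n. \<forall>i. \<bar>x $ i\<bar> \<le> 1}"
  have "?X = cbox (\<chi> i. - 1) (\<chi> i. 1)" by (auto simp: mem_box_cart abs_le_iff minus_le_iff)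
  then have X: "compact ?X" by (metis compact_cbox)
  \<comment> \<open>The sphere equation is treated as one more inequality: minus the square of
    \<open>sphere_poly\<close> is nonnegative exactly on the sphere, and its multiples lie in
    \<open>Q\<close> through the ideal.\<close>
  have "\<exists>q'. (\<forall>x\<in>?X. poly_eval q' x > 0) \<and> q - q' \<in> Q"
  proof (rule penalties[OF _ X, of "insert (- (sphere_poly * sphere_poly)) G"])
    fix x assume "\<And>g. g \<in> insert (- (sphere_poly * sphere_poly)) G \<Longrightarrow> 0 \<le> poly_eval g x"
    from this this[of "- (sphere_poly * sphere_poly)"] show "0 < poly_eval q x"
      by (intro pos) (auto simp: poly_eval_sphere mult_le_0_iff)
  next
    fix g p assume "g \<in> insert (- (sphere_poly * sphere_poly)) G"
    then show "g * p\<^sup>2 \<in> Q"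
      using G(2) sphere[of "- sphere_poly * p\<^sup>2"] by (auto simp: mult_ac)
  qed (use G in auto)
  then obtain q' where q': "\<And>x. x \<in> ?X \<Longrightarrow> poly_eval q' x > 0" "q - q' \<in> Q" by blast
  obtain \<eta> where \<eta>: "\<eta> > 0" "\<And>x. x \<in> ?X \<Longrightarrow> poly_eval q' x \<ge> \<eta>"
    using compact_pos_lower_bound[OF X continuous_poly_eval q'(1)] by blast
  interpret P: mpoly_semicone "sos_mod (sphere_poly :: 'n mpoly)" by (rule mpoly_semicone_sos_mod)
  have "q' \<in> sos_mod sphere_poly"
  proof (rule P.positive_on_cube[OF _ _ \<eta>(1)])
    show "(1 / 2) *\<^sub>R (1 + var i) \<in> sos_mod sphere_poly" "(1 / 2) *\<^sub>R (1 - var i) \<in> sos_mod sphere_poly"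
      for i :: 'n
      using half_one_plus_in_sos_mod[of 1 i] half_one_plus_in_sos_mod[of "- 1" i] by simp_all
  qed (use \<eta>(2) in auto)
  from add[OF q'(2) sos_mod_subset[OF this]] show ?thesis by simp
qed

end


section \<open>Flat extensions\<close>

lemma polys_iff: "p \<in> polys k \<longleftrightarrow> Poly_Mapping.keys p \<subseteq> exps k"
  by (simp add: polys_def tdeg_le_iff)

lemma mult_polys: "p \<in> polys k \<Longrightarrow> q \<in> polys l \<Longrightarrow> k + l \<le> r \<Longrightarrow> p * q \<in> polys r"
  unfolding polys_def using tdeg_mult[of p q] by auto

lemma monom_polys: "mdeg \<alpha> \<le> k \<Longrightarrow> mmonom \<alpha> \<in> polys k"
  by (simp add: polys_def)

lemma polys_mono: "p \<in> polys k \<Longrightarrow> k \<le> l \<Longrightarrow> p \<in> polys l"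
  by (auto simp: polys_def)

lemma exponent_split:
  fixes \<alpha> :: "'n::finite exponent"
  assumes "mdeg \<alpha> \<le> a + b"
  obtains \<beta> \<gamma> where "\<alpha> = \<beta> + \<gamma>" "mdeg \<beta> \<le> a" "mdeg \<gamma> \<le> b"
  using assms
proof (induction a arbitrary: \<alpha> thesis)
  case 0
  show ?case by (rule "0.prems"(1)[of 0 \<alpha>]) (use "0.prems"(2) in auto)
next
  case (Suc a)
  show ?case
  proof (cases \<alpha> rule: exponent_cases)
    case 1
    then show ?thesis using Suc.prems(1)[of 0 0] by simp
  next
    case (2 i \<alpha>')
    then have "mdeg \<alpha>' \<le> a + b" using Suc.prems(2) by (simp add: mdeg_add)
    then obtain \<beta> \<gamma> where "\<alpha>' = \<beta> + \<gamma>" "mdeg \<beta> \<le> a" "mdeg \<gamma> \<le> b" using Suc.IH by blast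
    then show ?thesis
      using 2 by (intro Suc.prems(1)[of "Poly_Mapping.single i 1 + \<beta>" \<gamma>]) (auto simp: mdeg_add add.assoc)
  qed
qed

text \<open>The multiset view lets commuting operators be folded over an exponent without ordering
  the variables.\<close>

definition exponent_mset :: "'n::finite exponent \<Rightarrow> 'n multiset"
  where "exponent_mset \<alpha> = (\<Sum>i\<in>UNIV. replicate_mset (Poly_Mapping.lookup \<alpha> i) i)"

lemma count_exponent_mset: "count (exponent_mset \<alpha>) i = Poly_Mapping.lookup \<alpha> i"
  by (simp add: exponent_mset_def count_sum)

lemma exponent_mset_simps [simp]:
  "exponent_mset 0 = {#}"
  "exponent_mset (Poly_Mapping.single i 1 + \<alpha>) = add_mset i (exponent_mset \<alpha>)"
  by (rule multiset_eqI; auto simp: count_exponent_mset lookup_add lookup_single when_def)+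

text \<open>Multiplication by a variable acts on the space \<open>H\<close> of classes modulo the kernel of the moment
  matrix, and these operators commute; evaluating polynomials at them extends the functional.\<close>

locale flat_functional =
  fixes l :: "'n::finite exponent \<Rightarrow> real" and s t :: nat
  assumes st: "s < t"
    and flat: "\<And>p. p \<in> polys t \<Longrightarrow> \<exists>p'\<in>polys s. \<forall>q\<in>polys t. lext l (p * q) = lext l (p' * q)"
begin

text \<open>The vector of pairings with all monomials of degree at most \<open>t\<close>. By
  \<open>T_eq_iff\<close> it is a faithful concrete model of the class of \<open>p\<close> modulo
  the kernel, so no quotient has to be formed.\<close>

definition T :: "'n mpoly \<Rightarrow> 'n mpoly"
  where "T p = (\<Sum>\<beta>\<in>exps t. Poly_Mapping.single \<beta> (lext l (p * mmonom \<beta>)))"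

lemma lookup_T: "mcoeff (T p) \<beta> = (if \<beta> \<in> exps t then lext l (p * mmonom \<beta>) else 0)"
proof -
  have "mcoeff (T p) \<beta> = (\<Sum>\<gamma>\<in>exps t. if \<gamma> = \<beta> then lext l (p * mmonom \<beta>) else 0)"
    unfolding T_def lookup_sum by (intro sum.cong) (auto simp: lookup_single when_def)
  then show ?thesis by simp
qed

lemma linear_T: "linear T"
  by (rule linearI; rule poly_mapping_eqI)
    (simp_all add: lookup_T lookup_add distrib_right lext_add mult_scaleR_mpoly lext_scaleR)

lemma linear_lext_mult: "linear (\<lambda>q. lext l (p * q))"
  by (rule linearI) (simp_all add: distrib_left lext_add mult_scaleR_mpoly lext_scaleR)

lemma T_eq_iff: "T p = T p' \<longleftrightarrow> (\<forall>q\<in>polys t. lext l (p * q) = lext l (p' * q))"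
proof
  assume eq: "T p = T p'"
  show "\<forall>q\<in>polys t. lext l (p * q) = lext l (p' * q)"
  proof
    fix q :: "'n mpoly" assume "q \<in> polys t"
    then have "lext l (p * mmonom \<alpha>) = lext l (p' * mmonom \<alpha>)" if "\<alpha> \<in> Poly_Mapping.keys q" for \<alpha>
      using that lookup_T[of p \<alpha>] lookup_T[of p' \<alpha>] eq by (auto simp: polys_iff)
    then show "lext l (p * q) = lext l (p' * q)"
      by (rule linear_eq_on_monom[OF linear_lext_mult linear_lext_mult])
  qed
next
  assume "\<forall>q\<in>polys t. lext l (p * q) = lext l (p' * q)"
  then show "T p = T p'"
    by (intro poly_mapping_eqI) (auto simp: lookup_T exps_def intro!: monom_polys)
qed

lemma T_eqD: "T p = T p' \<Longrightarrow> q \<in> polys t \<Longrightarrow> lext l (p * q) = lext l (p' * q)"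
  using T_eq_iff by blast

lemma T_reduce: "p \<in> polys t \<Longrightarrow> \<exists>p'\<in>polys s. T p' = T p"
  using flat[of p] T_eq_iff by metis

lemma var_polys: "p \<in> polys k \<Longrightarrow> k < r \<Longrightarrow> var i * p \<in> polys r"
  by (rule mult_polys[of _ 1]) (auto intro: monom_polys)

text \<open>A test polynomial of degree \<open>t\<close> leaves no room for another variable.
  Replacing it by a congruent one of degree at most \<open>s < t\<close> makes room, and the
  variable moves to the other factor.\<close>

lemma T_var_cong:
  assumes p: "p \<in> polys k" "k < t" and p': "p' \<in> polys k" and eq: "T p = T p'"
  shows "T (var i * p) = T (var i * p')"
  unfolding T_eq_iff
proof
  fix q :: "'n mpoly" assume "q \<in> polys t"
  then obtain q' where q': "q' \<in> polys s" "T q' = T q" using T_reduce by blast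
  have *: "lext l (var i * r * q) = lext l (r * (var i * q'))" if "r \<in> polys k" for r
  proof -
    have "lext l (q * (var i * r)) = lext l (q' * (var i * r))"
      using q'(2) by (intro T_eqD var_polys[OF that p(2)]) simp
    then show ?thesis by (simp add: mult_ac)
  qed
  show "lext l (var i * p * q) = lext l (var i * p' * q)"
    unfolding *[OF p(1)] *[OF p'] using q'(1) st by (intro T_eqD[OF eq] var_polys)
qed

definition H :: "'n mpoly set" where "H = T ` polys s"

text \<open>The choice of a representative is harmless by \<open>T_var_cong\<close>. The value 0 off
  \<open>H\<close> makes the operators commute on the whole type, as folding requires.\<close>

definition X :: "'n \<Rightarrow> 'n mpoly \<Rightarrow> 'n mpoly"
  where "X i h = (if h \<in> H then T (var i * (SOME p. p \<in> polys s \<and> T p = h)) else 0)"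

lemma X_T:
  assumes "p \<in> polys k" "k < t"
  shows "X i (T p) = T (var i * p)"
proof -
  define p' where "p' = (SOME p'. p' \<in> polys s \<and> T p' = T p)"
  have "\<exists>p'. p' \<in> polys s \<and> T p' = T p"
    using T_reduce polys_mono[OF assms(1)] assms(2) by (meson less_imp_le)
  then have p': "p' \<in> polys s" "T p' = T p" unfolding p'_def by (metis (mono_tags, lifting) someI_ex)+
  then have "T p \<in> H" unfolding H_def by (metis imageI)
  then have "X i (T p) = T (var i * p')" by (simp add: X_def p'_def)
  also have "\<dots> = T (var i * p)"
    by (rule T_var_cong[of _ "max k s"]) (use assms p' st in \<open>auto intro: polys_mono\<close>)
  finally show ?thesis .
qed

lemma H_cases:
  assumes "h \<in> H" obtains p where "p \<in> polys s" "h = T p"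
  using assms by (auto simp: H_def)

lemma T_in_H: "p \<in> polys t \<Longrightarrow> T p \<in> H"
  unfolding H_def using T_reduce by (metis imageI)

lemma X_in_H: "h \<in> H \<Longrightarrow> X i h \<in> H"
  by (erule H_cases) (simp only: X_T[OF _ st] T_in_H var_polys[OF _ st])

lemma X_commute: "X i (X j h) = X j (X i h)"
proof (cases "h \<in> H")
  case True
  then obtain p where p: "p \<in> polys s" "h = T p" by (rule H_cases)
  \<comment> \<open>Reducing the test polynomial to degree \<open>s\<close> turns the pairing with
    the composite into the value at x_i x_j p q', which is symmetric in i and j.\<close>
  have *: "\<exists>p1\<in>polys t. X i (X j h) = T p1 \<and>
      (\<forall>q\<in>polys t. \<forall>q'\<in>polys s. T q' = T q \<longrightarrow> lext l (p1 * q) = lext l (var i * var j * p * q'))" for i j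
  proof -
    obtain p0 where p0: "p0 \<in> polys s" "T p0 = T (var j * p)"
      using T_reduce[of "var j * p"] var_polys[OF p(1) st] by blast
    have "X i (X j h) = T (var i * p0)"
      using p p0 st by (metis X_T)
    moreover have "lext l (var i * p0 * q) = lext l (var i * var j * p * q')"
      if q: "q \<in> polys t" "q' \<in> polys s" "T q' = T q" for q q'
    proof -
      have "lext l (q * (var i * p0)) = lext l (q' * (var i * p0))"
        using q(3) by (intro T_eqD var_polys[OF p0(1) st]) auto
      moreover have "lext l (p0 * (var i * q')) = lext l (var j * p * (var i * q'))"
        by (intro T_eqD p0(2) var_polys[OF q(2) st])
      ultimately show ?thesis by (simp add: mult_ac)
    qed
    ultimately show ?thesis using var_polys[OF p0(1) st] by blast
  qed
  obtain p1 where p1: "X i (X j h) = T p1" "\<And>q q'. q \<in> polys t \<Longrightarrow> q' \<in> polys s \<Longrightarrow> T q' = T q \<Longrightarrow>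
      lext l (p1 * q) = lext l (var i * var j * p * q')" using *[of i j] by blast
  obtain p2 where p2: "X j (X i h) = T p2" "\<And>q q'. q \<in> polys t \<Longrightarrow> q' \<in> polys s \<Longrightarrow> T q' = T q \<Longrightarrow>
      lext l (p2 * q) = lext l (var j * var i * p * q')" using *[of j i] by blast
  have "lext l (p1 * q) = lext l (p2 * q)" if "q \<in> polys t" for q
    using T_reduce[OF that] p1(2)[OF that] p2(2)[OF that] by (metis mult.commute)
  then show ?thesis unfolding p1(1) p2(1) T_eq_iff by blast
next
  case False
  have "T 0 = 0" using linear_0[OF linear_T] .
  then have "X k 0 = 0" for k
    using X_T[of 0 0 k] st by (simp add: polys_def)
  then show ?thesis using False by (simp add: X_def[of _ h])
qed

sublocale X: comp_fun_commute X
  by standard (auto simp: X_commute)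

text \<open>The monomial \<alpha> evaluated at the operators and applied to the class of
  \<open>1\<close>. Only values of \<open>l\<close> in degrees up to 2 t enter, so the result really
  extends the truncated functional.\<close>

definition \<Phi> :: "'n exponent \<Rightarrow> 'n mpoly"
  where "\<Phi> \<alpha> = fold_mset X (T 1) (exponent_mset \<alpha>)"

lemma \<Phi>_0: "\<Phi> 0 = T 1"
  and \<Phi>_add: "\<Phi> (Poly_Mapping.single i 1 + \<alpha>) = X i (\<Phi> \<alpha>)"
  by (simp_all add: \<Phi>_def X.fold_mset_add_mset del: One_nat_def)

lemma \<Phi>_in_H: "\<Phi> \<alpha> \<in> H"
proof (induction \<alpha> rule: exponent_induct)
  case zero
  show ?case unfolding \<Phi>_0 by (rule T_in_H) (simp add: polys_def)
next
  case (add i \<alpha>)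
  then show ?case unfolding \<Phi>_add by (rule X_in_H)
qed

lemma lext_\<Phi>_var:
  assumes p: "lext \<Phi> p = T p'" "p' \<in> polys k" "k < t"
  shows "lext \<Phi> (var i * p) = T (var i * p')"
proof -
  have "\<exists>r. r \<in> polys s \<and> \<Phi> \<alpha> = T r" for \<alpha>
    using \<Phi>_in_H[of \<alpha>] H_cases by metis
  then obtain r where r: "\<And>\<alpha>. r \<alpha> \<in> polys s" "\<And>\<alpha>. \<Phi> \<alpha> = T (r \<alpha>)" by metis
  let ?r = "lext r p"
  have r_s: "?r \<in> polys s"
    unfolding lext_def by (intro subspace_sum subspace_scale subspace_polys r)
  have "T ?r = lext \<Phi> p"
    unfolding lext_def r(2) linear_sum[OF linear_T] linear_scale[OF linear_T] ..
  moreover have "lext \<Phi> (var i * p) = lext (\<lambda>\<alpha>. X i (\<Phi> \<alpha>)) p"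
    using lext_mult_monom[of \<Phi> p "Poly_Mapping.single i 1"]
    by (simp add: mult.commute add.commute[of _ "Poly_Mapping.single i _"] \<Phi>_add[unfolded One_nat_def])
  moreover have "\<dots> = T (var i * ?r)"
    unfolding r(2) X_T[OF r(1) st] lext_def linear_sum[OF linear_T] linear_scale[OF linear_T]
      sum_distrib_left mult_scaleR_mpoly ..
  moreover have "T (var i * ?r) = X i (T ?r)" by (rule X_T[OF r_s st, symmetric])
  moreover have "T (var i * p') = X i (T p')" by (rule X_T[OF p(2,3), symmetric])
  ultimately show ?thesis using p(1) by simp
qed

lemma lext_\<Phi>_monom:
  assumes p: "lext \<Phi> p = T p'" "p' \<in> polys k" and "mdeg \<beta> + k \<le> t"
  shows "lext \<Phi> (mmonom \<beta> * p) = T (mmonom \<beta> * p')"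
  using assms(3)
proof (induction \<beta> rule: exponent_induct)
  case zero
  then show ?case using p by simp
next
  case (add i \<beta>)
  then have "lext \<Phi> (var i * (mmonom \<beta> * p)) = T (var i * (mmonom \<beta> * p'))"
    by (intro lext_\<Phi>_var[of _ _ "mdeg \<beta> + k"]) (auto simp: mdeg_add intro: mult_polys monom_polys p(2))
  then show ?case by (simp add: mult.assoc[symmetric] mult_single)
qed

text \<open>Coordinate 0 of a vector \<open>T p\<close> is the pairing of \<open>p\<close> with
  \<open>1\<close>.\<close>

definition extension :: "'n mpoly \<Rightarrow> real"
  where "extension p = mcoeff (lext \<Phi> p) 0"

lemma linear_extension: "linear extension"
  by (rule linearI) (simp_all add: extension_def lext_add lext_scaleR lookup_add)

lemma lext_\<Phi>_in_H: "\<exists>q'\<in>polys s. lext \<Phi> q = T q'"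
proof -
  have "lext \<Phi> q \<in> H"
    unfolding lext_def H_def
    by (intro subspace_sum subspace_scale linear_subspace_image linear_T subspace_polys)
      (use \<Phi>_in_H in \<open>auto simp: H_def\<close>)
  then show ?thesis by (auto simp: H_def)
qed

text \<open>Induction on \<open>q\<close>: the operators are symmetric for the pairing, so a
  variable of \<open>q\<close> can be moved over to \<open>p\<close>, with representatives reduced
  to degree at most \<open>s\<close> each time. This is why \<open>?S\<close> quantifies over all
  \<open>p\<close> and all representatives.\<close>

lemma extension_mult:
  assumes "lext \<Phi> p = T p'" "lext \<Phi> q = T q'" "p' \<in> polys s" "q' \<in> polys s"
  shows "extension (p * q) = lext l (p' * q')"
proof -
  let ?S = "{q. \<forall>p p' q'. lext \<Phi> p = T p' \<longrightarrow> lext \<Phi> q = T q' \<longrightarrow> p' \<in> polys s \<longrightarrow> q' \<in> polys s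
    \<longrightarrow> extension (p * q) = lext l (p' * q')}"
  have s_t: "r \<in> polys t" if "r \<in> polys s" for r using that st by (auto intro: polys_mono)
  note rep = lext_\<Phi>_in_H
  have cong: "lext l (p' * q') = lext l (p' * q'')" if "T q' = T q''" "p' \<in> polys s" for p' q' q''
    using T_eqD[OF that(1) s_t[OF that(2)]] by (simp add: mult.commute)
  have "q \<in> ?S"
  proof (rule mpoly_var_induct)
    show "subspace ?S"
    proof (rule subspaceI; safe)
      fix p p' q' assume *: "lext \<Phi> p = T p'" "lext \<Phi> 0 = T q'" "p' \<in> polys s" "q' \<in> polys s"
      then have "T q' = T 0" by (simp add: lext_zero linear_0[OF linear_T])
      from cong[OF this *(3)] show "extension (p * 0) = lext l (p' * q')"
        by (simp add: lext_zero linear_0[OF linear_extension])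
    next
      fix x y p p' q'
      assume x: "\<forall>p p' q'. lext \<Phi> p = T p' \<longrightarrow> lext \<Phi> x = T q' \<longrightarrow> p' \<in> polys s \<longrightarrow> q' \<in> polys s
          \<longrightarrow> extension (p * x) = lext l (p' * q')"
        and y: "\<forall>p p' q'. lext \<Phi> p = T p' \<longrightarrow> lext \<Phi> y = T q' \<longrightarrow> p' \<in> polys s \<longrightarrow> q' \<in> polys s
          \<longrightarrow> extension (p * y) = lext l (p' * q')"
        and *: "lext \<Phi> p = T p'" "lext \<Phi> (x + y) = T q'" "p' \<in> polys s" "q' \<in> polys s"
      obtain x' y' where xy: "x' \<in> polys s" "lext \<Phi> x = T x'" "y' \<in> polys s" "lext \<Phi> y = T y'"
        using rep by metis
      have "T q' = T (x' + y')" using *(2) xy by (simp add: lext_add linear_add[OF linear_T])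
      from cong[OF this *(3)] have "lext l (p' * q') = lext l (p' * x') + lext l (p' * y')"
        by (simp add: distrib_left lext_add)
      moreover have "extension (p * x) = lext l (p' * x')" "extension (p * y) = lext l (p' * y')"
        using x y * xy by blast+
      ultimately show "extension (p * (x + y)) = lext l (p' * q')"
        by (simp add: distrib_left linear_add[OF linear_extension])
    next
      fix r x p p' q'
      assume x: "\<forall>p p' q'. lext \<Phi> p = T p' \<longrightarrow> lext \<Phi> x = T q' \<longrightarrow> p' \<in> polys s \<longrightarrow> q' \<in> polys s
          \<longrightarrow> extension (p * x) = lext l (p' * q')"
        and *: "lext \<Phi> p = T p'" "lext \<Phi> (r *\<^sub>R x) = T q'" "p' \<in> polys s" "q' \<in> polys s"
      obtain x' where x': "x' \<in> polys s" "lext \<Phi> x = T x'" using rep by metis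
      have "T q' = T (r *\<^sub>R x')" using *(2) x' by (simp add: lext_scaleR linear_scale[OF linear_T])
      from cong[OF this *(3)] have "lext l (p' * q') = r * lext l (p' * x')"
        by (simp add: mult_scaleR_mpoly lext_scaleR)
      moreover have "extension (p * x) = lext l (p' * x')" using x * x' by blast
      ultimately show "extension (p * r *\<^sub>R x) = lext l (p' * q')"
        by (simp add: mult_scaleR_mpoly linear_scale[OF linear_extension])
    qed
    show "1 \<in> ?S"
    proof safe
      fix p p' q' assume *: "lext \<Phi> p = T p'" "lext \<Phi> 1 = T q'" "p' \<in> polys s" "q' \<in> polys s"
      then have "T q' = T 1" by (simp add: \<Phi>_0)
      from cong[OF this *(3)] show "extension (p * 1) = lext l (p' * q')"
        using *(1) by (simp add: extension_def lookup_T exps_def)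
    qed
    show "var i * q \<in> ?S" if q: "q \<in> ?S" for i q
    proof safe
      fix p p' q' assume *: "lext \<Phi> p = T p'" "lext \<Phi> (var i * q) = T q'" "p' \<in> polys s" "q' \<in> polys s"
      obtain q0 where q0: "q0 \<in> polys s" "lext \<Phi> q = T q0" using rep by metis
      obtain p1 where p1: "p1 \<in> polys s" "T p1 = T (var i * p')"
        using T_reduce var_polys[OF *(3) st] by metis
      have "lext \<Phi> (var i * p) = T p1"
        unfolding p1(2) by (rule lext_\<Phi>_var[OF *(1,3) st])
      then have "extension (var i * p * q) = lext l (p1 * q0)"
        using q p1(1) q0 by blast
      also have "\<dots> = lext l (var i * p' * q0)"
        by (rule T_eqD[OF p1(2) s_t[OF q0(1)]])
      also have "\<dots> = lext l (p' * (var i * q0))" by (simp add: mult_ac)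
      also have "\<dots> = lext l (p' * q')"
        using *(2) lext_\<Phi>_var[OF q0(2,1) st] by (intro cong *(3)) simp
      finally show "extension (p * (var i * q)) = lext l (p' * q')" by (simp add: mult_ac)
    qed
  qed
  then show ?thesis using assms by blast
qed

text \<open>A weight \<open>g\<close> of degree at most \<open>2 (t - k)\<close> is distributed over both factors.\<close>

lemma extension_weighted_square:
  assumes p: "lext \<Phi> p = T p'" "p' \<in> polys k" and g: "g \<in> polys (2 * D)" "k + D \<le> t"
  shows "extension (g * p\<^sup>2) = lext l (g * p'\<^sup>2)"
proof (rule linear_eq_on_monom[of "\<lambda>g. extension (g * p\<^sup>2)" "\<lambda>g. lext l (g * p'\<^sup>2)"])
  show "linear (\<lambda>g. extension (g * p\<^sup>2))" "linear (\<lambda>g. lext l (g * p'\<^sup>2))"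
    using linear_compose[OF linear_mult_left linear_extension, of "p\<^sup>2"]
      linear_compose[OF linear_mult_left linear_lext, of l "p'\<^sup>2"]
    by (simp_all add: o_def mult.commute)
next
  fix \<alpha> assume "\<alpha> \<in> Poly_Mapping.keys g"
  then have "mdeg \<alpha> \<le> D + D" using g(1) by (auto simp: polys_iff exps_def)
  then obtain \<beta> \<gamma> where *: "\<alpha> = \<beta> + \<gamma>" "mdeg \<beta> \<le> D" "mdeg \<gamma> \<le> D" by (rule exponent_split)
  have pt: "mmonom \<delta> * p' \<in> polys t" if "mdeg \<delta> \<le> D" for \<delta>
    using that g(2) by (intro mult_polys[OF monom_polys p(2)]) auto
  have rep: "\<exists>r\<in>polys s. T r = T (mmonom \<delta> * p') \<and> lext \<Phi> (mmonom \<delta> * p) = T r" if "mdeg \<delta> \<le> D" for \<delta>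
    using T_reduce[OF pt[OF that]] lext_\<Phi>_monom[OF p, of \<delta>] that g(2) by fastforce
  obtain r1 where r1: "r1 \<in> polys s" "T r1 = T (mmonom \<beta> * p')" "lext \<Phi> (mmonom \<beta> * p) = T r1"
    using rep[OF *(2)] by blast
  obtain r2 where r2: "r2 \<in> polys s" "T r2 = T (mmonom \<gamma> * p')" "lext \<Phi> (mmonom \<gamma> * p) = T r2"
    using rep[OF *(3)] by blast
  have split: "mmonom \<alpha> * q\<^sup>2 = (mmonom \<beta> * q) * (mmonom \<gamma> * q)" for q :: "'n mpoly"
  proof -
    have "mmonom \<alpha> = mmonom \<beta> * (mmonom \<gamma> :: 'n mpoly)" by (simp add: *(1) mult_single)
    then show ?thesis by (simp add: power2_eq_square mult_ac)
  qed
  have "extension (mmonom \<alpha> * p\<^sup>2) = lext l (r1 * r2)"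
    unfolding split by (rule extension_mult[OF r1(3) r2(3) r1(1) r2(1)])
  also have "\<dots> = lext l (mmonom \<beta> * p' * r2)"
    using r2(1) st by (intro T_eqD[OF r1(2)]) (auto intro: polys_mono)
  also have "\<dots> = lext l (mmonom \<beta> * p' * (mmonom \<gamma> * p'))"
    using T_eqD[OF r2(2) pt[OF *(2)]] by (simp add: mult.commute)
  finally show "extension (mmonom \<alpha> * p\<^sup>2) = lext l (mmonom \<alpha> * p'\<^sup>2)"
    unfolding split .
qed

text \<open>For the square of \<open>1\<close>, represented by itself in degree 0, the whole degree
  2 t is available to the weight.\<close>

lemma extension_eq:
  assumes "g \<in> polys (2 * t)"
  shows "extension g = lext l g"
  using extension_weighted_square[of 1 1 0 g t] assms by (simp add: \<Phi>_0 polys_def)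

end


section \<open>Moment cones and homogenization\<close>

lemma conic_atoms_sum:
  assumes "finite U" "\<And>u. u \<in> U \<Longrightarrow> 0 \<le> \<kappa> u \<and> g u \<in> X"
  shows "(\<lambda>\<alpha>. \<Sum>u\<in>U. \<kappa> u * \<phi> (g u) \<alpha>) \<in> conic_atoms X \<phi>"
  using assms
proof (induction U rule: finite_induct)
  case empty
  show ?case using function_cone.zero[OF function_cone_conic_atoms] by simp
next
  case (insert u U)
  have "(\<lambda>\<alpha>. \<kappa> u * \<phi> (g u) \<alpha>) \<in> conic_atoms X \<phi>"
    using insert.prems[of u]
    by (intro function_cone.scale_nonneg[OF function_cone_conic_atoms] conic_atoms_single) auto
  from function_cone.add[OF function_cone_conic_atoms this insert.IH] show ?case
    using insert by simp
qed

definition mvec_of :: "'n exponent set \<Rightarrow> ('n exponent \<Rightarrow> real) \<Rightarrow> 'n mvec"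
  where "mvec_of A c = (\<Sum>\<alpha>\<in>A. Poly_Mapping.single \<alpha> (c \<alpha>))"

lemma lookup_mvec_of:
  assumes "finite A"
  shows "Poly_Mapping.lookup (mvec_of A c) \<alpha> = (if \<alpha> \<in> A then c \<alpha> else 0)"
proof -
  have "Poly_Mapping.lookup (mvec_of A c) \<alpha> = (\<Sum>\<gamma>\<in>A. if \<gamma> = \<alpha> then c \<alpha> else 0)"
    unfolding mvec_of_def lookup_sum by (intro sum.cong) (auto simp: lookup_single when_def)
  then show ?thesis using assms by simp
qed

lemma keys_mvec_of: "finite A \<Longrightarrow> Poly_Mapping.keys (mvec_of A c) \<subseteq> A"
  by (auto simp: in_keys_iff lookup_mvec_of split: if_splits)

lemma mvec_of_in_mvecs [simp]: "finite A \<Longrightarrow> mvec_of A c \<in> mvecs A"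
  using keys_mvec_of[of A c] by (simp add: mvecs_def)

lemma lext_mvec_of_left: "lext \<phi> (mvec_of A c) = (\<Sum>\<alpha>\<in>A. c \<alpha> *\<^sub>R \<phi> \<alpha>)"
  by (simp add: mvec_of_def lext_sum)

lemma pairing_mvec_of:
  assumes "finite A" "Poly_Mapping.keys q \<subseteq> A"
  shows "pairing q (mvec_of A c) = lext c q"
  unfolding pairing_eq_lext lext_def
  using assms by (intro sum.cong) (auto simp: lookup_mvec_of)

lemma lext_cong:
  assumes "\<And>\<alpha>. \<alpha> \<in> Poly_Mapping.keys q \<Longrightarrow> c \<alpha> = c' \<alpha>"
  shows "lext c q = lext c' q"
  unfolding lext_def using assms by (intro sum.cong) auto

lemma tendsto_lext:
  fixes f :: "nat \<Rightarrow> 'n exponent \<Rightarrow> real"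
  assumes "\<And>\<alpha>. \<alpha> \<in> Poly_Mapping.keys q \<Longrightarrow> (\<lambda>n. f n \<alpha>) \<longlonglongrightarrow> c \<alpha>"
  shows "(\<lambda>n. lext (f n) q) \<longlonglongrightarrow> lext c q"
  unfolding lext_def using assms by (intro tendsto_intros)

lemma lookup_diff_le_dist:
  fixes x y :: "'n mvec"
  shows "\<bar>Poly_Mapping.lookup x \<alpha> - Poly_Mapping.lookup y \<alpha>\<bar> \<le> dist x y"
proof (cases "\<alpha> \<in> Poly_Mapping.keys x \<union> Poly_Mapping.keys y")
  case True
  then show ?thesis
    unfolding dist_poly_mapping_def dist_real_def
    by (intro member_le_sum[where f = "\<lambda>\<alpha>. \<bar>Poly_Mapping.lookup x \<alpha> - Poly_Mapping.lookup y \<alpha>\<bar>"]) auto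
qed (simp add: in_keys_iff)

lemma dist_mvecs:
  assumes "finite A" "x \<in> mvecs A" "y \<in> mvecs A"
  shows "dist x y = (\<Sum>\<alpha>\<in>A. \<bar>Poly_Mapping.lookup x \<alpha> - Poly_Mapping.lookup y \<alpha>\<bar>)"
  unfolding dist_poly_mapping_def dist_real_def
  using assms by (intro sum.mono_neutral_left) (auto simp: mvecs_def in_keys_iff)

section \<open>Moments of finitely atomic measures\<close>

abbreviation moments :: "(real ^ 'n::finite) set \<Rightarrow> ('n exponent \<Rightarrow> real) set"
  where "moments X \<equiv> conic_atoms X (\<lambda>x \<alpha>. mono_eval \<alpha> x)"

lemma momentsD:
  assumes "c \<in> moments X"
  shows "\<exists>U \<kappa>. finite U \<and> U \<subseteq> X \<and> (\<forall>u\<in>U. 0 \<le> \<kappa> u) \<and>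
    c = (\<lambda>\<alpha>. \<Sum>u\<in>U. \<kappa> u * mono_eval \<alpha> u) \<and> (\<forall>q. lext c q = (\<Sum>u\<in>U. \<kappa> u * poly_eval q u))"
proof -
  obtain U \<kappa> where *: "finite U" "U \<subseteq> X" "\<forall>u\<in>U. 0 \<le> \<kappa> u"
    "c = (\<lambda>\<alpha>. \<Sum>u\<in>U. \<kappa> u * mono_eval \<alpha> u)"
    using assms unfolding conic_atoms_def by blast
  have "lext c q = (\<Sum>u\<in>U. \<kappa> u * poly_eval q u)" for q
    unfolding lext_def *(4) poly_eval_def sum_distrib_left real_scaleR_def
    by (subst sum.swap) (simp add: mult_ac)
  with * show ?thesis by blast
qed

text \<open>Richter's theorem in one direction, a weighted point measure in the other; afterwards
  moment vectors are handled as finite sums.\<close>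

lemma moment_cone_iff:
  assumes "finite A"
  shows "y \<in> moment_cone A K \<longleftrightarrow> y \<in> mvecs A \<and> (\<exists>c\<in>moments K. \<forall>\<alpha>\<in>A. Poly_Mapping.lookup y \<alpha> = c \<alpha>)"
proof (intro iffI conjI)
  assume y: "y \<in> moment_cone A K"
  then obtain \<mu> where \<mu>: "sets \<mu> = sets borel" "supp \<mu> \<subseteq> K"
    "\<And>\<alpha>. \<alpha> \<in> A \<Longrightarrow> integrable \<mu> (mono_eval \<alpha>)"
    "\<And>\<alpha>. \<alpha> \<in> A \<Longrightarrow> Poly_Mapping.lookup y \<alpha> = (\<integral>x. mono_eval \<alpha> x \<partial>\<mu>)"
    by (auto simp: moment_cone_def representing_measure_def)
  have "AE x in \<mu>. x \<in> K" using AE_in_supp[OF \<mu>(1)] \<mu>(2) by (auto elim: eventually_mono)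
  then obtain c where "c \<in> moments K" "\<forall>\<alpha>\<in>A. c \<alpha> = (\<integral>x. mono_eval \<alpha> x \<partial>\<mu>)"
    using richter[OF assms, of \<mu> "\<lambda>x \<alpha>. mono_eval \<alpha> x" K] \<mu>(3) by blast
  then show "\<exists>c\<in>moments K. \<forall>\<alpha>\<in>A. Poly_Mapping.lookup y \<alpha> = c \<alpha>"
    using \<mu>(4) by (intro bexI[of _ c]) auto
  show "y \<in> mvecs A" using y by (simp add: moment_cone_def)
next
  assume y: "y \<in> mvecs A \<and> (\<exists>c\<in>moments K. \<forall>\<alpha>\<in>A. Poly_Mapping.lookup y \<alpha> = c \<alpha>)"
  then obtain c where c: "c \<in> moments K" and yc: "\<And>\<alpha>. \<alpha> \<in> A \<Longrightarrow> Poly_Mapping.lookup y \<alpha> = c \<alpha>" by blast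
  obtain U \<kappa> where U: "finite U" "U \<subseteq> K" "\<And>u. u \<in> U \<Longrightarrow> 0 \<le> \<kappa> u"
    "c = (\<lambda>\<alpha>. \<Sum>u\<in>U. \<kappa> u * mono_eval \<alpha> u)"
    using momentsD[OF c] by blast
  define M where "M = point_measure U (\<lambda>u. ennreal (\<kappa> u))"
  \<comment> \<open>A point measure lives on the discrete sigma-algebra of \<open>U\<close>; the
    push-forward turns it into a Borel measure.\<close>
  define \<mu> where "\<mu> = distr M borel (\<lambda>u. u)"
  have id: "(\<lambda>u. u) \<in> measurable M borel" by (simp add: M_def)
  have meas: "mono_eval \<alpha> \<in> borel_measurable borel" for \<alpha> :: "'a exponent"
    by (intro borel_measurable_continuous_onI continuous_mono_eval)
  have "integrable M (\<lambda>x. mono_eval \<alpha> x)" for \<alpha>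
    unfolding M_def using U(1) by (rule integrable_point_measure_finite)
  moreover have "(\<integral>x. mono_eval \<alpha> x \<partial>M) = c \<alpha>" for \<alpha>
    unfolding M_def U(4) by (subst lebesgue_integral_point_measure_finite) (use U in auto)
  moreover have "supp \<mu> \<subseteq> K"
  proof
    fix x assume x: "x \<in> supp \<mu>"
    have "emeasure \<mu> (- U) = emeasure M ((\<lambda>u. u) -` (- U) \<inter> space M)"
      unfolding \<mu>_def
      by (intro emeasure_distr id borel_open open_Compl finite_imp_closed U(1))
    also have "(\<lambda>u. u) -` (- U) \<inter> space M = {}" by (auto simp: M_def space_point_measure)
    finally have "emeasure \<mu> (- U) = 0" by simp
    then have "x \<in> U" using x finite_imp_closed[OF U(1)] by (auto simp: supp_def open_Compl)
    then show "x \<in> K" using U(2) by blast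
  qed
  ultimately have "representing_measure A K y \<mu>"
    unfolding representing_measure_def \<mu>_def
    by (auto simp: integrable_distr_eq[OF id meas] integral_distr[OF id meas] yc)
  then show "y \<in> moment_cone A K" using y by (auto simp: moment_cone_def)
qed

text \<open>Bipolarity: a vector at positive distance from the cone is separated with a margin, and
  the separating functional, read as a polynomial supported in \<open>A\<close>, is nonnegative on
  \<open>K\<close> but negative on \<open>y\<close>.\<close>

lemma closure_moment_coneI:
  assumes A: "finite A" and y: "y \<in> mvecs A"
    and pos: "\<And>q. Poly_Mapping.keys q \<subseteq> A \<Longrightarrow> (\<And>x. x \<in> K \<Longrightarrow> 0 \<le> poly_eval q x) \<Longrightarrow> 0 \<le> pairing q y"
  shows "y \<in> closure (moment_cone A K)"
proof (rule ccontr)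
  assume "y \<notin> closure (moment_cone A K)"
  then obtain e where e: "e > 0" "\<And>x. x \<in> moment_cone A K \<Longrightarrow> e \<le> dist x y"
    unfolding closure_approachable by (auto simp: not_less)
  interpret function_cone "moments K" by (rule function_cone_conic_atoms)
  \<comment> \<open>Separation works in the maximum norm, while the distance is the l1-distance:
    \<open>card A\<close> errors of size \<epsilon> must add up to less than \<open>e\<close>, and
    the summand 1 covers empty \<open>A\<close>.\<close>
  define \<epsilon> where "\<epsilon> = e / (real (card A) + 1)"
  have \<epsilon>: "\<epsilon> > 0" using e by (simp add: \<epsilon>_def)
  have far: "\<exists>\<alpha>\<in>A. \<epsilon> < \<bar>c \<alpha> - Poly_Mapping.lookup y \<alpha>\<bar>" if c: "c \<in> moments K" for c
  proof (rule ccontr)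
    assume "\<not> ?thesis"
    then have "(\<Sum>\<alpha>\<in>A. \<bar>c \<alpha> - Poly_Mapping.lookup y \<alpha>\<bar>) \<le> (\<Sum>\<alpha>\<in>A. \<epsilon>)"
      by (intro sum_mono) (auto simp: not_less)
    moreover have "real (card A) * \<epsilon> < e"
      using e by (simp add: \<epsilon>_def field_simps)
    moreover have "mvec_of A c \<in> moment_cone A K"
      unfolding moment_cone_iff[OF A] using A c by (auto simp: lookup_mvec_of)
    then have "e \<le> dist (mvec_of A c) y" by (rule e(2))
    moreover have "dist (mvec_of A c) y = (\<Sum>\<alpha>\<in>A. \<bar>c \<alpha> - Poly_Mapping.lookup y \<alpha>\<bar>)"
      using A y by (simp add: dist_mvecs lookup_mvec_of)
    ultimately show False by simp
  qed
  obtain l where l: "\<exists>\<alpha>\<in>A. l \<alpha> \<noteq> 0"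
    "\<And>c. c \<in> moments K \<Longrightarrow> 0 \<le> (\<Sum>\<alpha>\<in>A. l \<alpha> * c \<alpha>)"
    "(\<Sum>\<alpha>\<in>A. l \<alpha> * Poly_Mapping.lookup y \<alpha>) \<le> - \<epsilon> * (\<Sum>\<alpha>\<in>A. \<bar>l \<alpha>\<bar>)"
    using separation[OF A less_imp_le[OF \<epsilon>] far] by auto
  have "0 \<le> pairing (mvec_of A l) y"
  proof (rule pos)
    show "Poly_Mapping.keys (mvec_of A l) \<subseteq> A" by (rule keys_mvec_of[OF A])
    show "0 \<le> poly_eval (mvec_of A l) x" if "x \<in> K" for x
      using l(2)[OF conic_atoms_single[OF that]] by (simp add: poly_eval_eq_lext lext_mvec_of_left)
  qed
  then have "0 \<le> (\<Sum>\<alpha>\<in>A. l \<alpha> * Poly_Mapping.lookup y \<alpha>)"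
    by (simp add: pairing_eq_lext lext_mvec_of_left)
  moreover have "0 < (\<Sum>\<alpha>\<in>A. \<bar>l \<alpha>\<bar>)" using l(1) A by (auto intro!: sum_pos2)
  then have "0 < \<epsilon> * (\<Sum>\<alpha>\<in>A. \<bar>l \<alpha>\<bar>)" using \<epsilon> by simp
  ultimately show False using l(3) by simp
qed

lemma closure_moment_cone_sequence:
  assumes A: "finite A" and y: "y \<in> closure (moment_cone A K)"
  obtains c where "\<And>n. c n \<in> moments K" "\<And>\<alpha>. \<alpha> \<in> A \<Longrightarrow> (\<lambda>n. c n \<alpha>) \<longlonglongrightarrow> Poly_Mapping.lookup y \<alpha>"
proof -
  obtain x where x: "\<And>n. x n \<in> moment_cone A K" "x \<longlonglongrightarrow> y"
    using y unfolding closure_sequential by blast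
  have "\<exists>c\<in>moments K. \<forall>\<alpha>\<in>A. Poly_Mapping.lookup (x n) \<alpha> = c \<alpha>" for n
    using x(1)[of n] moment_cone_iff[OF A] by blast
  then obtain c where c: "\<And>n. c n \<in> moments K"
    "\<And>n \<alpha>. \<alpha> \<in> A \<Longrightarrow> Poly_Mapping.lookup (x n) \<alpha> = c n \<alpha>" by metis
  have "(\<lambda>n. c n \<alpha>) \<longlonglongrightarrow> Poly_Mapping.lookup y \<alpha>" if "\<alpha> \<in> A" for \<alpha>
  proof (rule metric_tendsto_imp_tendsto[OF x(2)])
    show "\<forall>\<^sub>F n in sequentially. dist (c n \<alpha>) (Poly_Mapping.lookup y \<alpha>) \<le> dist (x n) y"
      using lookup_diff_le_dist[of "x _" \<alpha> y] c(2)[OF that] by (simp add: dist_real_def)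
  qed
  then show ?thesis using c(1) that by blast
qed

text \<open>Central projection of the affine chart x_0 = 1 to the open upper half sphere;
  \<open>affine_point\<close> undoes it.\<close>

definition lift_point :: "real ^ 'n \<Rightarrow> real ^ ('n::finite) option"
  where "lift_point u = (1 / sqrt (1 + (\<Sum>i\<in>UNIV. (u $ i)\<^sup>2))) *\<^sub>R
    (\<chi> j. case j of None \<Rightarrow> 1 | Some i \<Rightarrow> u $ i)"

definition affine_point :: "real ^ ('n::finite) option \<Rightarrow> real ^ 'n"
  where "affine_point z = (\<chi> i. z $ Some i / z $ None)"

lemma lift_point_None_pos: "lift_point u $ None > 0"
proof -
  have "0 < 1 + (\<Sum>i\<in>UNIV. (u $ i)\<^sup>2)" by (intro add_pos_nonneg sum_nonneg) auto
  then show ?thesis by (simp add: lift_point_def)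
qed

lemma affine_lift_point [simp]: "affine_point (lift_point u) = u"
  using lift_point_None_pos[of u] by (simp add: affine_point_def lift_point_def vec_eq_iff)

lemma lift_point_sphere: "(lift_point u $ None)\<^sup>2 + (\<Sum>i\<in>UNIV. (lift_point u $ Some i)\<^sup>2) = 1"
proof -
  define r where "r = 1 + (\<Sum>i\<in>UNIV. (u $ i)\<^sup>2)"
  have r: "0 < r" unfolding r_def by (intro add_pos_nonneg sum_nonneg) auto
  have "(lift_point u $ None)\<^sup>2 + (\<Sum>i\<in>UNIV. (lift_point u $ Some i)\<^sup>2)
      = (1 / sqrt r)\<^sup>2 * (1 + (\<Sum>i\<in>UNIV. (u $ i)\<^sup>2))"
    by (simp add: lift_point_def r_def power_mult_distrib power_divide sum_divide_distrib add_divide_distrib)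
  also have "\<dots> = 1" using r by (simp add: power_divide r_def)
  finally show ?thesis .
qed

lemma mono_eval_homog_affine:
  "z $ None \<noteq> 0 \<Longrightarrow> mdeg \<alpha> \<le> e \<Longrightarrow>
    mono_eval (homog_exp e \<alpha>) z = (z $ None) ^ e * mono_eval \<alpha> (affine_point z)"
  unfolding affine_point_def by (rule mono_eval_homog_exp)

lemma poly_eval_homogenize_affine:
  "z $ None \<noteq> 0 \<Longrightarrow> tdeg p \<le> e \<Longrightarrow>
    poly_eval (homogenize e p) z = (z $ None) ^ e * poly_eval p (affine_point z)"
  unfolding affine_point_def by (rule poly_eval_homogenize)

lemma lext_homogenize: "lext \<phi> (homogenize e p) = lext (\<lambda>\<alpha>. \<phi> (homog_exp e \<alpha>)) p"
  by (simp add: homogenize_def lext_sum lext_def[of _ p])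

lemma semialg_h_affine_iff:
  assumes "z $ None > 0"
  shows "z \<in> semialg_h E I c \<longleftrightarrow> affine_point z \<in> semialg E I c"
proof -
  have "poly_eval (homogenization p) z = (z $ None) ^ tdeg p * poly_eval p (affine_point z)" for p
    unfolding homogenization_def using assms by (intro poly_eval_homogenize_affine) auto
  moreover have "0 \<le> r * x \<longleftrightarrow> 0 \<le> x" if "r > 0" for r x :: real
    using that by (simp add: zero_le_mult_iff)
  ultimately show ?thesis using assms
    by (simp add: semialg_h_def semialg_def)
qed

abbreviation semialg_tilde_pos ::
    "'l set \<Rightarrow> 'l set \<Rightarrow> ('l \<Rightarrow> 'n::finite mpoly) \<Rightarrow> (real ^ 'n option) set"
  where "semialg_tilde_pos E I c \<equiv> semialg_tilde E I c \<inter> {z. z $ None > 0}"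

lemma lift_point_in: "u \<in> semialg E I c \<Longrightarrow> lift_point u \<in> semialg_tilde_pos E I c"
  using lift_point_None_pos[of u] lift_point_sphere[of u] semialg_h_affine_iff[of "lift_point u" E I c]
  by (simp add: semialg_tilde_def)

lemma affine_point_in: "z \<in> semialg_tilde_pos E I c \<Longrightarrow> affine_point z \<in> semialg E I c"
  using semialg_h_affine_iff[of z E I c] by (simp add: semialg_tilde_def)

text \<open>At a lifted point the monomials of degree \<open>d\<close> carry the factor x_0^d, which
  is compensated by dividing the mass by it; \<open>moments_affine\<close> multiplies it
  back.\<close>

lemma moments_lift:
  fixes c :: "'l \<Rightarrow> 'n::finite mpoly"
  assumes "f \<in> moments (semialg E I c)"
  obtains g where "g \<in> moments (semialg_tilde_pos E I c)"
    "\<And>\<alpha>. mdeg \<alpha> \<le> d \<Longrightarrow> g (homog_exp d \<alpha>) = f \<alpha>"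
proof -
  obtain U \<kappa> where U: "finite U" "U \<subseteq> semialg E I c" "\<And>u. u \<in> U \<Longrightarrow> 0 \<le> \<kappa> u"
    "f = (\<lambda>\<alpha>. \<Sum>u\<in>U. \<kappa> u * mono_eval \<alpha> u)"
    using momentsD[OF assms] by blast
  let ?g = "\<lambda>\<beta>. \<Sum>u\<in>U. (\<kappa> u / (lift_point u $ None) ^ d) * mono_eval \<beta> (lift_point u)"
  have "?g \<in> moments (semialg_tilde_pos E I c)"
    using U lift_point_None_pos lift_point_in[of _ E I c]
    by (intro conic_atoms_sum[where \<phi> = "\<lambda>x \<alpha>. mono_eval \<alpha> x"])
      (auto intro!: divide_nonneg_nonneg simp: less_imp_le)
  moreover have "?g (homog_exp d \<alpha>) = f \<alpha>" if "mdeg \<alpha> \<le> d" for \<alpha>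
  proof -
    have "lift_point u $ None \<noteq> 0" for u :: "real ^ 'n" using lift_point_None_pos[of u] by simp
    then show ?thesis unfolding U(4) using that by (simp add: mono_eval_homog_affine)
  qed
  ultimately show ?thesis using that by blast
qed

lemma moments_affine:
  assumes "g \<in> moments (semialg_tilde_pos E I c)"
  obtains f where "f \<in> moments (semialg E I c)"
    "\<And>\<alpha>. mdeg \<alpha> \<le> d \<Longrightarrow> g (homog_exp d \<alpha>) = f \<alpha>"
proof -
  obtain U \<kappa> where U: "finite U" "U \<subseteq> semialg_tilde_pos E I c" "\<And>u. u \<in> U \<Longrightarrow> 0 \<le> \<kappa> u"
    "g = (\<lambda>\<alpha>. \<Sum>u\<in>U. \<kappa> u * mono_eval \<alpha> u)"
    using momentsD[OF assms] by blast
  let ?f = "\<lambda>\<alpha>. \<Sum>u\<in>U. (\<kappa> u * (u $ None) ^ d) * mono_eval \<alpha> (affine_point u)"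
  have "?f \<in> moments (semialg E I c)"
    using U affine_point_in[of _ E I c]
    by (intro conic_atoms_sum[where \<phi> = "\<lambda>x \<alpha>. mono_eval \<alpha> x"])
      (blast intro!: mult_nonneg_nonneg zero_le_power intro: less_imp_le)+
  moreover have "g (homog_exp d \<alpha>) = ?f \<alpha>" if "mdeg \<alpha> \<le> d" for \<alpha>
    unfolding U(4) using that U(2)
    by (intro sum.cong refl, subst mono_eval_homog_affine) auto
  ultimately show ?thesis using that by blast
qed

lemma mdeg_homog_exp: "mdeg \<alpha> \<le> d \<Longrightarrow> mdeg (homog_exp d \<alpha>) = d"
  by (simp add: mdeg_def UNIV_option_conv sum.reindex lookup_homog_exp)

lemma sum_option_sphere: "(\<Sum>i\<in>UNIV. (z $ i)\<^sup>2) = (z $ None)\<^sup>2 + (\<Sum>i\<in>UNIV. (z $ Some i)\<^sup>2)"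
  for z :: "real ^ ('n::finite) option"
  by (simp add: UNIV_option_conv sum.reindex)

lemma compact_semialg_tilde: "compact (semialg_tilde E I c)"
proof -
  have "semialg_h E I c = (\<Inter>i\<in>E. {z. poly_eval (homogenization (c i)) z = 0})
      \<inter> (\<Inter>j\<in>I. {z. 0 \<le> poly_eval (homogenization (c j)) z}) \<inter> {z. 0 \<le> z $ None}"
    by (auto simp: semialg_h_def)
  moreover have "closed \<dots>"
    by (intro closed_Int closed_INT ballI closed_Collect_le closed_Collect_eq continuous_intros)
  ultimately have "closed (semialg_h E I c)" by metis
  moreover have "{z. (z $ None)\<^sup>2 + (\<Sum>i\<in>UNIV. (z $ Some i)\<^sup>2) = 1} = sphere (0 :: real ^ 'a option) 1"
    by (auto simp: sphere_def dist_norm norm_vec_def L2_set_def simp flip: sum_option_sphere)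
  ultimately show ?thesis
    unfolding semialg_tilde_def by (metis Int_commute compact_Int_closed compact_sphere)
qed

text \<open>On x_0 > 0 the homogenization is a positive multiple of \<open>q\<close> at a point of
  \<open>K\<close>. Closedness at infinity makes this region dense in \<open>semialg_h\<close>, so
  the sign passes to the points with x_0 = 0.\<close>

lemma homogenize_nonneg:
  assumes cl: "closed_at_infinity E I c" and q: "tdeg q \<le> d"
    and pos: "\<And>x. x \<in> semialg E I c \<Longrightarrow> 0 \<le> poly_eval q x" and z: "z \<in> semialg_h E I c"
  shows "0 \<le> poly_eval (homogenize d q) z"
proof -
  have "semialg_c E I c \<subseteq> {z. 0 \<le> poly_eval (homogenize d q) z}"
    using pos semialg_h_affine_iff[of _ E I c]
    by (auto simp: semialg_c_def poly_eval_homogenize_affine[OF _ q] intro!: mult_nonneg_nonneg)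
  then have "closure (semialg_c E I c) \<subseteq> {z. 0 \<le> poly_eval (homogenize d q) z}"
    by (rule closure_minimal) (intro closed_Collect_le continuous_intros)
  then show ?thesis using cl z by (auto simp: closed_at_infinity_def)
qed


section \<open>Truncated positivity\<close>

lemma loc_index_one [simp]: "loc_index 1 k = exps k"
  by (auto simp: loc_index_def exps_def)

lemma psd_loc_matrix_iff:
  "psd_on (loc_index q k) (loc_matrix q k w) \<longleftrightarrow>
    (\<forall>p. Poly_Mapping.keys p \<subseteq> loc_index q k \<longrightarrow> 0 \<le> pairing (q * p\<^sup>2) w)"
proof -
  let ?B = "loc_index q k"
  have quad: "pairing (q * p\<^sup>2) w
      = (\<Sum>\<beta>\<in>?B. \<Sum>\<gamma>\<in>?B. mcoeff p \<beta> * loc_matrix q k w \<beta> \<gamma> * mcoeff p \<gamma>)"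
    if "Poly_Mapping.keys p \<subseteq> ?B" for p
    using pairing_quadratic[OF finite_loc_index that] by (simp add: loc_matrix_eq)
  show ?thesis
  proof
    assume "psd_on ?B (loc_matrix q k w)"
    then show "\<forall>p. Poly_Mapping.keys p \<subseteq> ?B \<longrightarrow> 0 \<le> pairing (q * p\<^sup>2) w"
      by (simp add: quad psd_on_def)
  next
    assume *: "\<forall>p. Poly_Mapping.keys p \<subseteq> ?B \<longrightarrow> 0 \<le> pairing (q * p\<^sup>2) w"
    have "0 \<le> (\<Sum>\<beta>\<in>?B. \<Sum>\<gamma>\<in>?B. v \<beta> * loc_matrix q k w \<beta> \<gamma> * v \<gamma>)" for v
      using *[rule_format, OF keys_mvec_of[OF finite_loc_index], of v]
      by (simp add: quad[OF keys_mvec_of] lookup_mvec_of)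
    then show "psd_on ?B (loc_matrix q k w)"
      by (simp add: psd_on_def loc_matrix_eq add.commute)
  qed
qed

lemma loc_matrix_zero_iff:
  fixes q :: "'n::finite mpoly"
  shows "loc_matrix q k w = (\<lambda>_ _. 0) \<longleftrightarrow>
    (\<forall>p. Poly_Mapping.keys p \<subseteq> loc_index q k \<longrightarrow> pairing (q * p\<^sup>2) w = 0)"
proof
  assume eq: "loc_matrix q k w = (\<lambda>_ _. 0)"
  show "\<forall>p. Poly_Mapping.keys p \<subseteq> loc_index q k \<longrightarrow> pairing (q * p\<^sup>2) w = 0"
  proof (intro allI impI)
    fix p :: "'n mpoly" assume p: "Poly_Mapping.keys p \<subseteq> loc_index q k"
    have "pairing (q * mmonom (\<beta> + \<gamma>)) w = 0" if "\<beta> \<in> loc_index q k" "\<gamma> \<in> loc_index q k" for \<beta> \<gamma>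
      using fun_cong[OF fun_cong[OF eq], of \<beta> \<gamma>] that by (simp add: loc_matrix_eq)
    then show "pairing (q * p\<^sup>2) w = 0"
      unfolding pairing_quadratic[OF finite_loc_index p] by (intro sum.neutral ballI) simp
  qed
next
  assume "\<forall>p. Poly_Mapping.keys p \<subseteq> loc_index q k \<longrightarrow> pairing (q * p\<^sup>2) w = 0"
  \<comment> \<open>The zero matrix is a localizing matrix and hence the only one; polarization is
    hidden in that uniqueness.\<close>
  then have "is_loc_matrix q k w (\<lambda>_ _. 0)"
    unfolding is_loc_matrix_def using loc_index_keys[of q _ k] by simp
  from is_loc_matrix_unique[OF this] show "loc_matrix q k w = (\<lambda>_ _. 0)"
    unfolding loc_matrix_eq by (intro ext) simp
qed

text \<open>Equations become pairs of opposite inequalities, so that every matrix condition of the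
  relaxation is a sign condition on weighted squares.\<close>

definition constraint_polys :: "'l set \<Rightarrow> 'l set \<Rightarrow> ('l \<Rightarrow> 'n::finite mpoly) \<Rightarrow> 'n option mpoly set"
  where "constraint_polys E I c =
    (\<lambda>i. homogenization (c i)) ` (E \<union> I) \<union> (\<lambda>i. - homogenization (c i)) ` E \<union> {var None}"

lemma finite_constraint_polys: "finite E \<Longrightarrow> finite I \<Longrightarrow> finite (constraint_polys E I c)"
  by (simp add: constraint_polys_def)

lemma semialg_tilde_iff:
  "z \<in> semialg_tilde E I c \<longleftrightarrow>
    (\<Sum>i\<in>UNIV. (z $ i)\<^sup>2) = 1 \<and> (\<forall>g\<in>constraint_polys E I c. 0 \<le> poly_eval g z)"
proof -
  have "poly_eval (var None) z = z $ None" by simp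
  then show ?thesis
    unfolding semialg_tilde_def semialg_h_def constraint_polys_def sum_option_sphere
    by (auto simp: ball_Un intro: antisym simp del: poly_eval_simps(9) One_nat_def)
qed

abbreviation weights :: "'l set \<Rightarrow> 'l set \<Rightarrow> ('l \<Rightarrow> 'n::finite mpoly) \<Rightarrow> 'n option mpoly set"
  where "weights E I c \<equiv> {1, sphere_poly, - sphere_poly} \<union> constraint_polys E I c"

definition truncated_nonneg ::
    "'l set \<Rightarrow> 'l set \<Rightarrow> ('l \<Rightarrow> 'n::finite mpoly) \<Rightarrow> nat \<Rightarrow> ('n option exponent \<Rightarrow> real) \<Rightarrow> bool"
  where "truncated_nonneg E I c k f \<longleftrightarrow>
    (\<forall>g\<in>weights E I c. \<forall>p. Poly_Mapping.keys p \<subseteq> loc_index g k \<longrightarrow> 0 \<le> lext f (g * p\<^sup>2))"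

lemma loc_index_uminus [simp]: "loc_index (- q) k = loc_index q k"
  by (simp add: loc_index_def)

lemma relax_feasible_iff:
  "w \<in> relax_feasible E I c m1 m a b d k \<longleftrightarrow> w \<in> mvecs (exps (2 * k)) \<and>
    lin_constraints m1 m (\<lambda>i. homogenize d (a i)) b w \<and>
    truncated_nonneg E I c k (Poly_Mapping.lookup w)"
proof -
  have eq: "(\<forall>p. Poly_Mapping.keys p \<subseteq> loc_index q k \<longrightarrow> pairing (q * p\<^sup>2) w = 0) \<longleftrightarrow>
    (\<forall>p. Poly_Mapping.keys p \<subseteq> loc_index q k \<longrightarrow> 0 \<le> pairing (q * p\<^sup>2) w) \<and>
    (\<forall>p. Poly_Mapping.keys p \<subseteq> loc_index (- q) k \<longrightarrow> 0 \<le> pairing (- q * p\<^sup>2) w)" for q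
    by (auto simp: pairing_eq_lext lext_neg intro: antisym)
  have one: "psd_on (exps k) (moment_matrix k w) \<longleftrightarrow>
    (\<forall>p. Poly_Mapping.keys p \<subseteq> loc_index 1 k \<longrightarrow> 0 \<le> pairing (1 * p\<^sup>2) w)"
    using psd_loc_matrix_iff[of 1 k w] by (simp add: moment_matrix_def)
  show ?thesis
    unfolding relax_feasible_def mem_Collect_eq sphere_poly_def[symmetric] loc_matrix_zero_iff
      psd_loc_matrix_iff one eq truncated_nonneg_def pairing_eq_lext[symmetric] constraint_polys_def
    by (simp only: ball_Un ball_simps) blast
qed

lemma truncated_nonneg_moments:
  assumes "f \<in> moments (semialg_tilde E I c)"
  shows "truncated_nonneg E I c k f"
  unfolding truncated_nonneg_def
proof (intro ballI allI impI)
  fix g p assume g: "g \<in> weights E I c"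
  obtain U \<kappa> where U: "U \<subseteq> semialg_tilde E I c" "\<forall>u\<in>U. 0 \<le> \<kappa> u"
    "\<forall>q. lext f q = (\<Sum>u\<in>U. \<kappa> u * poly_eval q u)"
    using momentsD[OF assms] by blast
  have "0 \<le> poly_eval g u" if "u \<in> U" for u
    using g that U(1) semialg_tilde_iff[of u E I c] by (auto simp: poly_eval_sphere)
  then show "0 \<le> lext f (g * p\<^sup>2)"
    using U by (auto intro!: sum_nonneg mult_nonneg_nonneg)
qed

lemma truncated_nonneg_cong:
  assumes "\<And>\<beta>. \<beta> \<in> exps (2 * k) \<Longrightarrow> f \<beta> = f' \<beta>"
  shows "truncated_nonneg E I c k f \<longleftrightarrow> truncated_nonneg E I c k f'"
proof -
  have "lext f (g * p\<^sup>2) = lext f' (g * p\<^sup>2)" if "Poly_Mapping.keys p \<subseteq> loc_index g k" for g p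
  proof (cases "p = 0")
    case False
    have "tdeg (g * p\<^sup>2) \<le> tdeg g + (tdeg p + tdeg p)"
      unfolding power2_eq_square using tdeg_mult[of g "p * p"] tdeg_mult[of p p] by linarith
    then have "g * p\<^sup>2 \<in> polys (2 * k)"
      using tdeg_loc_index[OF that False] by (simp add: polys_def)
    then show ?thesis using assms by (intro lext_cong) (auto simp: polys_iff)
  qed (simp add: lext_zero)
  then show ?thesis unfolding truncated_nonneg_def by auto
qed

lemma lin_constraints_homogenize:
  assumes "m1 \<le> m" "finite A" "\<And>i. i \<in> {1..m} \<Longrightarrow> Poly_Mapping.keys (a i) \<subseteq> A"
    and "\<And>\<alpha>. \<alpha> \<in> A \<Longrightarrow> Poly_Mapping.lookup w (homog_exp d \<alpha>) = Poly_Mapping.lookup y \<alpha>"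
  shows "lin_constraints m1 m (\<lambda>i. homogenize d (a i)) b w \<longleftrightarrow> lin_constraints m1 m a b y"
proof -
  have "pairing (homogenize d (a i)) w = pairing (a i) y" if "i \<in> {1..m}" for i
    unfolding pairing_eq_lext lext_homogenize using assms(3)[OF that] assms(4) by (intro lext_cong) auto
  moreover have "{1..m1} \<subseteq> {1..m}" "{m1<..m} \<subseteq> {1..m}" using assms(1) by auto
  ultimately show ?thesis unfolding lin_constraints_def by (auto simp: subset_iff)
qed

lemma relax_feasibleI:
  assumes f: "truncated_nonneg E I c k f" and lin: "lin_constraints m1 m a b y"
    and y: "\<And>\<alpha>. \<alpha> \<in> A \<Longrightarrow> f (homog_exp d \<alpha>) = Poly_Mapping.lookup y \<alpha>"
    and A: "m1 \<le> m" "finite A" "\<And>i. i \<in> {1..m} \<Longrightarrow> Poly_Mapping.keys (a i) \<subseteq> A" "A \<subseteq> exps d"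
    and d: "d \<le> 2 * k"
  shows "mvec_of (exps (2 * k)) f \<in> relax_feasible E I c m1 m a b d k"
proof -
  have "Poly_Mapping.lookup (mvec_of (exps (2 * k)) f) (homog_exp d \<alpha>) = Poly_Mapping.lookup y \<alpha>" if "\<alpha> \<in> A" for \<alpha>
  proof -
    have "mdeg \<alpha> \<le> d" using that A(4) by (auto simp: exps_def)
    then have "homog_exp d \<alpha> \<in> exps (2 * k)" using d by (simp add: exps_def mdeg_homog_exp)
    then show ?thesis using y[OF that] by (simp add: lookup_mvec_of)
  qed
  then have "lin_constraints m1 m (\<lambda>i. homogenize d (a i)) b (mvec_of (exps (2 * k)) f)"
    using lin by (subst lin_constraints_homogenize[where a = a and A = A and y = y]) (use A in auto)
  moreover have "truncated_nonneg E I c k (Poly_Mapping.lookup (mvec_of (exps (2 * k)) f))"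
    using f by (subst truncated_nonneg_cong) (simp_all add: lookup_mvec_of)
  ultimately show ?thesis unfolding relax_feasible_iff by simp
qed

lemma truncated_nonneg_limit:
  assumes "\<And>n. truncated_nonneg E I c k (f n)"
    and lim: "\<And>\<beta>. \<beta> \<in> exps (2 * k) \<Longrightarrow> (\<lambda>n. f n \<beta>) \<longlonglongrightarrow> l \<beta>"
  shows "truncated_nonneg E I c k l"
proof -
  \<comment> \<open>Convergence is known only up to degree 2 k; zero elsewhere makes it hold at
    every exponent.\<close>
  let ?r = "\<lambda>f \<beta>. if \<beta> \<in> exps (2 * k) then f \<beta> else 0"
  have "truncated_nonneg E I c k (?r (f n))" for n
    using assms(1)[of n] by (subst truncated_nonneg_cong[of k _ "f n"]) auto
  then have nonneg: "0 \<le> lext (?r (f n)) (g * p\<^sup>2)"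
    if "g \<in> weights E I c" "Poly_Mapping.keys p \<subseteq> loc_index g k" for n g p
    using that unfolding truncated_nonneg_def by blast
  have "(\<lambda>n. ?r (f n) \<beta>) \<longlonglongrightarrow> ?r l \<beta>" for \<beta> using lim by simp
  then have lext_lim: "(\<lambda>n. lext (?r (f n)) q) \<longlonglongrightarrow> lext (?r l) q" for q
    by (rule tendsto_lext)
  have "truncated_nonneg E I c k (?r l)"
    unfolding truncated_nonneg_def
    by (intro ballI allI impI LIMSEQ_le_const[OF lext_lim]) (use nonneg in blast)
  then show ?thesis by (subst truncated_nonneg_cong[of k _ "?r l"]) auto
qed

text \<open>Every polynomial is a difference of two squares, p = ((p + 1)/2)^2 - ((p - 1)/2)^2, so
  sums of square multiples of plus and minus \<open>sphere_poly\<close> exhaust the ideal.\<close>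

lemma quadratic_coneI:
  fixes Q :: "('n::finite) mpoly set"
  assumes add: "\<And>p q. p \<in> Q \<Longrightarrow> q \<in> Q \<Longrightarrow> p + q \<in> Q"
    and sq: "\<And>p. 1 * p\<^sup>2 \<in> Q" "\<And>p. sphere_poly * p\<^sup>2 \<in> Q" "\<And>p. - sphere_poly * p\<^sup>2 \<in> Q"
  shows "quadratic_cone Q"
proof
  fix p :: "'n mpoly"
  let ?h = "(1 / 2 :: real)"
  have half: "(?h *\<^sub>R q)\<^sup>2 = (1 / 4) *\<^sub>R q\<^sup>2" for q :: "'n mpoly"
    by (simp add: power2_eq_square mult_scaleR_mpoly)
  have "(p + 1)\<^sup>2 - (p - 1)\<^sup>2 = 4 *\<^sub>R p"
  proof -
    have "4 *\<^sub>R p = 2 *\<^sub>R (2 *\<^sub>R p)" by simp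
    also have "\<dots> = (p + p) + (p + p)" unfolding scaleR_2 ..
    finally show ?thesis by (simp add: power2_eq_square algebra_simps)
  qed
  then have "p = (1 / 4) *\<^sub>R ((p + 1)\<^sup>2 - (p - 1)\<^sup>2)" by simp
  then have "p = (?h *\<^sub>R (p + 1))\<^sup>2 - (?h *\<^sub>R (p - 1))\<^sup>2"
    unfolding half by (simp add: scaleR_diff_right)
  then have "sphere_poly * p = sphere_poly * (?h *\<^sub>R (p + 1))\<^sup>2 + - sphere_poly * (?h *\<^sub>R (p - 1))\<^sup>2"
    by (metis (no_types, lifting) diff_conv_add_uminus minus_mult_left right_diff_distrib)
  then show "sphere_poly * p \<in> Q" using add[OF sq(2,3)] by simp
qed (use add sq(1) in auto)

lemma putinar_weights:
  assumes Q: "\<And>g p. g \<in> weights E I c \<Longrightarrow> g * p\<^sup>2 \<in> Q" "\<And>p q. p \<in> Q \<Longrightarrow> q \<in> Q \<Longrightarrow> p + q \<in> Q"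
    and fin: "finite E" "finite I"
    and pos: "\<And>z. z \<in> semialg_tilde E I c \<Longrightarrow> 0 < poly_eval q z"
  shows "q \<in> Q"
proof -
  interpret quadratic_cone Q
    using Q(1)[of 1] Q(1)[of sphere_poly] Q(1)[of "- sphere_poly"]
    by (intro quadratic_coneI Q(2)) auto
  show ?thesis
    by (rule putinar[OF finite_constraint_polys[OF fin, of c]])
      (use Q(1) pos semialg_tilde_iff[of _ E I c] in auto)
qed


section \<open>Flatness, interior points and linear constraints\<close>

text \<open>A subset \<open>B\<close> of \<open>W\<close> mapped bijectively to a basis of the image
  is independent and has \<open>dim V\<close> elements, so a vector of \<open>V\<close> outside its
  span would exceed the dimension. For flatness \<open>R\<close> drops rows: the columns of the
  smaller moment matrix are truncated columns of the larger one.\<close>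

lemma span_superset_of_dim_image:
  fixes R :: "'a::real_vector \<Rightarrow> 'b::real_vector"
  assumes R: "linear R" and V: "finite V" "W \<subseteq> V" and dim: "dim (R ` W) = dim V"
  shows "V \<subseteq> span W"
proof -
  obtain BS where BS: "BS \<subseteq> R ` W" "independent BS" "R ` W \<subseteq> span BS" "card BS = dim (R ` W)"
    by (rule basis_exists)
  obtain B where B: "B \<subseteq> W" "inj_on R B" "BS = R ` B"
    using BS(1) unfolding subset_image_inj by blast
  have indep: "independent B"
  proof
    assume "dependent B"
    then obtain x where x: "x \<in> B" "x \<in> span (B - {x})" unfolding dependent_def by blast
    have "R x \<in> span (R ` (B - {x}))"
      unfolding linear_span_image[OF R] using x(2) by (rule imageI)
    also have "R ` (B - {x}) = BS - {R x}"
      using B(2,3) x(1) by (auto simp: inj_on_def)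
    finally show False using BS(2) x(1) unfolding B(3) dependent_def by blast
  qed
  have card: "card B = dim V" using B BS(4) dim by (simp add: card_image)
  have finB: "finite B" by (rule finite_subset[OF _ V(1)]) (use B(1) V(2) in blast)
  obtain BV where BV: "BV \<subseteq> V" "V \<subseteq> span BV" "card BV = dim V" by (rule basis_exists)
  have "V \<subseteq> span B"
  proof (rule ccontr)
    assume "\<not> V \<subseteq> span B"
    then obtain v where v: "v \<in> V" "v \<notin> span B" by blast
    have "independent (insert v B)" using indep v(2) by (simp add: independent_insertI)
    moreover have "insert v B \<subseteq> span BV" using v(1) B(1) V(2) BV(2) by blast
    ultimately have "card (insert v B) \<le> card BV"
      using independent_span_bound[OF finite_subset[OF BV(1) V(1)]] by blast
    moreover have "v \<notin> B" using v(2) span_base by blast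
    ultimately show False using BV(3) card finB by simp
  qed
  then show ?thesis using span_mono[OF B(1)] by blast
qed

lemma deg_K_bounds:
  assumes "finite E" "finite I"
  shows "1 \<le> deg_K E I c" "i \<in> E \<union> I \<Longrightarrow> tdeg (c i) \<le> 2 * deg_K E I c"
proof -
  let ?S = "insert 1 ((\<lambda>i. nat \<lceil>real (tdeg (c i)) / 2\<rceil>) ` (E \<union> I))"
  have fin: "finite ?S" using assms by simp
  show "1 \<le> deg_K E I c" unfolding deg_K_def using fin by (intro Max_ge) auto
  assume "i \<in> E \<union> I"
  then have "nat \<lceil>real (tdeg (c i)) / 2\<rceil> \<le> deg_K E I c"
    unfolding deg_K_def using fin by (intro Max_ge) auto
  then show "tdeg (c i) \<le> 2 * deg_K E I c" by linarith
qed

lemma tdeg_homogenization: "tdeg (homogenization p) \<le> tdeg p"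
proof -
  have "homogenize (tdeg p) p \<in> polys (tdeg p)"
    unfolding homogenize_def
  proof (intro subspace_sum subspace_polys)
    fix \<alpha> assume "\<alpha> \<in> Poly_Mapping.keys p"
    then have "mdeg (homog_exp (tdeg p) \<alpha>) = tdeg p" by (intro mdeg_homog_exp mdeg_le_tdeg)
    then show "Poly_Mapping.single (homog_exp (tdeg p) \<alpha>) (mcoeff p \<alpha>) \<in> polys (tdeg p)"
      by (simp add: polys_iff exps_def)
  qed
  then show ?thesis by (simp add: homogenization_def polys_def)
qed

lemma sphere_poly_polys: "sphere_poly \<in> polys 2"
  unfolding sphere_poly_def power2_eq_square
  by (intro subspace_diff subspace_sum subspace_polys mult_polys[of _ 1 _ 1] monom_polys)
    (auto simp: polys_def)

lemma weights_polys:
  fixes c :: "'l \<Rightarrow> 'b::finite mpoly"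
  assumes "finite E" "finite I" "g \<in> weights E I c"
  shows "g \<in> polys (2 * deg_K E I c)"
proof -
  have 1: "1 \<le> deg_K E I c" using deg_K_bounds(1)[OF assms(1,2)] .
  have hom: "homogenization (c i) \<in> polys (2 * deg_K E I c)" if "i \<in> E \<union> I" for i
    unfolding polys_def mem_Collect_eq
    by (rule order_trans[OF tdeg_homogenization deg_K_bounds(2)[OF assms(1,2) that]])
  have sph: "sphere_poly \<in> polys (2 * deg_K E I c)"
    by (rule polys_mono[OF sphere_poly_polys]) (use 1 in simp)
  have neg: "- q \<in> polys (2 * deg_K E I c)" if "q \<in> polys (2 * deg_K E I c)" for q :: "'b option mpoly"
    using that by (rule subspace_neg[OF subspace_polys])
  have "1 \<in> polys (2 * deg_K E I c)" by (simp add: polys_def)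
  moreover have "var None \<in> polys (2 * deg_K E I c)" by (rule monom_polys) (use 1 in simp)
  ultimately show ?thesis
    using assms(3) hom sph neg unfolding constraint_polys_def by blast
qed

text \<open>Equal ranks mean that the columns of degree at most \<open>s\<close> span all columns,
  and a linear relation between columns of the moment matrix is exactly a congruence modulo its
  kernel.\<close>

lemma flat_imp_flat_functional:
  fixes c :: "'l \<Rightarrow> 'n::finite mpoly"
  assumes "finite E" "finite I" "flat E I c t u"
  shows "flat_functional (Poly_Mapping.lookup u) (t - deg_K E I c) t"
proof
  let ?l = "Poly_Mapping.lookup u"
  define s where "s = t - deg_K E I c"
  have tD: "deg_K E I c \<le> t" using assms(3) by (simp add: flat_def)
  then show st: "t - deg_K E I c < t" using deg_K_bounds(1)[OF assms(1,2), of c] by simp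
  define col where "col r \<gamma> = mvec_of (exps r) (\<lambda>\<beta>. ?l (\<gamma> + \<beta>))" for r and \<gamma> :: "'n option exponent"
  have entry: "moment_matrix r u \<beta> \<gamma> = ?l (\<gamma> + \<beta>)" if "\<beta> \<in> exps r" "\<gamma> \<in> exps r" for r \<beta> \<gamma>
    using that by (simp add: moment_matrix_def loc_matrix_eq pairing_eq_lext add.commute)
  have rank: "rank_on (exps r) (moment_matrix r u) = dim (col r ` exps r)" for r
  proof -
    have "(\<Sum>\<beta>\<in>exps r. Poly_Mapping.single \<beta> (moment_matrix r u \<beta> \<gamma>)) = col r \<gamma>" if "\<gamma> \<in> exps r" for \<gamma>
      unfolding col_def mvec_of_def using that by (intro sum.cong) (auto simp: entry)
    then have "(\<lambda>\<gamma>. \<Sum>\<beta>\<in>exps r. Poly_Mapping.single \<beta> (moment_matrix r u \<beta> \<gamma>)) ` exps r = col r ` exps r"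
      by (intro image_cong) auto
    then show ?thesis by (simp add: rank_on_def)
  qed
  define R :: "'n option mvec \<Rightarrow> 'n option mvec" where "R y = mvec_of (exps s) (Poly_Mapping.lookup y)" for y
  have "linear R"
    by (rule linearI; rule poly_mapping_eqI) (simp_all add: R_def lookup_mvec_of lookup_add)
  have sub: "exps s \<subseteq> (exps t :: 'n option exponent set)" using st by (auto simp: exps_def s_def)
  have "R (col t \<gamma>) = col s \<gamma>" for \<gamma>
    by (rule poly_mapping_eqI) (use sub in \<open>auto simp: R_def col_def lookup_mvec_of\<close>)
  then have "R ` col t ` exps s = col s ` exps s" unfolding image_image by (intro image_cong refl)
  moreover have "dim (col s ` exps s) = dim (col t ` exps t)"
    using assms(3) unfolding flat_def s_def[symmetric] rank by blast
  ultimately have "dim (R ` col t ` exps s) = dim (col t ` exps t)" by (simp only:)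
  then have "col t ` exps t \<subseteq> span (col t ` exps s)"
    by (intro span_superset_of_dim_image[OF \<open>linear R\<close>] image_mono sub) simp
  also have "span (col t ` exps s) \<subseteq> lext (col t) ` polys s"
  proof (rule span_minimal)
    show "subspace (lext (col t) ` polys s)"
      by (intro linear_subspace_image linear_lext subspace_polys)
    show "col t ` exps s \<subseteq> lext (col t) ` polys s"
    proof
      fix y assume "y \<in> col t ` exps s"
      then obtain \<gamma> where "\<gamma> \<in> exps s" "y = lext (col t) (mmonom \<gamma>)" by auto
      then show "y \<in> lext (col t) ` polys s" 
        by (simp only:) (intro imageI monom_polys, simp add: exps_def)
    qed
  qed
  finally have cols: "col t \<gamma> \<in> lext (col t) ` polys s" if "\<gamma> \<in> exps t" for \<gamma>
    using that by (meson image_subset_iff)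
  fix p :: "'n option mpoly" assume p: "p \<in> polys t"
  have "lext (col t) p \<in> lext (col t) ` polys s"
    unfolding lext_def[of _ p]
    by (intro subspace_sum subspace_scale linear_subspace_image linear_lext subspace_polys)
      (rule cols, use p in \<open>auto simp: polys_iff[of p]\<close>)
  then obtain p' where p': "p' \<in> polys s" "lext (col t) p = lext (col t) p'" by blast
  have col_lext: "lext ?l (r * mmonom \<beta>) = mcoeff (lext (col t) r) \<beta>" if "\<beta> \<in> exps t" for r \<beta>
    unfolding lext_mult_monom unfolding lext_def lookup_sum
    by (intro sum.cong) (use that in \<open>auto simp: col_def lookup_mvec_of\<close>)
  have "lext ?l (p * q) = lext ?l (p' * q)" if "q \<in> polys t" for q
  proof (rule linear_eq_on_monom[of "\<lambda>q. lext ?l (p * q)" "\<lambda>q. lext ?l (p' * q)"])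
    show "linear (\<lambda>q. lext ?l (p * q))" "linear (\<lambda>q. lext ?l (p' * q))"
      by (rule linearI; simp add: distrib_left lext_add mult_scaleR_mpoly lext_scaleR)+
    fix \<beta> assume "\<beta> \<in> Poly_Mapping.keys q"
    then have "\<beta> \<in> exps t" using that by (auto simp: polys_iff)
    then show "lext ?l (p * mmonom \<beta>) = lext ?l (p' * mmonom \<beta>)" using p'(2) by (simp add: col_lext)
  qed
  then show "\<exists>p'\<in>polys (t - deg_K E I c). \<forall>q\<in>polys t. lext ?l (p * q) = lext ?l (p' * q)"
    using p'(1) unfolding s_def by (intro bexI[of _ p'] ballI)
qed

section \<open>Interior points of the cone of nonnegative polynomials\<close>

lemma norm_monom [simp]: "norm (mmonom \<alpha> :: 'n mpoly) = 1"
  by (simp add: norm_poly_mapping_def dist_poly_mapping_def)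

text \<open>Monomials have norm 1, so half the radius of a ball around \<open>p\<close> serves as
  \<delta> for all of them and for both signs.\<close>

lemma int_nonneg_polys_margin:
  assumes "p \<in> int_nonneg_polys d K"
  shows "p \<in> polys d \<and> (\<exists>\<delta>>0. \<forall>\<alpha> \<sigma>. mdeg \<alpha> \<le> d \<longrightarrow> \<bar>\<sigma>\<bar> = \<delta> \<longrightarrow>
    (\<forall>x\<in>K. 0 \<le> poly_eval (p - \<sigma> *\<^sub>R mmonom \<alpha>) x))"
proof -
  obtain T where T: "openin (top_of_set (polys d)) T" "p \<in> T" "T \<subseteq> nonneg_polys d K"
    using assms unfolding int_nonneg_polys_def interior_of_def by auto
  then obtain e where e: "e > 0" "\<And>q. q \<in> polys d \<Longrightarrow> dist q p < e \<Longrightarrow> q \<in> T"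
    unfolding openin_euclidean_subtopology_iff by blast
  have p: "p \<in> polys d" using T by (auto simp: nonneg_polys_def)
  have "0 \<le> poly_eval (p - \<sigma> *\<^sub>R mmonom \<alpha>) x" if "mdeg \<alpha> \<le> d" "\<bar>\<sigma>\<bar> = e / 2" "x \<in> K" for \<alpha> \<sigma> x
  proof -
    have "p - \<sigma> *\<^sub>R mmonom \<alpha> \<in> polys d"
      by (intro subspace_diff subspace_scale subspace_polys p monom_polys that)
    moreover have "dist (p - \<sigma> *\<^sub>R mmonom \<alpha>) p < e" using that(2) e(1) by (simp add: dist_norm)
    ultimately have "p - \<sigma> *\<^sub>R mmonom \<alpha> \<in> nonneg_polys d K" using e(2) T(3) by blast
    then show ?thesis using that(3) unfolding nonneg_polys_def by blast
  qed
  then show ?thesis using e(1) p by (intro conjI exI[of _ "e / 2"]) auto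
qed

lemma homog_exp_pure_power:
  fixes j :: "('n::finite) option"
  obtains \<alpha> :: "'n exponent" where "mdeg \<alpha> \<le> d" "homog_exp d \<alpha> = Poly_Mapping.single j d"
proof (cases j)
  case None
  have "homog_exp d (0 :: 'n exponent) = Poly_Mapping.single j d"
  proof (rule poly_mapping_eqI)
    fix k show "Poly_Mapping.lookup (homog_exp d (0 :: 'n exponent)) k = Poly_Mapping.lookup (Poly_Mapping.single j d) k"
      by (cases k) (auto simp: None lookup_homog_exp lookup_single when_def)
  qed
  then show ?thesis using that[of 0] by simp
next
  case (Some i)
  have "homog_exp d (Poly_Mapping.single i d) = Poly_Mapping.single j d"
  proof (rule poly_mapping_eqI)
    fix k show "Poly_Mapping.lookup (homog_exp d (Poly_Mapping.single i d)) k = Poly_Mapping.lookup (Poly_Mapping.single j d) k"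
      by (cases k) (auto simp: Some lookup_homog_exp lookup_single when_def)
  qed
  then show ?thesis using that[of "Poly_Mapping.single i d"] by simp
qed

text \<open>Nonnegativity survives a small multiple of x_j^d of either sign, and the homogenizations
  inherit this even at infinity. Choosing j with z_j \<noteq> 0 leaves the strictly positive reserve
  \<delta> |z_j^d|.\<close>

lemma int_nonneg_polys_positive:
  assumes cl: "closed_at_infinity E I c" and p: "p \<in> int_nonneg_polys d (semialg E I c)"
    and z: "z \<in> semialg_tilde E I c"
  shows "0 < poly_eval (homogenize d p) z"
proof -
  obtain \<delta> where \<delta>: "\<delta> > 0" "p \<in> polys d" "\<And>\<alpha> \<sigma> x. mdeg \<alpha> \<le> d \<Longrightarrow> \<bar>\<sigma>\<bar> = \<delta> \<Longrightarrow> x \<in> semialg E I c \<Longrightarrow>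
      0 \<le> poly_eval (p - \<sigma> *\<^sub>R mmonom \<alpha>) x"
    using int_nonneg_polys_margin[OF p] by blast
  have zh: "z \<in> semialg_h E I c" using z by (simp add: semialg_tilde_def)
  have ge: "\<sigma> * mono_eval (homog_exp d \<alpha>) z \<le> poly_eval (homogenize d p) z"
    if "mdeg \<alpha> \<le> d" "\<bar>\<sigma>\<bar> = \<delta>" for \<alpha> \<sigma>
  proof -
    have "p - \<sigma> *\<^sub>R mmonom \<alpha> \<in> polys d"
      by (intro subspace_diff subspace_scale subspace_polys \<delta>(2) monom_polys that)
    then have "0 \<le> poly_eval (homogenize d (p - \<sigma> *\<^sub>R mmonom \<alpha>)) z"
      using \<delta>(3)[OF that] zh by (intro homogenize_nonneg[OF cl]) (auto simp: polys_def)
    then show ?thesis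
      by (simp add: poly_eval_eq_lext lext_homogenize lext_diff lext_scaleR)
  qed
  have "(\<Sum>i\<in>UNIV. (z $ i)\<^sup>2) = 1" using z semialg_tilde_iff by blast
  then obtain j where j: "z $ j \<noteq> 0" by (metis (no_types, lifting) power_zero_numeral sum.neutral zero_neq_one)
  obtain \<alpha> where \<alpha>: "mdeg \<alpha> \<le> d" "homog_exp d \<alpha> = Poly_Mapping.single j d"
    using homog_exp_pure_power by blast
  let ?v = "(z $ j) ^ d"
  have "\<delta> * ?v \<le> poly_eval (homogenize d p) z" "- \<delta> * ?v \<le> poly_eval (homogenize d p) z"
    using ge[OF \<alpha>(1), of \<delta>] ge[OF \<alpha>(1), of "- \<delta>"] \<delta>(1) \<alpha>(2) by simp_all
  moreover have "0 < \<delta> * \<bar>?v\<bar>" using \<delta>(1) j by simp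
  ultimately show ?thesis by (cases "?v \<ge> 0") (auto simp: abs_if split: if_splits)
qed

section \<open>Bounds imposed by the linear constraints\<close>

lemma subspace_mvecs: "subspace (mvecs A)"
  by (rule subspaceI) (auto simp: mvecs_def in_keys_iff lookup_add subset_iff, metis add_0)

lemma poly_space_subset_mvecs: "poly_space A \<subseteq> mvecs A"
  unfolding poly_space_def by (rule span_minimal[OF _ subspace_mvecs]) (auto simp: mvecs_def)

lemma span_minus_cone_subset_mvecs:
  assumes "m1 \<le> m" "\<And>i. i \<in> {1..m} \<Longrightarrow> a i \<in> mvecs A"
  shows "span_minus_cone m1 m a \<subseteq> mvecs A"
proof
  fix p assume "p \<in> span_minus_cone m1 m a"
  then obtain p1 p2 where *: "p = p1 - p2" "p1 \<in> span (a ` {1..m1})" "p2 \<in> convex_cone hull (a ` {m1<..m})"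
    unfolding span_minus_cone_def by blast
  have "span (a ` {1..m1}) \<subseteq> mvecs A"
    using assms by (intro span_minimal subspace_mvecs) auto
  moreover have "convex_cone hull (a ` {m1<..m}) \<subseteq> mvecs A"
    using assms by (intro hull_minimal subspace_imp_convex_cone subspace_mvecs) auto
  ultimately show "p \<in> mvecs A"
    using * by (auto intro: subspace_diff[OF subspace_mvecs])
qed

text \<open>The constraints fix the pairing with the span part and bound that with the cone part
  from below; the minus sign in H_0 turns this into an upper bound.\<close>

lemma span_minus_cone_bound:
  assumes "p \<in> span_minus_cone m1 m a"
  obtains B where "\<And>y. lin_constraints m1 m a b y \<Longrightarrow> pairing p y \<le> B"
proof -
  obtain p1 p2 where *: "p = p1 - p2" "p1 \<in> span (a ` {1..m1})" "p2 \<in> convex_cone hull (a ` {m1<..m})"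
    using assms unfolding span_minus_cone_def by blast
  let ?S = "{q. \<exists>B. \<forall>y. lin_constraints m1 m a b y \<longrightarrow> pairing q y = B}"
  let ?C = "{q. \<exists>B. \<forall>y. lin_constraints m1 m a b y \<longrightarrow> B \<le> pairing q y}"
  have "span (a ` {1..m1}) \<subseteq> ?S"
  proof (rule span_minimal)
    show "subspace ?S"
    proof (rule subspaceI)
      show "0 \<in> ?S" by (simp add: pairing_eq_lext lext_zero)
    next
      fix x y assume "x \<in> ?S" "y \<in> ?S"
      then obtain B B' where "\<forall>u. lin_constraints m1 m a b u \<longrightarrow> pairing x u = B"
        "\<forall>u. lin_constraints m1 m a b u \<longrightarrow> pairing y u = B'" by blast
      then show "x + y \<in> ?S" by (simp add: pairing_add)
    next
      fix x and r :: real assume "x \<in> ?S"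
      then obtain B where "\<forall>u. lin_constraints m1 m a b u \<longrightarrow> pairing x u = B" by blast
      then show "r *\<^sub>R x \<in> ?S" by (simp add: pairing_scaleR)
    qed
    show "a ` {1..m1} \<subseteq> ?S"
    proof (rule image_subsetI)
      fix i assume "i \<in> {1..m1}"
      then show "a i \<in> ?S" unfolding lin_constraints_def by (intro CollectI exI[of _ "b i"]) blast
    qed
  qed
  moreover have "convex_cone hull (a ` {m1<..m}) \<subseteq> ?C"
  proof (rule hull_minimal)
    show "convex_cone ?C"
      unfolding convex_cone_iff
    proof (intro conjI ballI allI impI)
      show "0 \<in> ?C" by (simp add: pairing_eq_lext lext_zero) blast
    next
      fix x y assume "x \<in> ?C" "y \<in> ?C"
      then obtain B B' where "\<forall>u. lin_constraints m1 m a b u \<longrightarrow> B \<le> pairing x u"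
        "\<forall>u. lin_constraints m1 m a b u \<longrightarrow> B' \<le> pairing y u" by blast
      then show "x + y \<in> ?C" by (auto simp: pairing_add intro!: exI[of _ "B + B'"] add_mono)
    next
      fix x and r :: real assume "x \<in> ?C" "0 \<le> r"
      then obtain B where "\<forall>u. lin_constraints m1 m a b u \<longrightarrow> B \<le> pairing x u" by blast
      then show "r *\<^sub>R x \<in> ?C"
        using \<open>0 \<le> r\<close> by (auto simp: pairing_scaleR intro!: exI[of _ "r * B"] mult_left_mono)
    qed
    show "a ` {m1<..m} \<subseteq> ?C"
    proof (rule image_subsetI)
      fix i assume "i \<in> {m1<..m}"
      then show "a i \<in> ?C" unfolding lin_constraints_def by (intro CollectI exI[of _ "b i"]) blast
    qed
  qed
  ultimately have "p1 \<in> ?S" "p2 \<in> ?C" using *(2,3) by auto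
  then obtain B1 B2 where B: "\<And>y. lin_constraints m1 m a b y \<Longrightarrow> pairing p1 y = B1"
    "\<And>y. lin_constraints m1 m a b y \<Longrightarrow> B2 \<le> pairing p2 y" by auto
  have "pairing p y \<le> B1 - B2" if "lin_constraints m1 m a b y" for y
    using B[OF that] *(1) by (simp add: pairing_eq_lext lext_diff)
  then show ?thesis using that by blast
qed


section \<open>The moment problem\<close>

lemma lext_moments_nonneg:
  assumes "f \<in> moments X" "\<And>x. x \<in> X \<Longrightarrow> 0 \<le> poly_eval q x"
  shows "0 \<le> lext f q"
proof -
  obtain U \<kappa> where "U \<subseteq> X" "\<forall>u\<in>U. 0 \<le> \<kappa> u" "\<forall>q. lext f q = (\<Sum>u\<in>U. \<kappa> u * poly_eval q u)"
    using momentsD[OF assms(1)] by blast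
  then show ?thesis using assms(2) by (auto intro!: sum_nonneg mult_nonneg_nonneg)
qed

lemma abs_mono_eval_le_1:
  assumes "z \<in> semialg_tilde E I c"
  shows "\<bar>mono_eval \<beta> z\<bar> \<le> 1"
proof -
  have "(z $ i)\<^sup>2 \<le> (\<Sum>i\<in>UNIV. (z $ i)\<^sup>2)" for i by (rule member_le_sum) auto
  moreover have "(\<Sum>i\<in>UNIV. (z $ i)\<^sup>2) = 1" using assms semialg_tilde_iff by blast
  ultimately have "\<bar>z $ i\<bar> \<le> 1" for i by (simp add: abs_square_le_1)
  then show ?thesis
    unfolding mono_eval_def abs_prod power_abs by (intro prod_le_1 conjI power_le_one) auto
qed

text \<open>\<open>f 0\<close> is the total mass, and 1 - x^\<beta> and 1 + x^\<beta> are
  nonnegative on the sphere.\<close>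

lemma abs_lext_monom_le_mass:
  assumes f: "f \<in> moments (semialg_tilde E I c)"
  shows "\<bar>f \<beta>\<bar> \<le> f 0"
proof -
  have "0 \<le> lext f (1 - e *\<^sub>R mmonom \<beta>)" if "\<bar>e\<bar> = 1" for e :: real
  proof (rule lext_moments_nonneg[OF f])
    fix z assume "z \<in> semialg_tilde E I c"
    then have "\<bar>e * mono_eval \<beta> z\<bar> \<le> 1" using abs_mono_eval_le_1 that by (simp add: abs_mult)
    then show "0 \<le> poly_eval (1 - e *\<^sub>R mmonom \<beta>) z" by simp
  qed
  from this[of 1] this[of "- 1"] show ?thesis by (simp add: lext_diff lext_scaleR lext_add)
qed

lemma lookup_truncate:
  "Poly_Mapping.lookup (truncate k w) \<beta> = (if \<beta> \<in> exps k then Poly_Mapping.lookup w \<beta> else 0)"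
proof -
  have "Poly_Mapping.lookup (truncate k w) \<beta>
      = (\<Sum>\<gamma>\<in>Poly_Mapping.keys w \<inter> exps k. if \<gamma> = \<beta> then Poly_Mapping.lookup w \<beta> else 0)"
    unfolding truncate_def lookup_sum by (intro sum.cong) (auto simp: lookup_single when_def)
  then show ?thesis by (auto simp: in_keys_iff)
qed

locale moment_problem =
  fixes E I :: "'l set" and c :: "'l \<Rightarrow> 'n::finite mpoly" and A :: "'n exponent set"
    and a :: "nat \<Rightarrow> 'n mpoly" and b :: "nat \<Rightarrow> real" and m1 m d :: nat
  assumes fin: "finite E" "finite I" "finite A" and m: "m1 \<le> m"
    and A_d: "A \<subseteq> exps d" and a: "\<And>i. i \<in> {1..m} \<Longrightarrow> a i \<in> mvecs A"
begin

abbreviation "K \<equiv> semialg E I c"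
abbreviation "feas k \<equiv> relax_feasible E I c m1 m a b d k"

lemma keys_a: "i \<in> {1..m} \<Longrightarrow> Poly_Mapping.keys (a i) \<subseteq> A"
  using a by (simp add: mvecs_def)

lemma keys_span_minus_cone: "p \<in> span_minus_cone m1 m a \<Longrightarrow> Poly_Mapping.keys p \<subseteq> A"
  using span_minus_cone_subset_mvecs[of m1 m a A] m a unfolding mvecs_def by blast

lemma mdeg_A: "\<alpha> \<in> A \<Longrightarrow> mdeg \<alpha> \<le> d"
  using A_d by (auto simp: exps_def)

definition dehom :: "('n option exponent \<Rightarrow> real) \<Rightarrow> 'n mvec"
  where "dehom f = mvec_of A (\<lambda>\<alpha>. f (homog_exp d \<alpha>))"

lemma dehom_in: "dehom f \<in> mvecs A"
  using fin by (simp add: dehom_def)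

lemma lookup_dehom: "\<alpha> \<in> A \<Longrightarrow> Poly_Mapping.lookup (dehom f) \<alpha> = f (homog_exp d \<alpha>)"
  using fin by (simp add: dehom_def lookup_mvec_of)

lemma pairing_dehom: "Poly_Mapping.keys q \<subseteq> A \<Longrightarrow> pairing q (dehom f) = lext f (homogenize d q)"
  unfolding dehom_def lext_homogenize by (rule pairing_mvec_of[OF fin(3)])

lemma lin_constraints_dehom:
  "w \<in> feas k \<Longrightarrow> lin_constraints m1 m a b (dehom (Poly_Mapping.lookup w))"
  unfolding relax_feasible_iff
  using lin_constraints_homogenize[of m1 m A a w d "dehom (Poly_Mapping.lookup w)" b] m fin keys_a
    lookup_dehom[of _ "Poly_Mapping.lookup w"] by auto

lemma feasI:
  assumes "truncated_nonneg E I c k f" "lin_constraints m1 m a b y" "d \<le> 2 * k"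
    and "\<And>\<alpha>. \<alpha> \<in> A \<Longrightarrow> f (homog_exp d \<alpha>) = Poly_Mapping.lookup y \<alpha>"
  shows "mvec_of (exps (2 * k)) f \<in> feas k"
  by (rule relax_feasibleI[OF assms(1,2) _ m fin(3) keys_a A_d assms(3)]) (use assms(4) in auto)

lemma lift_moments:
  assumes "f \<in> moments K"
  obtains g where "g \<in> moments (semialg_tilde E I c)"
    "\<And>\<alpha>. \<alpha> \<in> A \<Longrightarrow> g (homog_exp d \<alpha>) = f \<alpha>"
proof -
  obtain g where g: "g \<in> moments (semialg_tilde_pos E I c)"
    "\<And>\<alpha>. mdeg \<alpha> \<le> d \<Longrightarrow> g (homog_exp d \<alpha>) = f \<alpha>"
    using moments_lift[OF assms] by metis
  have "g \<in> moments (semialg_tilde E I c)"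
    using g(1) conic_atoms_mono[of "semialg_tilde_pos E I c" "semialg_tilde E I c"] by blast
  then show ?thesis using that g(2) mdeg_A by blast
qed

theorem infeasible_if_relaxation_infeasible:
  assumes "d \<le> 2 * k" "feas k = {}"
  shows "moment_system m1 m a b A K = {}"
proof (rule ccontr)
  assume "moment_system m1 m a b A K \<noteq> {}"
  then obtain y where y: "y \<in> moment_cone A K" "lin_constraints m1 m a b y"
    by (auto simp: moment_system_def)
  then obtain f where f: "f \<in> moments K" "\<And>\<alpha>. \<alpha> \<in> A \<Longrightarrow> Poly_Mapping.lookup y \<alpha> = f \<alpha>"
    using moment_cone_iff[OF fin(3)] by blast
  obtain g where g: "g \<in> moments (semialg_tilde E I c)"
    "\<And>\<alpha>. \<alpha> \<in> A \<Longrightarrow> g (homog_exp d \<alpha>) = f \<alpha>"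
    using lift_moments[OF f(1)] by metis
  have "mvec_of (exps (2 * k)) g \<in> feas k"
    using feasI[OF truncated_nonneg_moments[OF g(1)] y(2) assms(1)] g(2) f(2) by simp
  then show False using assms(2) by blast
qed

lemma positive_lower_bound:
  assumes cl: "closed_at_infinity E I c" and p: "p \<in> int_nonneg_polys d K"
  obtains \<epsilon> where "\<epsilon> > 0" "\<And>z. z \<in> semialg_tilde E I c \<Longrightarrow> \<epsilon> \<le> poly_eval (homogenize d p) z"
  using compact_pos_lower_bound[OF compact_semialg_tilde continuous_poly_eval]
    int_nonneg_polys_positive[OF cl p] by metis

text \<open>The element \<open>p\<close> of the interior bounds the masses of the lifted atomic measures.\<close>

theorem relaxation_feasible_if_closure_feasible:
  assumes cl: "closed_at_infinity E I c" and p: "p \<in> span_minus_cone m1 m a" "p \<in> int_nonneg_polys d K"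
    and y: "y \<in> closure_moment_system m1 m a b A K" and k: "d \<le> 2 * k"
  shows "feas k \<noteq> {}"
proof -
  have yc: "y \<in> closure (moment_cone A K)" "lin_constraints m1 m a b y"
    using y by (auto simp: closure_moment_system_def)
  have pA: "Poly_Mapping.keys p \<subseteq> A"
    by (rule keys_span_minus_cone[OF p(1)])
  obtain \<epsilon> where \<epsilon>: "\<epsilon> > 0" "\<And>z. z \<in> semialg_tilde E I c \<Longrightarrow> \<epsilon> \<le> poly_eval (homogenize d p) z"
    using positive_lower_bound[OF cl p(2)] by blast
  obtain f where f: "\<And>n. f n \<in> moments K" "\<And>\<alpha>. \<alpha> \<in> A \<Longrightarrow> (\<lambda>n. f n \<alpha>) \<longlonglongrightarrow> Poly_Mapping.lookup y \<alpha>"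
    using closure_moment_cone_sequence[OF fin(3) yc(1)] by metis
  have "\<exists>g. g \<in> moments (semialg_tilde E I c) \<and> (\<forall>\<alpha>\<in>A. g (homog_exp d \<alpha>) = f n \<alpha>)" for n
    using lift_moments[OF f(1)] by metis
  then obtain g where g: "\<And>n. g n \<in> moments (semialg_tilde E I c)"
    "\<And>n \<alpha>. \<alpha> \<in> A \<Longrightarrow> g n (homog_exp d \<alpha>) = f n \<alpha>" by metis
  have mass: "\<epsilon> * g n 0 \<le> lext (f n) p" for n
  proof -
    have "0 \<le> lext (g n) (homogenize d p - \<epsilon> *\<^sub>R 1)"
      by (rule lext_moments_nonneg[OF g(1)]) (use \<epsilon>(2) in simp)
    moreover have "lext (g n) (homogenize d p) = lext (f n) p"
      unfolding lext_homogenize using g(2) pA by (intro lext_cong) auto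
    ultimately show ?thesis by (simp add: lext_diff lext_scaleR)
  qed
  have "(\<lambda>n. lext (f n) p) \<longlonglongrightarrow> lext (Poly_Mapping.lookup y) p"
    using f(2) pA by (intro tendsto_lext) auto
  then have "Bseq (\<lambda>n. lext (f n) p)" by (rule convergent_imp_Bseq[OF convergentI])
  then obtain B where B: "\<And>n. \<bar>lext (f n) p\<bar> \<le> B" unfolding Bseq_def by auto
  have "\<bar>g n \<beta>\<bar> \<le> B / \<epsilon>" for n \<beta>
  proof -
    have "\<epsilon> * g n 0 \<le> B" using mass[of n] B[of n] by linarith
    then have "g n 0 \<le> B / \<epsilon>" using \<epsilon>(1) by (simp add: field_simps)
    then show ?thesis using abs_lext_monom_le_mass[OF g(1), of n \<beta>] by linarith
  qed
  then have "bounded (range (\<lambda>n. g n \<beta>))" for \<beta> by (intro boundedI[of _ "B / \<epsilon>"]) auto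
  then obtain l r where r: "strict_mono r" "\<And>\<beta>. \<beta> \<in> exps (2 * k) \<Longrightarrow> (\<lambda>n. g (r n) \<beta>) \<longlonglongrightarrow> l \<beta>"
    using finite_bolzano_weierstrass[OF finite_exps, of "2 * k" g] by blast
  have "l (homog_exp d \<alpha>) = Poly_Mapping.lookup y \<alpha>" if \<alpha>: "\<alpha> \<in> A" for \<alpha>
  proof (rule LIMSEQ_unique)
    show "(\<lambda>n. g (r n) (homog_exp d \<alpha>)) \<longlonglongrightarrow> l (homog_exp d \<alpha>)"
      using mdeg_homog_exp[OF mdeg_A[OF \<alpha>]] k by (intro r(2)) (simp add: exps_def)
    show "(\<lambda>n. g (r n) (homog_exp d \<alpha>)) \<longlonglongrightarrow> Poly_Mapping.lookup y \<alpha>"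
      using LIMSEQ_subseq_LIMSEQ[OF f(2)[OF \<alpha>] r(1)] by (simp add: g(2)[OF \<alpha>] o_def)
  qed
  moreover have "truncated_nonneg E I c k l"
    using truncated_nonneg_limit[OF truncated_nonneg_moments[OF g(1)] r(2)] .
  ultimately have "mvec_of (exps (2 * k)) l \<in> feas k"
    using feasI yc(2) k by blast
  then show ?thesis by blast
qed

text \<open>The homogenization may vanish on the sphere; the constant \<open>e\<close> restores the
  strict positivity that Putinar's theorem demands.\<close>

lemma homogenize_plus_in_cone:
  assumes Q: "\<And>g p. g \<in> weights E I c \<Longrightarrow> g * p\<^sup>2 \<in> Q" "\<And>p q. p \<in> Q \<Longrightarrow> q \<in> Q \<Longrightarrow> p + q \<in> Q"
    and cl: "closed_at_infinity E I c" and q: "Poly_Mapping.keys q \<subseteq> A"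
    and pos: "\<And>x. x \<in> K \<Longrightarrow> 0 \<le> poly_eval q x" and e: "e > 0"
  shows "homogenize d q + e *\<^sub>R 1 \<in> Q"
proof (rule putinar_weights[OF Q fin(1,2)])
  fix z assume "z \<in> semialg_tilde E I c"
  moreover have "tdeg q \<le> d" using q A_d by (auto simp: tdeg_le_iff)
  ultimately show "0 < poly_eval (homogenize d q + e *\<^sub>R 1) z"
    using homogenize_nonneg[OF cl _ pos] e by (simp add: semialg_tilde_def add_nonneg_pos)
qed

text \<open>Feasible points of different orders need not extend one another, so a limit is taken
  along a subsequence of their degree-\<open>d\<close> coordinates. The bounds combine the linear
  constraints with Putinar certificates, which act on the k-th point once \<open>k\<close> is large
  enough for their degree.\<close>

theorem closure_feasible_if_relaxations_feasible:
  assumes cl: "closed_at_infinity E I c" and p: "p \<in> span_minus_cone m1 m a" "p \<in> int_nonneg_polys d K"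
    and feas: "\<And>k. k0 \<le> k \<Longrightarrow> feas k \<noteq> {}"
  shows "closure_moment_system m1 m a b A K \<noteq> {}"
proof -
  have "\<exists>w. k0 \<le> k \<longrightarrow> w \<in> feas k" for k using feas by blast
  then obtain w where w: "\<And>k. k0 \<le> k \<Longrightarrow> w k \<in> feas k" by metis
  define F where "F k = Poly_Mapping.lookup (w k)" for k
  \<comment> \<open>Eventual nonnegativity, because a certificate of given degree is tested only by
    relaxations of sufficiently high order.\<close>
  define Q where "Q = {q. \<forall>\<^sub>F k in sequentially. 0 \<le> lext (F k) q}"
  have Q_weights: "g * q\<^sup>2 \<in> Q" if "g \<in> weights E I c" for g q
    unfolding Q_def mem_Collect_eq
  proof (rule eventually_sequentiallyI[of "max k0 (tdeg g + tdeg q)"])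
    fix k assume "max k0 (tdeg g + tdeg q) \<le> k"
    then have "w k \<in> feas k" "tdeg g + 2 * tdeg q \<le> 2 * k" using w by auto
    then show "0 \<le> lext (F k) (g * q\<^sup>2)"
      using that loc_index_keys unfolding relax_feasible_iff truncated_nonneg_def F_def by blast
  qed
  have Q_add: "q + r \<in> Q" if "q \<in> Q" "r \<in> Q" for q r
  proof -
    have "\<forall>\<^sub>F k in sequentially. 0 \<le> lext (F k) q" "\<forall>\<^sub>F k in sequentially. 0 \<le> lext (F k) r"
      using that by (simp_all add: Q_def)
    then have "\<forall>\<^sub>F k in sequentially. 0 \<le> lext (F k) (q + r)"
      by eventually_elim (simp add: lext_add)
    then show ?thesis by (simp add: Q_def)
  qed
  have pA: "Poly_Mapping.keys p \<subseteq> A"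
    by (rule keys_span_minus_cone[OF p(1)])
  obtain B where B: "\<And>y. lin_constraints m1 m a b y \<Longrightarrow> pairing p y \<le> B"
    using span_minus_cone_bound[OF p(1)] by metis
  obtain \<epsilon> where \<epsilon>: "\<epsilon> > 0" "\<And>z. z \<in> semialg_tilde E I c \<Longrightarrow> \<epsilon> \<le> poly_eval (homogenize d p) z"
    using positive_lower_bound[OF cl p(2)] by blast
  \<comment> \<open>Subtracting only half of \<epsilon> keeps the polynomial strictly positive; the
    resulting inequality bounds the mass \<open>F k 0\<close> by the pairing with
    \<open>p\<close>.\<close>
  have "homogenize d p - (\<epsilon> / 2) *\<^sub>R 1 \<in> Q"
    by (rule putinar_weights[OF Q_weights Q_add fin(1,2)]) (use \<epsilon> in force)+
  then have "\<forall>\<^sub>F k in sequentially. 0 \<le> lext (F k) (homogenize d p - (\<epsilon> / 2) *\<^sub>R 1)"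
    by (simp add: Q_def)
  then have mass: "\<forall>\<^sub>F k in sequentially. F k 0 \<le> 2 * B / \<epsilon>"
    using eventually_ge_at_top[of k0]
  proof eventually_elim
    case (elim k)
    have "lext (F k) (homogenize d p) \<le> B"
      using B[OF lin_constraints_dehom[OF w[OF elim(2)]]] pairing_dehom[OF pA] by (simp add: F_def)
    then have "\<epsilon> / 2 * F k 0 \<le> B" using elim(1) by (simp add: lext_diff lext_scaleR)
    then show ?case using \<epsilon>(1) by (simp add: field_simps)
  qed
  define M where "M = 2 * B / \<epsilon>"
  \<comment> \<open>2 - x^\<beta> and 2 + x^\<beta> are strictly positive on the sphere, so every
    coordinate is eventually at most twice the mass. The threshold depends on \<beta>, which is why
    only the finitely many coordinates from \<open>A\<close> are bounded together.\<close>
  have coeff: "\<forall>\<^sub>F k in sequentially. \<bar>F k \<beta>\<bar> \<le> 2 * M" for \<beta>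
  proof -
    have "2 *\<^sub>R 1 - e *\<^sub>R mmonom \<beta> \<in> Q" if "\<bar>e\<bar> = 1" for e :: real
    proof (rule putinar_weights[OF Q_weights Q_add fin(1,2)])
      fix z assume "z \<in> semialg_tilde E I c"
      then have "\<bar>e * mono_eval \<beta> z\<bar> \<le> 1" using abs_mono_eval_le_1 that by (simp add: abs_mult)
      then show "0 < poly_eval (2 *\<^sub>R 1 - e *\<^sub>R mmonom \<beta>) z" by simp
    qed
    from this[of 1] this[of "- 1"]
    have "\<forall>\<^sub>F k in sequentially. F k \<beta> \<le> 2 * F k 0" "\<forall>\<^sub>F k in sequentially. 0 \<le> 2 * F k 0 + F k \<beta>"
      by (simp_all add: Q_def lext_diff lext_add lext_scaleR)
    then show ?thesis using mass by eventually_elim (auto simp: M_def)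
  qed
  then have "\<forall>\<^sub>F k in sequentially. \<forall>\<alpha>\<in>A. \<bar>F k (homog_exp d \<alpha>)\<bar> \<le> 2 * M"
    by (intro eventually_ball_finite fin(3)) auto
  then have "\<forall>\<^sub>F k in sequentially. (\<forall>\<alpha>\<in>A. \<bar>F k (homog_exp d \<alpha>)\<bar> \<le> 2 * M) \<and> F k 0 \<le> M \<and> k0 \<le> k"
    using mass eventually_ge_at_top[of k0] by eventually_elim (auto simp: M_def)
  then obtain N where N: "\<And>k. N \<le> k \<Longrightarrow> (\<forall>\<alpha>\<in>A. \<bar>F k (homog_exp d \<alpha>)\<bar> \<le> 2 * M) \<and> F k 0 \<le> M \<and> k0 \<le> k"
    unfolding eventually_sequentially by blast
  let ?h = "\<lambda>n \<alpha>. F (n + N) (homog_exp d \<alpha>)"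
  have "bounded (range (\<lambda>n. ?h n \<alpha>))" if "\<alpha> \<in> A" for \<alpha>
    using N that by (intro boundedI[of _ "2 * M"]) auto
  then obtain l r where r: "strict_mono r" "\<And>\<alpha>. \<alpha> \<in> A \<Longrightarrow> (\<lambda>n. ?h (r n) \<alpha>) \<longlonglongrightarrow> l \<alpha>"
    using finite_bolzano_weierstrass[OF fin(3), of ?h] by blast
  define y where "y = mvec_of A l"
  have lim: "(\<lambda>n. lext (F (r n + N)) (homogenize d q)) \<longlonglongrightarrow> pairing q y" if "Poly_Mapping.keys q \<subseteq> A" for q
    unfolding lext_homogenize y_def pairing_mvec_of[OF fin(3) that]
    using r(2) that by (intro tendsto_lext) auto
  have "0 \<le> pairing q y"
    if q: "Poly_Mapping.keys q \<subseteq> A" "\<And>x. x \<in> K \<Longrightarrow> 0 \<le> poly_eval q x" for q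
  proof (rule field_le_epsilon)
    fix e :: real assume e: "e > 0"
    \<comment> \<open>Makes e' times the mass at most \<open>e\<close>; |M| + 1 is positive whatever
      the sign of \<open>M\<close>.\<close>
    define e' where "e' = e / (\<bar>M\<bar> + 1)"
    have e': "e' > 0" using e by (simp add: e'_def add_nonneg_pos)
    have "homogenize d q + e' *\<^sub>R 1 \<in> Q"
      by (rule homogenize_plus_in_cone[OF Q_weights Q_add cl q(1) q(2) e'])
    then have ev: "\<forall>\<^sub>F k in sequentially. 0 \<le> lext (F k) (homogenize d q) + e' * F k 0"
      by (simp add: Q_def lext_add lext_scaleR)
    have "strict_mono (\<lambda>n. r n + N)" using r(1) by (simp add: strict_mono_def)
    from eventually_subseq[OF this ev]
    have "\<forall>\<^sub>F n in sequentially. - e \<le> lext (F (r n + N)) (homogenize d q)"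
    proof eventually_elim
      case (elim n)
      have "e' * F (r n + N) 0 \<le> e' * (\<bar>M\<bar> + 1)" using N[of "r n + N"] e' by (intro mult_left_mono) auto
      then show ?case using elim by (simp add: e'_def)
    qed
    from tendsto_lowerbound[OF lim[OF q(1)] this] show "0 \<le> pairing q y + e" by simp
  qed
  then have "y \<in> closure (moment_cone A K)"
    using fin(3) by (intro closure_moment_coneI) (auto simp: y_def)
  moreover have "lin_constraints m1 m a b y"
    unfolding lin_constraints_def
  proof (intro conjI ballI)
    have lin: "lin_constraints m1 m a b (dehom (F (r n + N)))" for n
      unfolding F_def by (rule lin_constraints_dehom[OF w]) (use N[of "r n + N"] in simp)
    have pair: "pairing (a i) (dehom (F (r n + N))) = lext (F (r n + N)) (homogenize d (a i))"
      if "i \<in> {1..m}" for i n by (rule pairing_dehom[OF keys_a[OF that]])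
    fix i
    show "pairing (a i) y = b i" if i: "i \<in> {1..m1}"
    proof -
      have im: "i \<in> {1..m}" using i m by auto
      have "lext (F (r n + N)) (homogenize d (a i)) = b i" for n
        using lin[of n] pair[OF im, of n] i unfolding lin_constraints_def by simp
      then show ?thesis using lim[OF keys_a[OF im]] by (simp add: LIMSEQ_const_iff)
    qed
    show "b i \<le> pairing (a i) y" if i: "i \<in> {m1<..m}"
    proof -
      have im: "i \<in> {1..m}" using i by auto
      have "b i \<le> lext (F (r n + N)) (homogenize d (a i))" for n
        unfolding pair[OF im, symmetric] using lin[of n] i unfolding lin_constraints_def by blast
      then show ?thesis by (intro LIMSEQ_le_const[OF lim[OF keys_a[OF im]]]) auto
    qed
  qed
  ultimately show ?thesis by (auto simp: closure_moment_system_def)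
qed

text \<open>Every polynomial has a representative of degree at most \<open>s\<close>, and the
  weights have degree at most twice \<open>deg_K E I c\<close>, which is t - s. The weighted square
  of the representative thus has degree at most 2 t, where feasibility of \<open>w\<close> gives the
  sign, and the extension is nonnegative on weighted squares of every degree.\<close>

theorem closure_feasible_if_flat:
  assumes cl: "closed_at_infinity E I c" and w: "w \<in> feas k" and t: "t \<le> k" "d \<le> 2 * t"
    and flat: "flat E I c t (truncate (2 * t) w)"
  shows "closure_moment_system m1 m a b A K \<noteq> {}"
proof -
  let ?u = "Poly_Mapping.lookup (truncate (2 * t) w)" and ?w = "Poly_Mapping.lookup w"
  define s where "s = t - deg_K E I c"
  have tD: "s + deg_K E I c \<le> t" using flat by (simp add: flat_def s_def)
  have uw: "lext ?u q = lext ?w q" if "q \<in> polys (2 * t)" for q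
    using that by (intro lext_cong) (auto simp: lookup_truncate polys_iff exps_def)
  interpret flat_functional ?u s t
    unfolding s_def by (rule flat_imp_flat_functional[OF fin(1,2) flat])
  define Q where "Q = {q. 0 \<le> extension q}"
  have Q_weights: "g * q\<^sup>2 \<in> Q" if g: "g \<in> weights E I c" for g q
  proof -
    obtain q' where q': "q' \<in> polys s" "lext \<Phi> q = T q'" using lext_\<Phi>_in_H by blast
    have gD: "g \<in> polys (2 * deg_K E I c)" by (rule weights_polys[OF fin(1,2) g])
    have "extension (g * q\<^sup>2) = lext ?u (g * q'\<^sup>2)"
      by (rule extension_weighted_square[OF q'(2,1) gD tD])
    also have "\<dots> = lext ?w (g * q'\<^sup>2)"
      unfolding power2_eq_square
      by (intro uw mult_polys[OF gD mult_polys[OF q'(1) q'(1) order_refl]]) (use tD in simp)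
    also have "0 \<le> \<dots>"
    proof -
      have "Poly_Mapping.keys q' \<subseteq> loc_index g k"
        using gD q'(1) tD t(1) by (intro loc_index_keys) (simp add: polys_def)
      then show ?thesis using w g unfolding relax_feasible_iff truncated_nonneg_def by blast
    qed
    finally show ?thesis by (simp add: Q_def)
  qed
  have Q_add: "q + r \<in> Q" if "q \<in> Q" "r \<in> Q" for q r
    using that by (simp add: Q_def linear_add[OF linear_extension])
  have "0 \<le> pairing q (dehom ?w)"
    if q: "Poly_Mapping.keys q \<subseteq> A" "\<And>x. x \<in> K \<Longrightarrow> 0 \<le> poly_eval q x" for q
  proof -
    \<comment> \<open>The functional is fixed, so letting \<open>e\<close> tend to 0 from the right
      removes the perturbation.\<close>
    have "0 \<le> extension (homogenize d q) + e * extension 1" if "e > 0" for e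
      using homogenize_plus_in_cone[OF Q_weights Q_add cl q(1) q(2) that]
      by (simp add: Q_def linear_add[OF linear_extension] linear_scale[OF linear_extension])
    then have "\<forall>\<^sub>F e in at_right 0. 0 \<le> extension (homogenize d q) + e * extension 1"
      by (intro eventually_at_right_less[THEN eventually_mono]) auto
    moreover have "((\<lambda>e. extension (homogenize d q) + e * extension 1)
        \<longlongrightarrow> extension (homogenize d q) + 0 * extension 1) (at_right 0)"
      by (intro tendsto_intros)
    ultimately have "0 \<le> extension (homogenize d q) + 0 * extension 1"
      by (intro tendsto_lowerbound) auto
    moreover have hq: "homogenize d q \<in> polys (2 * t)"
      unfolding homogenize_def
    proof (intro subspace_sum subspace_polys)
      fix \<alpha> assume "\<alpha> \<in> Poly_Mapping.keys q"
      then have "mdeg (homog_exp d \<alpha>) = d" using q(1) mdeg_A by (intro mdeg_homog_exp) auto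
      then show "Poly_Mapping.single (homog_exp d \<alpha>) (mcoeff q \<alpha>) \<in> polys (2 * t)"
        using t(2) by (simp add: polys_iff exps_def)
    qed
    ultimately show ?thesis
      using extension_eq[OF hq] uw[OF hq] pairing_dehom[OF q(1)] by simp
  qed
  then have "dehom ?w \<in> closure (moment_cone A K)"
    by (intro closure_moment_coneI fin(3) dehom_in) auto
  then show ?thesis using lin_constraints_dehom[OF w] by (auto simp: closure_moment_system_def)
qed

text \<open>Almost every point lies in the support, so Richter's theorem finds atoms with x_0 > 0.
  They project to \<open>K\<close>, each with its mass multiplied by x_0^d.\<close>

theorem feasible_if_affine_representing_measure:
  assumes w: "w \<in> feas k" and t: "d \<le> 2 * t"
    and \<nu>: "representing_measure (exps (2 * t)) (semialg_tilde E I c) (truncate (2 * t) w) \<nu>"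
      "supp \<nu> \<subseteq> {z. z $ None > 0}"
  shows "moment_system m1 m a b A K \<noteq> {}"
proof -
  have sets: "sets \<nu> = sets borel" and supp: "supp \<nu> \<subseteq> semialg_tilde E I c"
    and int: "\<And>\<beta>. \<beta> \<in> exps (2 * t) \<Longrightarrow> integrable \<nu> (mono_eval \<beta>)"
    "\<And>\<beta>. \<beta> \<in> exps (2 * t) \<Longrightarrow> Poly_Mapping.lookup (truncate (2 * t) w) \<beta> = (\<integral>z. mono_eval \<beta> z \<partial>\<nu>)"
    using \<nu>(1) unfolding representing_measure_def by auto
  have "AE z in \<nu>. z \<in> semialg_tilde_pos E I c"
    using AE_in_supp[OF sets] supp \<nu>(2) by (auto elim!: eventually_mono)
  then obtain g where g: "g \<in> moments (semialg_tilde_pos E I c)"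
    "\<And>\<beta>. \<beta> \<in> exps (2 * t) \<Longrightarrow> g \<beta> = (\<integral>z. mono_eval \<beta> z \<partial>\<nu>)"
    using richter[OF finite_exps[of "2 * t"], of \<nu> "\<lambda>z \<beta>. mono_eval \<beta> z"] int(1) by blast
  obtain f where f: "f \<in> moments K" "\<And>\<alpha>. mdeg \<alpha> \<le> d \<Longrightarrow> g (homog_exp d \<alpha>) = f \<alpha>"
    using moments_affine[OF g(1)] by metis
  have "Poly_Mapping.lookup (dehom (Poly_Mapping.lookup w)) \<alpha> = f \<alpha>" if \<alpha>: "\<alpha> \<in> A" for \<alpha>
  proof -
    have "homog_exp d \<alpha> \<in> exps (2 * t)"
      using mdeg_homog_exp[OF mdeg_A[OF \<alpha>]] t by (simp add: exps_def)
    then have "Poly_Mapping.lookup w (homog_exp d \<alpha>) = g (homog_exp d \<alpha>)"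
      using int(2) g(2) by (simp add: lookup_truncate)
    then show ?thesis using f(2)[OF mdeg_A[OF \<alpha>]] by (simp add: lookup_dehom[OF \<alpha>])
  qed
  then have "dehom (Poly_Mapping.lookup w) \<in> moment_cone A K"
    unfolding moment_cone_iff[OF fin(3)] using dehom_in f(1) by blast
  then show ?thesis using lin_constraints_dehom[OF w] by (auto simp: moment_system_def)
qed

end

theorem theorem4p2:
  fixes c :: "'l \<Rightarrow> 'n::finite mpoly"
    and E I :: "'l set"
    and A :: "'n exponent set"
    and a :: "nat \<Rightarrow> 'n mpoly"
    and b :: "nat \<Rightarrow> real"
    and m m1 d d1 :: nat
    and f :: "'n option mpoly"
    and K :: "(real ^ 'n) set"
  assumes "finite E" and "finite I"
    and "K = semialg E I c"
    and "finite A" and "d = set_deg A"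
    and "m1 \<le> m" and "\<forall>i\<in>{1..m}. a i \<in> poly_space A"
    and "even d1" and "d < d1" and "f \<in> polys d1"
  shows
    "((\<exists>k. d1 \<le> 2 * k \<and> relax_feasible E I c m1 m a b d k = {})
        \<longrightarrow> moment_system m1 m a b A K = {})
    \<and> (closed_at_infinity E I c \<and> span_minus_cone m1 m a \<inter> int_nonneg_polys d K \<noteq> {}
        \<longrightarrow> (closure_moment_system m1 m a b A K = {}
             \<longleftrightarrow> (\<exists>k. d1 \<le> 2 * k \<and> relax_feasible E I c m1 m a b d k = {})))
    \<and> (closed_at_infinity E I c
        \<longrightarrow> (\<forall>k t w. d1 \<le> 2 * k \<and> relax_minimizer E I c m1 m a b d f k w
              \<and> t \<le> k \<and> d \<le> 2 * t \<and> flat E I c t (truncate (2 * t) w)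
            \<longrightarrow> closure_moment_system m1 m a b A K \<noteq> {}
              \<and> (\<forall>\<nu>. representing_measure (exps (2 * t)) (semialg_tilde E I c)
                      (truncate (2 * t) w) \<nu>
                    \<and> supp \<nu> \<subseteq> {z. z $ None > 0}
                  \<longrightarrow> moment_system m1 m a b A K \<noteq> {})))"
proof -
  have A_d: "A \<subseteq> exps d"
    unfolding \<open>d = set_deg A\<close> set_deg_def exps_def using \<open>finite A\<close>
    by (auto intro!: cSUP_upper bdd_above_finite)
  interpret moment_problem E I c A a b m1 m d
    by unfold_locales (use assms A_d poly_space_subset_mvecs[of A] in auto)
  show ?thesis
    unfolding \<open>K = semialg E I c\<close>
  proof (intro conjI impI allI)
    assume "\<exists>k. d1 \<le> 2 * k \<and> feas k = {}"
    then show "moment_system m1 m a b A (semialg E I c) = {}"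
      using infeasible_if_relaxation_infeasible \<open>d < d1\<close> by (meson less_imp_le order_trans)
  next
    assume "closed_at_infinity E I c \<and> span_minus_cone m1 m a \<inter> int_nonneg_polys d (semialg E I c) \<noteq> {}"
    then obtain p where cl: "closed_at_infinity E I c" and p: "p \<in> span_minus_cone m1 m a"
      "p \<in> int_nonneg_polys d (semialg E I c)" by blast
    show "closure_moment_system m1 m a b A (semialg E I c) = {} \<longleftrightarrow> (\<exists>k. d1 \<le> 2 * k \<and> feas k = {})"
    proof
      assume empty: "closure_moment_system m1 m a b A (semialg E I c) = {}"
      show "\<exists>k. d1 \<le> 2 * k \<and> feas k = {}"
      proof (rule ccontr)
        assume "\<not> ?thesis"
        \<comment> \<open>The threshold \<open>d1\<close> suffices, since d1 \<le> k implies d1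
          \<le> 2 k.\<close>
        then have "feas k \<noteq> {}" if "d1 \<le> k" for k using that by (metis le_add1 mult_2 order_trans)
        from closure_feasible_if_relaxations_feasible[OF cl p this] empty show False by blast
      qed
    next
      assume "\<exists>k. d1 \<le> 2 * k \<and> feas k = {}"
      then obtain k where k: "d1 \<le> 2 * k" "feas k = {}" by blast
      then have "d \<le> 2 * k" using \<open>d < d1\<close> by linarith
      then show "closure_moment_system m1 m a b A (semialg E I c) = {}"
        using relaxation_feasible_if_closure_feasible[OF cl p] k(2) by blast
    qed
  next
    fix k t w
    assume cl: "closed_at_infinity E I c" and *: "d1 \<le> 2 * k \<and> relax_minimizer E I c m1 m a b d f k w
      \<and> t \<le> k \<and> d \<le> 2 * t \<and> flat E I c t (truncate (2 * t) w)"
    then have w: "w \<in> feas k" by (simp add: relax_minimizer_def)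
    show "closure_moment_system m1 m a b A (semialg E I c) \<noteq> {}"
      using closure_feasible_if_flat[OF cl w] * by blast
    fix \<nu>
    assume "representing_measure (exps (2 * t)) (semialg_tilde E I c) (truncate (2 * t) w) \<nu>
      \<and> supp \<nu> \<subseteq> {z. z $ None > 0}"
    then show "moment_system m1 m a b A (semialg E I c) \<noteq> {}"
      using feasible_if_affine_representing_measure[OF w] * by blast
  qed
qed

end
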